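(* Let $\mathcal P$ be a space-time partition obtained from $\mathcal P_0$ by a finite number of applications of $\mathrm{ATOMIC\_SPLIT}(\cdot,d,s_1,s_2)$ which is conforming in space, additionally 1-irregular in space if $d=1$, and 1-irregular in time, and let $I\times S\in\mathcal P$. Then the algorithm $\mathrm{PATCH\_REFINE}(\mathcal P,I\times S,d,s_1,s_2)$ terminates; the space-time partition $\mathcal P':=\mathrm{PATCH\_REFINE}(\mathcal P,I\times S,d,s_1,s_2)$ again has all these properties (obtained from $\mathcal P_0$ by finitely many atomic splits, conforming in space, 1-irregular in time, and 1-irregular in space if $d=1$); and the minimum number of applications of $\mathrm{ATOMIC\_SPLIT}(\cdot,d,s_1,s_2)$ has been used in order to atomically refine $I\times S$ while maintaining these properties. Further, any newly created element has level less than or equal to $\ell(I\times S)+1$.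
   Context: SETTING. Let $d\in\mathbb N$, $T\in(0,\infty)$, $\Omega\subset\mathbb R^d$ a bounded polyhedral Lipschitz domain, $\Omega_T=[0,T]\times\Omega$, $s_1,s_2\in(0,\infty)$. $|\cdot|$ is Lebesgue measure of the appropriate dimension. A prism is $I\times S$ with an interval $I\subset[0,T]$ and a closed $d$-simplex $S$; a space-time partition is a finite non-overlapping covering of $\Omega_T$ by prisms. Fixed initial partition: $\mathcal P_0=\{I\times S: I\in\mathcal I_0,S\in\mathcal T_0\}$, where $\mathcal I_0=\{[t_i,t_{i+1}):0\le i\le M-2\}\cup\{[t_{M-1},t_M]\}$, $0=t_0<\dots<t_M=T$, and $\mathcal T_0$ is a non-overlapping, conforming (two simplices are equal, disjoint, or meet in a common face of both), well-labeled (see below) simplicial triangulation of $\Omega$ by closed simplices. BISECTION. $\mathrm{BISECT}(1,I)$ halves an interval at its midpoint (half-open into two half-open intervals, closed into one half-open and one closed). For $d\ge2$ simplices are tagged: $S=(x_0,\dots,x_d)_\gamma$, ordered vertices, type $\gamma\in\{0,\dots,d-1\}$. The refinement edge is $\mathrm{RE}(S)=\overline{x_0x_d}$ and $\mathrm{BISECT}(d,S)$ consists of the closed tagged simplices $(x_0,\frac{x_0+x_d}2,x_1,\dots,x_\gamma,x_{\gamma+1},\dots,x_{d-1})_{(\gamma+1)\bmod d}$ and $(x_d,\frac{x_0+x_d}2,x_1,\dots,x_\gamma,x_{d-1},\dots,x_{\gamma+1})_{(\gamma+1)\bmod d}$. Put $S_R=(x_d,x_1,\dots,x_\gamma,x_{d-1},\dots,x_{\gamma+1},x_0)_\gamma$.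 Two tagged simplices $S,S'$ of equal type sharing a hyperface are reflected neighbours if the vertex sequence of $S$ or of $S_R$ agrees with that of $S'$ in all but one position. $\mathcal T_0$ is well-labeled if all its simplices have the same type and, whenever $S,S'\in\mathcal T_0$ share a hyperface: if $\mathrm{RE}(S)\subset S\cap S'$ or $\mathrm{RE}(S')\subset S\cap S'$, then $S,S'$ are reflected neighbours; otherwise the children of $S$ and $S'$ containing this hyperface are reflected neighbours. For $d=1$, $\mathrm{BISECT}(d,S)$ halves $S$ into two closed intervals, $\mathrm{RE}(S)=\emptyset$, and no labeling condition is imposed. $\mathrm{BISECT}(\cdot,R)^{\otimes m}$ is the set of results of $m$ successive bisections; the level $\ell(S)$ is the number of bisections producing $S$ from $\mathcal T_0$. ATOMIC SPLIT. With $n=\ell(S)+1$, $m=\lceil\frac{ns_2}{s_1d}\rceil-\lceil\frac{(n-1)s_2}{s_1d}\rceil$: $\mathrm{ATOMIC\_SPLIT}(I\times S,d,s_1,s_2)=\{I'\times S':I'\in\mathrm{BISECT}(1,I)^{\otimes m},S'\in\mathrm{BISECT}(d,S)\}$. The level $\ell(I\times S)$ is the number of atomic splits producing $I\times S$ from $\mathcal P_0$; $\ell(I\times S)=\ell(S)$. MESH PROPERTIES. $\mathcal P$ is conforming in space if for every $t\in[0,T]$ the active triangulation $\mathcal T(t,\mathcal P)=\{S: I\times S\in\mathcal P,\ t\in I\}$ is conforming. $\mathcal P$ is 1-irregular in time if the levels of any two elements $I\times S,I'\times S'\in\mathcal P$ that touch in time (i.e. $\#(\overline I\cap\overline{I'})=1$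 and their closures share a $d$-dimensional piece of hyperface, $\dim(S\cap S')=d$) differ by at most one. For $d=1$, $\mathcal P$ is 1-irregular in space if the levels of any two elements touching in space ($|I\cap I'|>0$, $\#(S\cap S')=1$) differ by at most one. PATCH REFINEMENT. Put $\mathcal N=\mathcal N_t\cup\mathcal N_{\boldsymbol x}$, where $\mathcal N_t(I\times S,\mathcal P)$ is the set of $I'\times S'\in\mathcal P\setminus\{I\times S\}$ with $\#(\overline I\cap\overline{I'})=1$, $\dim(S\cap S')=d$, $\ell(I'\times S')=\ell(I\times S)-1$; and $\mathcal N_{\boldsymbol x}(I\times S,\mathcal P)$ is the set of $I'\times S'\in\mathcal P\setminus\{I\times S\}$ with $|I\cap I'|>0$ and, if $d\ge2$: $1\le\dim(S\cap S')\le d-1$ and $\mathrm{RE}(S)\subset S'$; if $d=1$: $\#(S\cap S')=1$ and $\ell(I'\times S')=\ell(I\times S)-1$. $\mathrm{PATCH\_REFINE}(\mathcal P,I\times S,d,s_1,s_2)$: set $K:=\emptyset$, $F:=\{I\times S\}$. While $F\ne\emptyset$: set $F_{new}:=\emptyset$; for every $I'\times S'\in F$ and every $I''\times S''\in\mathcal N(I'\times S',\mathcal P)\setminus(K\cup F)$ ($\mathcal P$ being the current partition): if $\ell(I''\times S'')=\ell(I'\times S')$ add $I''\times S''$ to $F_{new}$; else set $\mathcal P_{old}:=\mathcal P$, $\mathcal P:=\mathrm{PATCH\_REFINE}(\mathcal P,I''\times S'',d,s_1,s_2)$ and, if $I''\times S''\in\mathcal N_{\boldsymbol x}(I'\times S',\mathcal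 P_{old})$, add to $F_{new}$ all elements of $\mathrm{ATOMIC\_SPLIT}(I''\times S'',d,s_1,s_2)$ lying in $\mathcal N(I'\times S',\mathcal P)$. Then $K:=K\cup F$, $F:=F_{new}$. Finally return $(\mathcal P\setminus K)\cup\bigcup_{Q\in K}\mathrm{ATOMIC\_SPLIT}(Q,d,s_1,s_2)$.
   Formalization: In the for-loop of PATCH_REFINE, whose order is left open, a neighbour coarser by two or more levels must wait while one of equal level or one level coarser is pending; otherwise, for d ≥ 3, the algorithm can return overlapping prisms. All other choices stay arbitrary. *)

theory Defs
  imports "HOL-Analysis.Analysis"
begin

section \<open>The spatial domain\<close>

text \<open>Near each boundary point the domain is, in suitable Cartesian coordinates, the strict
  subgraph of a Lipschitz function; \<^term>\<open>e\<close> is the vertical direction and the function lives on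
  the hyperplane orthogonal to it.\<close>

definition lipschitz_boundary :: "'a::euclidean_space set \<Rightarrow> bool" where
  "lipschitz_boundary \<Omega> \<longleftrightarrow>
    (\<forall>x\<in>frontier \<Omega>. \<exists>e \<phi> L r. norm e = 1 \<and> 0 < r \<and> L-lipschitz_on {z. z \<bullet> e = 0} \<phi> \<and>
       \<Omega> \<inter> ball x r = {y \<in> ball x r. y \<bullet> e < \<phi> (y - (y \<bullet> e) *\<^sub>R e)})"

definition polyhedral_lipschitz_domain :: "'a::euclidean_space set \<Rightarrow> bool" where
  "polyhedral_lipschitz_domain \<Omega> \<longleftrightarrow>
     open \<Omega> \<and> connected \<Omega> \<and> \<Omega> \<noteq> {} \<and> bounded \<Omega> \<and> lipschitz_boundary \<Omega> \<and>
     (\<exists>\<F>. finite \<F> \<and> (\<forall>p\<in>\<F>. polytope p) \<and> closure \<Omega> = \<Union>\<F>)"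

definition nonoverlapping :: "'a::topological_space set \<Rightarrow> 'a set \<Rightarrow> bool" where
  "nonoverlapping A B \<longleftrightarrow> interior A \<inter> interior B = {}"


section \<open>Tagged simplices and their bisection\<close>

text \<open>The dimension $d$ is \<open>DIM('a)\<close>. For $d = 1$ the tag carries no information: the type is
  $0$, and the vertex order does not influence any of the notions below.\<close>

datatype 'a tsimplex = TSimplex (verts: "'a list") (stype: nat)

definition tagged_simplex :: "'a::euclidean_space tsimplex \<Rightarrow> bool" where
  "tagged_simplex S \<longleftrightarrow> length (verts S) = DIM('a) + 1 \<and> distinct (verts S) \<and>
     \<not> affine_dependent (set (verts S)) \<and> stype S < DIM('a)"

definition pts :: "'a::euclidean_space tsimplex \<Rightarrow> 'a set" where
  "pts S = convex hull (set (verts S))"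

definition RE :: "'a::euclidean_space tsimplex \<Rightarrow> 'a set" where
  "RE S = (if DIM('a) = 1 then {} else closed_segment (hd (verts S)) (last (verts S)))"

text \<open>The list \<^term>\<open>inner_verts S\<close> is $x_1, \dots, x_{d-1}$. In dimension one it is empty and
  \<^term>\<open>bisect S\<close> consists of the two closed halves of the segment.\<close>

definition inner_verts :: "'a::euclidean_space tsimplex \<Rightarrow> 'a list" where
  "inner_verts S = butlast (tl (verts S))"

definition bisect :: "'a::euclidean_space tsimplex \<Rightarrow> 'a tsimplex set" where
  "bisect S =
    (let x0 = hd (verts S); xd = last (verts S); xs = inner_verts S; \<gamma> = stype S;
         \<gamma>' = (\<gamma> + 1) mod DIM('a)
     in {TSimplex (x0 # midpoint x0 xd # take \<gamma> xs @ drop \<gamma> xs) \<gamma>',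
         TSimplex (xd # midpoint x0 xd # take \<gamma> xs @ rev (drop \<gamma> xs)) \<gamma>'})"

definition reflect :: "'a::euclidean_space tsimplex \<Rightarrow> 'a tsimplex" where
  "reflect S =
    (let xs = inner_verts S; \<gamma> = stype S
     in TSimplex (last (verts S) # take \<gamma> xs @ rev (drop \<gamma> xs) @ [hd (verts S)]) \<gamma>)"

definition share_hyperface :: "'a::euclidean_space tsimplex \<Rightarrow> 'a tsimplex \<Rightarrow> bool" where
  "share_hyperface S S' \<longleftrightarrow>
     (pts S \<inter> pts S') facet_of pts S \<and> (pts S \<inter> pts S') facet_of pts S'"

definition differ_once :: "'b list \<Rightarrow> 'b list \<Rightarrow> bool" where
  "differ_once xs ys \<longleftrightarrow> length xs = length ys \<and> card {i. i < length xs \<and> xs ! i \<noteq> ys ! i} = 1"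

definition reflected_neighbours :: "'a::euclidean_space tsimplex \<Rightarrow> 'a tsimplex \<Rightarrow> bool" where
  "reflected_neighbours S S' \<longleftrightarrow> stype S = stype S' \<and> share_hyperface S S' \<and>
     (differ_once (verts S) (verts S') \<or> differ_once (verts (reflect S)) (verts S'))"

definition well_labeled :: "'a::euclidean_space tsimplex set \<Rightarrow> bool" where
  "well_labeled \<T> \<longleftrightarrow>
    (\<forall>S\<in>\<T>. \<forall>S'\<in>\<T>. stype S = stype S') \<and>
    (\<forall>S\<in>\<T>. \<forall>S'\<in>\<T>. share_hyperface S S' \<longrightarrow>
       (if RE S \<subseteq> pts S \<inter> pts S' \<or> RE S' \<subseteq> pts S \<inter> pts S' then reflected_neighbours S S'
        else (\<forall>C\<in>bisect S. \<forall>C'\<in>bisect S'.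
                pts S \<inter> pts S' \<subseteq> pts C \<and> pts S \<inter> pts S' \<subseteq> pts C' \<longrightarrow> reflected_neighbours C C')))"

definition conforming :: "'a::euclidean_space tsimplex set \<Rightarrow> bool" where
  "conforming \<T> \<longleftrightarrow> (\<forall>S\<in>\<T>. \<forall>S'\<in>\<T>. pts S = pts S' \<or> pts S \<inter> pts S' = {} \<or>
     (pts S \<inter> pts S') face_of pts S \<and> (pts S \<inter> pts S') face_of pts S')"

definition initial_triangulation :: "'a::euclidean_space set \<Rightarrow> 'a tsimplex set \<Rightarrow> bool" where
  "initial_triangulation \<Omega> \<T>\<^sub>0 \<longleftrightarrow> finite \<T>\<^sub>0 \<and> (\<forall>S\<in>\<T>\<^sub>0. tagged_simplex S) \<and>
     (\<forall>S\<in>\<T>\<^sub>0. \<forall>S'\<in>\<T>\<^sub>0. S \<noteq> S' \<longrightarrow> nonoverlapping (pts S) (pts S')) \<and>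
     (\<Union>S\<in>\<T>\<^sub>0. pts S) = closure \<Omega> \<and> conforming \<T>\<^sub>0 \<and> (2 \<le> DIM('a) \<longrightarrow> well_labeled \<T>\<^sub>0)"


section \<open>Time intervals\<close>

definition bisect_interval :: "real set \<Rightarrow> real set set" where
  "bisect_interval I =
    (let a = Inf I; b = Sup I; m = (a + b) / 2
     in {{a..<m}, if b \<in> I then {m..b} else {m..<b}})"

definition time_grid :: "real \<Rightarrow> nat \<Rightarrow> (nat \<Rightarrow> real) \<Rightarrow> bool" where
  "time_grid T M t \<longleftrightarrow> 1 \<le> M \<and> t 0 = 0 \<and> t M = T \<and> (\<forall>i<M. t i < t (Suc i))"

definition initial_intervals :: "nat \<Rightarrow> (nat \<Rightarrow> real) \<Rightarrow> real set set" where
  "initial_intervals M t = {{t i..<t (Suc i)} |i. Suc i < M} \<union> {{t (M - 1)..t M}}"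

text \<open>The set of results of $m$ successive bisections.\<close>

fun iterated :: "('b \<Rightarrow> 'b set) \<Rightarrow> nat \<Rightarrow> 'b \<Rightarrow> 'b set" where
  "iterated f 0 R = {R}"
| "iterated f (Suc m) R = (\<Union>R'\<in>iterated f m R. f R')"


section \<open>Prisms, levels, atomic splits\<close>

text \<open>The pair \<^term>\<open>(I, S)\<close> stands for the prism $I \times S$, whose points form \<^term>\<open>I \<times> pts S\<close>.\<close>

type_synonym 'a prism = "real set \<times> 'a tsimplex"

definition simplex_level :: "'a::euclidean_space tsimplex set \<Rightarrow> 'a tsimplex \<Rightarrow> nat" where
  "simplex_level \<T>\<^sub>0 S = (LEAST n. \<exists>S\<^sub>0\<in>\<T>\<^sub>0. S \<in> iterated bisect n S\<^sub>0)"

definition level :: "'a::euclidean_space tsimplex set \<Rightarrow> 'a prism \<Rightarrow> nat" where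
  "level \<T>\<^sub>0 Q = simplex_level \<T>\<^sub>0 (snd Q)"

definition atomic_split ::
  "'a::euclidean_space tsimplex set \<Rightarrow> real \<Rightarrow> real \<Rightarrow> 'a prism \<Rightarrow> 'a prism set" where
  "atomic_split \<T>\<^sub>0 s1 s2 Q =
    (let n = simplex_level \<T>\<^sub>0 (snd Q) + 1;
         m = nat (\<lceil>real n * s2 / (s1 * real DIM('a))\<rceil> - \<lceil>real (n - 1) * s2 / (s1 * real DIM('a))\<rceil>)
     in iterated bisect_interval m (fst Q) \<times> bisect (snd Q))"

definition atomic_step ::
  "'a::euclidean_space tsimplex set \<Rightarrow> real \<Rightarrow> real \<Rightarrow> 'a prism set \<Rightarrow> 'a prism set \<Rightarrow> bool" where
  "atomic_step \<T>\<^sub>0 s1 s2 P P' \<longleftrightarrow> (\<exists>Q\<in>P. P' = (P - {Q}) \<union> atomic_split \<T>\<^sub>0 s1 s2 Q)"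

text \<open>The simplices are closed, so the covered set is $[0,T] \times \overline\Omega$.\<close>

definition space_time_partition ::
  "real \<Rightarrow> 'a::euclidean_space set \<Rightarrow> 'a prism set \<Rightarrow> bool" where
  "space_time_partition T \<Omega> P \<longleftrightarrow> finite P \<and>
     (\<forall>(I, S)\<in>P. is_interval I \<and> I \<subseteq> {0..T} \<and> tagged_simplex S) \<and>
     (\<forall>(I, S)\<in>P. \<forall>(I', S')\<in>P. (I, S) \<noteq> (I', S') \<longrightarrow> nonoverlapping (I \<times> pts S) (I' \<times> pts S')) \<and>
     (\<Union>(I, S)\<in>P. I \<times> pts S) = {0..T} \<times> closure \<Omega>"


section \<open>Mesh properties\<close>

definition touch_in_time :: "'a::euclidean_space prism \<Rightarrow> 'a prism \<Rightarrow> bool" where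
  "touch_in_time Q Q' \<longleftrightarrow> card (closure (fst Q) \<inter> closure (fst Q')) = 1 \<and>
     aff_dim (pts (snd Q) \<inter> pts (snd Q')) = int DIM('a)"

definition overlap_in_time :: "'a::euclidean_space prism \<Rightarrow> 'a prism \<Rightarrow> bool" where
  "overlap_in_time Q Q' \<longleftrightarrow> measure lebesgue (fst Q \<inter> fst Q') > 0"

definition active :: "real \<Rightarrow> 'a::euclidean_space prism set \<Rightarrow> 'a tsimplex set" where
  "active t P = {S. \<exists>I. (I, S) \<in> P \<and> t \<in> I}"

definition conforming_in_space :: "real \<Rightarrow> 'a::euclidean_space prism set \<Rightarrow> bool" where
  "conforming_in_space T P \<longleftrightarrow> (\<forall>t\<in>{0..T}. conforming (active t P))"

definition levels_close ::
  "'a::euclidean_space tsimplex set \<Rightarrow> 'a prism \<Rightarrow> 'a prism \<Rightarrow> bool" where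
  "levels_close \<T>\<^sub>0 Q Q' \<longleftrightarrow> \<bar>int (level \<T>\<^sub>0 Q) - int (level \<T>\<^sub>0 Q')\<bar> \<le> 1"

definition one_irregular_in_time ::
  "'a::euclidean_space tsimplex set \<Rightarrow> 'a prism set \<Rightarrow> bool" where
  "one_irregular_in_time \<T>\<^sub>0 P \<longleftrightarrow>
     (\<forall>Q\<in>P. \<forall>Q'\<in>P. touch_in_time Q Q' \<longrightarrow> levels_close \<T>\<^sub>0 Q Q')"

text \<open>Only used for $d = 1$.\<close>

definition one_irregular_in_space ::
  "'a::euclidean_space tsimplex set \<Rightarrow> 'a prism set \<Rightarrow> bool" where
  "one_irregular_in_space \<T>\<^sub>0 P \<longleftrightarrow>
     (\<forall>Q\<in>P. \<forall>Q'\<in>P. overlap_in_time Q Q' \<and> card (pts (snd Q) \<inter> pts (snd Q')) = 1 \<longrightarrow>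
        levels_close \<T>\<^sub>0 Q Q')"

definition admissible ::
  "real \<Rightarrow> 'a::euclidean_space set \<Rightarrow> real set set \<Rightarrow> 'a tsimplex set \<Rightarrow> real \<Rightarrow> real \<Rightarrow>
   'a prism set \<Rightarrow> bool" where
  "admissible T \<Omega> \<I>\<^sub>0 \<T>\<^sub>0 s1 s2 P \<longleftrightarrow>
     space_time_partition T \<Omega> P \<and>
     (atomic_step \<T>\<^sub>0 s1 s2)\<^sup>*\<^sup>* (\<I>\<^sub>0 \<times> \<T>\<^sub>0) P \<and>
     conforming_in_space T P \<and>
     one_irregular_in_time \<T>\<^sub>0 P \<and>
     (DIM('a) = 1 \<longrightarrow> one_irregular_in_space \<T>\<^sub>0 P)"


section \<open>Neighbourhoods\<close>

definition nbrs_t ::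
  "'a::euclidean_space tsimplex set \<Rightarrow> 'a prism set \<Rightarrow> 'a prism \<Rightarrow> 'a prism set" where
  "nbrs_t \<T>\<^sub>0 P Q = {Q' \<in> P - {Q}. touch_in_time Q Q' \<and> level \<T>\<^sub>0 Q' + 1 = level \<T>\<^sub>0 Q}"

definition nbrs_x ::
  "'a::euclidean_space tsimplex set \<Rightarrow> 'a prism set \<Rightarrow> 'a prism \<Rightarrow> 'a prism set" where
  "nbrs_x \<T>\<^sub>0 P Q = {Q' \<in> P - {Q}. overlap_in_time Q Q' \<and>
     (if DIM('a) = 1
      then card (pts (snd Q) \<inter> pts (snd Q')) = 1 \<and> level \<T>\<^sub>0 Q' + 1 = level \<T>\<^sub>0 Q
      else 1 \<le> aff_dim (pts (snd Q) \<inter> pts (snd Q')) \<and>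
           aff_dim (pts (snd Q) \<inter> pts (snd Q')) \<le> int DIM('a) - 1 \<and>
           RE (snd Q) \<subseteq> pts (snd Q'))}"

definition nbrs ::
  "'a::euclidean_space tsimplex set \<Rightarrow> 'a prism set \<Rightarrow> 'a prism \<Rightarrow> 'a prism set" where
  "nbrs \<T>\<^sub>0 P Q = nbrs_t \<T>\<^sub>0 P Q \<union> nbrs_x \<T>\<^sub>0 P Q"


section \<open>Patch refinement as a transition system\<close>

text \<open>A call of the procedure has local variables \<^term>\<open>K\<close>, \<^term>\<open>F\<close>, \<^term>\<open>Fnew\<close> and the set
  \<^term>\<open>D\<close> of those pairs $(Q', Q'')$, $Q' \in F$, that the body of the for-loop of the current round
  has already treated. The neighbours are always taken in the current partition: a prism that a
  recursive call has meanwhile refined is no longer a candidate, a newly created one may become a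
  candidate.\<close>

definition pending ::
  "'a::euclidean_space tsimplex set \<Rightarrow> 'a prism set \<Rightarrow> 'a prism set \<Rightarrow> 'a prism set \<Rightarrow>
   ('a prism \<times> 'a prism) set \<Rightarrow> ('a prism \<times> 'a prism) set" where
  "pending \<T>\<^sub>0 P K F D = {(Q', Q''). Q' \<in> F \<and> Q'' \<in> nbrs \<T>\<^sub>0 P Q' - (K \<union> F)} - D"

text \<open>The order in which the for-loop runs through the pending pairs is arbitrary, with one
  proviso: a neighbour $Q''$ that is coarser than $Q'$ by two or more levels waits until no closer
  one is pending. The proviso is void for $d \le 2$, where the levels of $Q'$ and $Q''$ differ by at
  most one. For $d \ge 3$ the prisms around the edge \<^term>\<open>RE S\<close> can differ in level by more than
  one, and without the proviso the algorithm is not correct: if $\ell(Q'') \le \ell(Q') - 2$, the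
  children of $Q''$ put into \<^term>\<open>Fnew\<close> are themselves coarser than $Q'$ and may be refined by a
  later recursive call in the same round.\<close>

definition candidates ::
  "'a::euclidean_space tsimplex set \<Rightarrow> ('a prism \<times> 'a prism) set \<Rightarrow> ('a prism \<times> 'a prism) set" where
  "candidates \<T>\<^sub>0 X =
    (let near = {(Q', Q'') \<in> X. level \<T>\<^sub>0 Q' \<le> level \<T>\<^sub>0 Q'' + 1}
     in if near = {} then X else near)"

type_synonym 'a frame =
  "'a prism set \<times> 'a prism set \<times> 'a prism set \<times> ('a prism \<times> 'a prism) set"

text \<open>A configuration consists of the current partition, the number of applications of
  \<^const>\<open>atomic_split\<close> made so far, the local variables of the running call, and the stack of
  interrupted calls. For an interrupted call the stack records its local variables, the partition
  $\mathcal P_{old}$ at the time of the interruption, and the pair being treated.\<close>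

datatype 'a config =
    Running "'a prism set" nat "'a frame" "('a frame \<times> 'a prism set \<times> 'a prism \<times> 'a prism) list"
  | Returned "'a prism set" nat

definition refine_all ::
  "'a::euclidean_space tsimplex set \<Rightarrow> real \<Rightarrow> real \<Rightarrow> 'a prism set \<Rightarrow> 'a prism set \<Rightarrow> 'a prism set"
  where
  "refine_all \<T>\<^sub>0 s1 s2 P K = (P - K) \<union> (\<Union>Q\<in>K. atomic_split \<T>\<^sub>0 s1 s2 Q)"

inductive patch_step ::
  "'a::euclidean_space tsimplex set \<Rightarrow> real \<Rightarrow> real \<Rightarrow> 'a config \<Rightarrow> 'a config \<Rightarrow> bool"
  for \<T>\<^sub>0 s1 s2 where
  same_level:
  "(Q', Q'') \<in> candidates \<T>\<^sub>0 (pending \<T>\<^sub>0 P K F D) \<Longrightarrow> level \<T>\<^sub>0 Q'' = level \<T>\<^sub>0 Q' \<Longrightarrow>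
   patch_step \<T>\<^sub>0 s1 s2
     (Running P c (K, F, Fnew, D) st)
     (Running P c (K, F, insert Q'' Fnew, insert (Q', Q'') D) st)"
| recursive_call:
  "(Q', Q'') \<in> candidates \<T>\<^sub>0 (pending \<T>\<^sub>0 P K F D) \<Longrightarrow> level \<T>\<^sub>0 Q'' \<noteq> level \<T>\<^sub>0 Q' \<Longrightarrow>
   patch_step \<T>\<^sub>0 s1 s2
     (Running P c (K, F, Fnew, D) st)
     (Running P c ({}, {Q''}, {}, {}) (((K, F, Fnew, insert (Q', Q'') D), P, Q', Q'') # st))"
| next_round:
  "F \<noteq> {} \<Longrightarrow> pending \<T>\<^sub>0 P K F D = {} \<Longrightarrow>
   patch_step \<T>\<^sub>0 s1 s2
     (Running P c (K, F, Fnew, D) st)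
     (Running P c (K \<union> F, Fnew, {}, {}) st)"
| return_to_caller:
  "P\<^sub>1 = refine_all \<T>\<^sub>0 s1 s2 P K \<Longrightarrow>
   Fnew\<^sub>1 = (if Q'' \<in> nbrs_x \<T>\<^sub>0 P\<^sub>o\<^sub>l\<^sub>d Q' then atomic_split \<T>\<^sub>0 s1 s2 Q'' \<inter> nbrs \<T>\<^sub>0 P\<^sub>1 Q' else {}) \<Longrightarrow>
   patch_step \<T>\<^sub>0 s1 s2
     (Running P c (K, {}, Fnew, D) (((K', F', Fnew', D'), P\<^sub>o\<^sub>l\<^sub>d, Q', Q'') # st))
     (Running P\<^sub>1 (c + card K) (K', F', Fnew' \<union> Fnew\<^sub>1, D') st)"
| return:
  "patch_step \<T>\<^sub>0 s1 s2
     (Running P c (K, {}, Fnew, D) [])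
     (Returned (refine_all \<T>\<^sub>0 s1 s2 P K) (c + card K))"

lemma patch_step_progress: "\<exists>cf. patch_step \<T>\<^sub>0 s1 s2 (Running P c (K, F, Fnew, D) st) cf"
proof (cases "F = {}")
  case True
  show ?thesis
  proof (cases st)
    case Nil
    then show ?thesis using True by (auto intro: patch_step.return)
  next
    case (Cons a st')
    then obtain K' F' Fnew' D' Po Q' Q'' where "st = ((K', F', Fnew', D'), Po, Q', Q'') # st'"
      by (metis prod_cases4 prod.exhaust)
    then show ?thesis using True patch_step.return_to_caller[OF refl refl] by blast
  qed
next
  case False
  show ?thesis
  proof (cases "pending \<T>\<^sub>0 P K F D = {}")
    case True
    then show ?thesis using False patch_step.next_round by blast
  next
    case ne: False
    then have "candidates \<T>\<^sub>0 (pending \<T>\<^sub>0 P K F D) \<noteq> {}"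
      by (simp add: candidates_def Let_def)
    then obtain Q' Q'' where "(Q', Q'') \<in> candidates \<T>\<^sub>0 (pending \<T>\<^sub>0 P K F D)"
      by auto
    note pair = this
    show ?thesis
    proof (cases "level \<T>\<^sub>0 Q'' = level \<T>\<^sub>0 Q'")
      case True
      show ?thesis by (rule exI, rule patch_step.same_level[OF pair True])
    next
      case False
      show ?thesis by (rule exI, rule patch_step.recursive_call[OF pair False])
    qed
  qed
qed

definition initial_config :: "'a prism set \<Rightarrow> 'a prism \<Rightarrow> 'a config" where
  "initial_config P Q = Running P 0 ({}, {Q}, {}, {}) []"

text \<open>Every execution is finite; by the progress lemma above it then ends in a
  \<^const>\<open>Returned\<close> configuration.\<close>

definition patch_refine_terminates ::
  "'a::euclidean_space tsimplex set \<Rightarrow> real \<Rightarrow> real \<Rightarrow> 'a prism set \<Rightarrow> 'a prism \<Rightarrow> bool" where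
  "patch_refine_terminates \<T>\<^sub>0 s1 s2 P Q \<longleftrightarrow>
     \<not> (\<exists>cf. cf 0 = initial_config P Q \<and> (\<forall>i::nat. patch_step \<T>\<^sub>0 s1 s2 (cf i) (cf (Suc i))))"

text \<open>\<^term>\<open>P'\<close> is a result, and \<^term>\<open>n\<close> the number of atomic splits applied to obtain it.\<close>

definition patch_refine ::
  "'a::euclidean_space tsimplex set \<Rightarrow> real \<Rightarrow> real \<Rightarrow> 'a prism set \<Rightarrow> 'a prism \<Rightarrow>
   'a prism set \<Rightarrow> nat \<Rightarrow> bool" where
  "patch_refine \<T>\<^sub>0 s1 s2 P Q P' n \<longleftrightarrow>
     (patch_step \<T>\<^sub>0 s1 s2)\<^sup>*\<^sup>* (initial_config P Q) (Returned P' n)"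

end

theory Submission
  imports Defs
begin

text \<open>
  The prisms that can arise form a forest, and a partition reachable from the initial one is the set
  of leaves of a finite subtree; let \<open>R\<close> be the set of inner nodes, i.e. of the prisms that have been
  split. Conformity and 1-irregularity of the leaves amount to \<open>R\<close> being closed under static
  dependencies: a split prism drags along its \<^emph>\<open>patch\<close> (the prisms of equal level and equal time
  interval whose simplices have the same refinement edge), and the prisms of level one less that
  touch it in time or, for $d = 1$, in space. The smallest admissible refinement that splits a given
  prism is therefore the closure of \<open>R\<close> together with that prism, and the algorithm computes this
  closure: a call collects one patch, and its recursive calls split forced prisms of lower level.

  The geometric input is that all uniform refinements are conforming, with the refinement edge of a
  simplex being the refinement edge of every simplex of its level that contains it. As neighbours
  across hyperfaces are compatibly labelled, this needs that the star of an edge is connected through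
  hyperfaces, which is where the Lipschitz property of the domain enters. The same connectivity shows
  that among the prisms around a refinement edge levels drop by one at a time, so that the algorithm
  never has to treat a neighbour that is coarser by two or more levels.
\<close>

section \<open>Bisecting a simplex at an edge\<close>

lemma affine_extension:
  fixes V :: "'a::euclidean_space set" and h :: "'a \<Rightarrow> real"
  assumes "\<not> affine_dependent V"
  obtains g c where "linear g" "\<And>v. v \<in> V \<Longrightarrow> g v + c = h v"
proof (cases "V = {}")
  case True
  then show ?thesis using that[of "\<lambda>_. 0" 0] by (simp add: linear_iff)
next
  case False
  then obtain a where a: "a \<in> V" by blast
  have "independent ((\<lambda>x. -a + x) ` (V - {a}))"
    using assms affine_dependent_iff_dependent2[OF a] by blast
  then obtain g where g: "linear g" "\<forall>x\<in>(\<lambda>x. -a + x) ` (V - {a}). g x = h (x + a) - h a"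
    using linear_independent_extend[of _ "\<lambda>x. h (x + a) - h a"] by metis
  have "g v + (h a - g a) = h v" if "v \<in> V" for v
  proof (cases "v = a")
    case False
    then have "g (-a + v) = h v - h a" using g(2) that by auto
    then show ?thesis using linear_diff[OF g(1), of v a] by simp
  qed simp
  then show ?thesis using that g(1) by blast
qed

text \<open>If \<open>W\<close> is a set of vertices of a simplex that is bisected at its edge \<open>ab\<close>, then \<open>half a b W\<close>
  spans the part of the face \<open>W\<close> that belongs to the child containing \<open>a\<close>, also when \<open>a\<close> or \<open>b\<close> is
  not a vertex of that face.\<close>

definition half :: "'a::euclidean_space \<Rightarrow> 'a \<Rightarrow> 'a set \<Rightarrow> 'a set" where
  "half a b W = (if a \<in> W \<and> b \<in> W then insert (midpoint a b) (W - {b}) else W - {b})"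

lemma affine_combination:
  fixes g :: "'a::euclidean_space \<Rightarrow> real"
  assumes "linear g" "finite W" "sum u W = 1"
  shows "g (\<Sum>v\<in>W. u v *\<^sub>R v) + c = (\<Sum>v\<in>W. u v * (g v + c))"
  using assms
  by (simp add: linear_sum linear_cmul distrib_left sum.distrib flip: sum_distrib_right)

lemma affine_midpoint:
  fixes g :: "'a::euclidean_space \<Rightarrow> real"
  assumes "linear g"
  shows "g (midpoint a b) + c = ((g a + c) + (g b + c)) / 2"
  using assms by (simp add: midpoint_def linear_cmul linear_add field_simps)

lemma convex_affine_le:
  fixes g :: "'a::euclidean_space \<Rightarrow> real"
  assumes "linear g"
  shows "convex {x. g x + c \<le> 0}"
proof -
  have "{x. g x + c \<le> 0} = g -` {.. -c}" by auto
  then show ?thesis using convex_linear_vimage[OF assms, of "{.. -c}"] by simp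
qed

lemma hull_halfspace:
  fixes g :: "'a::euclidean_space \<Rightarrow> real"
  assumes W: "finite W" and g: "linear g" and ab: "a \<noteq> b"
    and 0: "\<And>v. v \<in> W \<Longrightarrow> v \<noteq> a \<Longrightarrow> v \<noteq> b \<Longrightarrow> g v + c = 0"
    and a: "a \<in> W \<Longrightarrow> g a + c = -1" and b: "b \<in> W \<Longrightarrow> g b + c = 1"
  shows "convex hull W \<inter> {x. g x + c \<le> 0} = convex hull (half a b W)"
proof
  have "half a b W \<subseteq> convex hull W \<inter> {x. g x + c \<le> 0}"
  proof
    fix x assume x: "x \<in> half a b W"
    show "x \<in> convex hull W \<inter> {x. g x + c \<le> 0}"
    proof (cases "x \<in> W - {b}")
      case True
      then show ?thesis using 0[of x] a by (cases "x = a") (auto intro: hull_inc)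
    next
      case False
      then have m: "x = midpoint a b" "a \<in> W" "b \<in> W"
        using x by (auto simp: half_def split: if_splits)
      have "midpoint a b \<in> closed_segment a b" by simp
      also have "\<dots> \<subseteq> convex hull W"
        using m by (simp add: segment_convex_hull hull_mono)
      finally show ?thesis using m a b affine_midpoint[OF g, of a b c] by simp
    qed
  qed
  moreover have "convex (convex hull W \<inter> {x. g x + c \<le> 0})"
    by (intro convex_Int convex_affine_le g convex_convex_hull)
  ultimately show "convex hull (half a b W) \<subseteq> convex hull W \<inter> {x. g x + c \<le> 0}"
    by (rule hull_minimal)
next
  show "convex hull W \<inter> {x. g x + c \<le> 0} \<subseteq> convex hull (half a b W)"
  proof
    fix y assume y: "y \<in> convex hull W \<inter> {x. g x + c \<le> 0}"
    then obtain u where u: "\<And>v. v \<in> W \<Longrightarrow> 0 \<le> u v" "sum u W = 1" "(\<Sum>v\<in>W. u v *\<^sub>R v) = y"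
      using convex_hull_finite[OF W] by auto
    have fy: "(\<Sum>v\<in>W. u v * (g v + c)) \<le> 0"
      using y affine_combination[OF g W u(2), of c] u(3) by simp
    have C: "convex (convex hull (half a b W))" by simp
    show "y \<in> convex hull (half a b W)"
    proof (cases "b \<in> W")
      case False
      then show ?thesis using y by (simp add: half_def)
    next
      case bW: True
      show ?thesis
      proof (cases "a \<in> W")
        case False
        have "(\<Sum>v\<in>W. u v * (g v + c)) = u b + (\<Sum>v\<in>W-{b}. u v * (g v + c))"
          using bW W b by (simp add: sum.remove)
        also have "(\<Sum>v\<in>W-{b}. u v * (g v + c)) = 0"
          using False 0 by (intro sum.neutral) auto
        finally have ub: "u b = 0" using fy u(1)[OF bW] by simp
        have "y = (\<Sum>v\<in>W-{b}. u v *\<^sub>R v)" "sum u (W - {b}) = 1"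
          using u ub bW W by (simp_all add: sum.remove[of W b])
        moreover have "half a b W = W - {b}" using False by (simp add: half_def)
        ultimately show ?thesis using u(1) W by (auto simp: convex_hull_finite)
      next
        case aW: True
        have "(\<Sum>v\<in>W. u v * (g v + c)) = - u a + (u b + (\<Sum>v\<in>W-{a}-{b}. u v * (g v + c)))"
          using bW aW W a b ab by (simp add: sum.remove[of W a] sum.remove[of "W-{a}" b])
        also have "(\<Sum>v\<in>W-{a}-{b}. u v * (g v + c)) = 0"
          using 0 by (intro sum.neutral) auto
        finally have uab: "u b \<le> u a" using fy by simp
        define w where "w = u(a := u a - u b, b := 2 * u b)"
        define p where "p = (\<lambda>v. v)(b := midpoint a b)"
        have split: "sum F W = F a + (F b + sum F (W - {a} - {b}))" for F :: "'a \<Rightarrow> 'b::comm_monoid_add"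
          using bW aW W ab by (simp add: sum.remove[of W a] sum.remove[of "W-{a}" b])
        have rest: "(\<Sum>v\<in>W-{a}-{b}. w v) = (\<Sum>v\<in>W-{a}-{b}. u v)"
          "(\<Sum>v\<in>W-{a}-{b}. w v *\<^sub>R p v) = (\<Sum>v\<in>W-{a}-{b}. u v *\<^sub>R v)"
          by (auto simp: w_def p_def intro!: sum.cong)
        have "sum w W = 1"
          using u(2) rest(1) ab by (subst split, subst (asm) split) (simp add: w_def)
        moreover have "\<forall>v\<in>W. 0 \<le> w v" using u(1) uab bW by (auto simp: w_def)
        moreover have "\<forall>v\<in>W. p v \<in> convex hull (half a b W)"
          using aW bW by (auto simp: p_def half_def intro!: hull_inc)
        ultimately have "(\<Sum>v\<in>W. w v *\<^sub>R p v) \<in> convex hull (half a b W)"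
          using convex_sum[OF W C] by simp
        moreover have "(\<Sum>v\<in>W. w v *\<^sub>R p v) = y"
          unfolding u(3)[symmetric] using ab
          by (subst (1 2) split, unfold rest(2)) (simp add: w_def p_def midpoint_def algebra_simps)
        ultimately show ?thesis by simp
      qed
    qed
  qed
qed

lemma midpoint_in_hull:
  fixes V :: "'a::euclidean_space set"
  assumes V: "\<not> affine_dependent V" and W: "W \<subseteq> V" and ab: "a \<in> V" "b \<in> V"
    and m: "midpoint a b \<in> convex hull W"
  shows "a \<in> W \<and> b \<in> W"
proof -
  have *: "a \<in> W" if a: "a \<in> V" and b: "b \<in> V" and m: "midpoint a b \<in> convex hull W" for a b
  proof (rule ccontr)
    assume aW: "a \<notin> W"
    obtain g c where g: "linear g" "\<And>v. v \<in> V \<Longrightarrow> g v + c = (if v = a then 1 else 0 :: real)"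
      by (rule affine_extension[OF V, of "\<lambda>v. if v = a then 1 else 0"]) (rule that)
    have "W \<subseteq> {x. g x + c \<le> 0}" using aW W g(2) by fastforce
    then have "convex hull W \<subseteq> {x. g x + c \<le> 0}"
      using convex_affine_le[OF g(1)] by (rule hull_minimal)
    then have "g (midpoint a b) + c \<le> 0" using m by auto
    then show False using affine_midpoint[OF g(1), of a b c] g(2) a b by (auto split: if_splits)
  qed
  show ?thesis using *[of a b] *[of b a] ab m by (simp add: midpoint_sym)
qed

lemma vertex_in_hull:
  fixes V :: "'a::euclidean_space set"
  assumes "\<not> affine_dependent V" "W \<subseteq> V" "a \<in> V" "a \<in> convex hull W"
  shows "a \<in> W"
  using midpoint_in_hull[OF assms(1,2,3,3)] assms(4) by simp

lemma midpoint_not_vertex: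
  fixes V :: "'a::euclidean_space set"
  assumes "\<not> affine_dependent V" "a \<in> V" "b \<in> V" "a \<noteq> b"
  shows "midpoint a b \<notin> V"
proof
  assume m: "midpoint a b \<in> V"
  then have "a \<in> {midpoint a b}"
    using midpoint_in_hull[OF assms(1) _ assms(2,3), of "{midpoint a b}"] by simp
  then show False using assms(4) midpoint_eq_endpoint(1)[of a b] by (metis singletonD)
qed

lemma affine_independent_half:
  fixes V :: "'a::euclidean_space set"
  assumes V: "\<not> affine_dependent V" and ab: "a \<in> V" "b \<in> V" "a \<noteq> b"
  shows "\<not> affine_dependent (half a b V)"
proof -
  have "midpoint a b \<notin> affine hull (V - {b})"
  proof
    assume m: "midpoint a b \<in> affine hull (V - {b})"
    have a: "a \<in> affine hull (V - {b})" using ab by (auto intro: hull_inc)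
    have "(-1) *\<^sub>R a + 2 *\<^sub>R midpoint a b \<in> affine hull (V - {b})"
      by (rule mem_affine[OF affine_affine_hull a m]) simp
    then have "b \<in> affine hull (V - {b})" by (simp add: midpoint_def)
    then show False using V ab by (auto simp: affine_dependent_def)
  qed
  then show ?thesis
    using affine_independent_insert[of "V - {b}" "midpoint a b"] affine_independent_Diff[OF V] ab
    by (simp add: half_def)
qed

lemma hull_half:
  fixes V :: "'a::euclidean_space set"
  assumes V: "\<not> affine_dependent V" and ab: "a \<noteq> b"
  obtains g c where "linear (g :: 'a \<Rightarrow> real)"
    "\<And>W. W \<subseteq> V \<Longrightarrow> convex hull (half a b W) = convex hull W \<inter> {x. g x + c \<le> 0}"
    "\<And>W. W \<subseteq> V \<Longrightarrow> convex hull (half b a W) = convex hull W \<inter> {x. 0 \<le> g x + c}"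
    "\<And>v. v \<in> V \<Longrightarrow> g v + c = (if v = a then -1 else if v = b then 1 else 0)"
proof -
  obtain g c where g: "linear g"
    "\<And>v. v \<in> V \<Longrightarrow> g v + c = (if v = a then -1 else if v = b then 1 else 0 :: real)"
    by (rule affine_extension[OF V, of "\<lambda>v. if v = a then -1 else if v = b then 1 else 0"]) (rule that)
  have fin: "finite W" if "W \<subseteq> V" for W
    using V aff_independent_finite finite_subset that by blast
  have 1: "convex hull W \<inter> {x. g x + c \<le> 0} = convex hull (half a b W)" if "W \<subseteq> V" for W
    by (rule hull_halfspace[OF fin[OF that] g(1) ab]) (use g(2) that ab in auto)
  have "convex hull W \<inter> {x. - g x + - c \<le> 0} = convex hull (half b a W)" if "W \<subseteq> V" for W
  proof (rule hull_halfspace[OF fin[OF that] _ ab[symmetric]])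
    show "linear (\<lambda>x. - g x)" using g(1) by (rule linear_compose_neg)
    show "- g v + - c = 0" if "v \<in> W" "v \<noteq> b" "v \<noteq> a" for v
      using g(2)[of v] that \<open>W \<subseteq> V\<close> by auto
    show "- g b + - c = -1" if "b \<in> W" using g(2)[of b] that \<open>W \<subseteq> V\<close> ab by auto
    show "- g a + - c = 1" if "a \<in> W" using g(2)[of a] that \<open>W \<subseteq> V\<close> by auto
  qed
  moreover have "{x. - g x + - c \<le> 0} = {x. 0 \<le> g x + c}" by auto
  ultimately have 2: "convex hull W \<inter> {x. 0 \<le> g x + c} = convex hull (half b a W)" if "W \<subseteq> V" for W
    using that by simp
  show ?thesis using that[OF g(1) 1[symmetric] 2[symmetric] g(2)] .
qed

lemma hull_half_Un:
  fixes V :: "'a::euclidean_space set"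
  assumes "\<not> affine_dependent V" "a \<noteq> b"
  shows "convex hull (half a b V) \<union> convex hull (half b a V) = convex hull V"
proof -
  obtain g c where g: "linear (g :: 'a \<Rightarrow> real)"
    "\<And>W. W \<subseteq> V \<Longrightarrow> convex hull (half a b W) = convex hull W \<inter> {x. g x + c \<le> 0}"
    "\<And>W. W \<subseteq> V \<Longrightarrow> convex hull (half b a W) = convex hull W \<inter> {x. 0 \<le> g x + c}"
    "\<And>v. v \<in> V \<Longrightarrow> g v + c = (if v = a then -1 else if v = b then 1 else 0)"
    by (rule hull_half[OF assms]) (rule that)
  show ?thesis unfolding g(2)[OF order_refl] g(3)[OF order_refl] by auto
qed

definition meet_in_face :: "'a::euclidean_space set \<Rightarrow> 'a set \<Rightarrow> bool" where
  "meet_in_face V W \<longleftrightarrow> convex hull V \<inter> convex hull W = convex hull (V \<inter> W)"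

lemma meet_in_face_sym: "meet_in_face V W \<Longrightarrow> meet_in_face W V"
  by (simp add: meet_in_face_def Int_commute)

lemma meet_in_face_self: "meet_in_face V V"
  by (simp add: meet_in_face_def)

lemma meet_in_face_half:
  fixes V :: "'a::euclidean_space set"
  assumes V: "\<not> affine_dependent V" and ab: "a \<in> V" "b \<in> V" "a \<noteq> b"
    and mf: "meet_in_face V V'" and ne: "\<not> (a \<in> V' \<and> b \<in> V')"
  shows "meet_in_face (half a b V) V'" "half a b V \<inter> V' = V \<inter> V' - {b}"
proof -
  obtain g c where g: "linear (g :: 'a \<Rightarrow> real)"
    "\<And>W. W \<subseteq> V \<Longrightarrow> convex hull (half a b W) = convex hull W \<inter> {x. g x + c \<le> 0}"
    "\<And>W. W \<subseteq> V \<Longrightarrow> convex hull (half b a W) = convex hull W \<inter> {x. 0 \<le> g x + c}"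
    "\<And>v. v \<in> V \<Longrightarrow> g v + c = (if v = a then -1 else if v = b then 1 else 0)"
    by (rule hull_half[OF V ab(3)]) (rule that)
  have m: "midpoint a b \<notin> V'"
  proof
    assume m: "midpoint a b \<in> V'"
    have "midpoint a b \<in> closed_segment a b" by simp
    also have "\<dots> \<subseteq> convex hull V"
      using ab by (simp add: segment_convex_hull hull_mono)
    finally have "midpoint a b \<in> convex hull (V \<inter> V')"
      using m mf hull_inc[OF m, of convex] unfolding meet_in_face_def by blast
    then show False using midpoint_in_hull[OF V _ ab(1,2), of "V \<inter> V'"] ne by blast
  qed
  show eq: "half a b V \<inter> V' = V \<inter> V' - {b}" using m ab by (auto simp: half_def)
  have "convex hull (half a b V) \<inter> convex hull V' = convex hull (V \<inter> V') \<inter> {x. g x + c \<le> 0}"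
    using mf unfolding meet_in_face_def g(2)[OF order_refl] by blast
  also have "\<dots> = convex hull (half a b (V \<inter> V'))" by (rule g(2)[symmetric]) simp
  also have "half a b (V \<inter> V') = V \<inter> V' - {b}" using ne by (auto simp: half_def)
  finally show "meet_in_face (half a b V) V'" by (simp add: meet_in_face_def eq)
qed

lemma meet_in_face_half_half:
  fixes V V' :: "'a::euclidean_space set"
  assumes V: "\<not> affine_dependent V" and ab: "a \<in> V" "b \<in> V" "a \<noteq> b"
    and V': "\<not> affine_dependent V'" and ab': "a' \<in> V'" "b' \<in> V'" "a' \<noteq> b'"
    and mf: "meet_in_face V V'" and ne: "\<not> (a \<in> V' \<and> b \<in> V')" "\<not> (a' \<in> V \<and> b' \<in> V)"
  shows "meet_in_face (half a b V) (half a' b' V')"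
proof -
  note 1 = meet_in_face_half[OF V ab mf ne(1)]
  have "\<not> (a' \<in> half a b V \<and> b' \<in> half a b V)" using 1(2) ne(2) ab' by blast
  then show ?thesis
    using meet_in_face_half(1)[OF V' ab' meet_in_face_sym[OF 1(1)]] meet_in_face_sym by blast
qed

lemma meet_in_face_half_same:
  fixes V V' :: "'a::euclidean_space set"
  assumes V: "\<not> affine_dependent V" and V': "\<not> affine_dependent V'"
    and ab: "a \<in> V" "b \<in> V" "a \<in> V'" "b \<in> V'" "a \<noteq> b" and mf: "meet_in_face V V'"
  shows "meet_in_face (half a b V) (half a b V')" "half a b V \<inter> half a b V' = half a b (V \<inter> V')"
proof -
  obtain g c where g: "linear (g :: 'a \<Rightarrow> real)"
    "\<And>W. W \<subseteq> V \<Longrightarrow> convex hull (half a b W) = convex hull W \<inter> {x. g x + c \<le> 0}"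
    "\<And>W. W \<subseteq> V \<Longrightarrow> convex hull (half b a W) = convex hull W \<inter> {x. 0 \<le> g x + c}"
    "\<And>v. v \<in> V \<Longrightarrow> g v + c = (if v = a then -1 else if v = b then 1 else 0)"
    by (rule hull_half[OF V ab(5)]) (rule that)
  obtain g' c' where g': "linear (g' :: 'a \<Rightarrow> real)"
    "\<And>W. W \<subseteq> V' \<Longrightarrow> convex hull (half a b W) = convex hull W \<inter> {x. g' x + c' \<le> 0}"
    "\<And>W. W \<subseteq> V' \<Longrightarrow> convex hull (half b a W) = convex hull W \<inter> {x. 0 \<le> g' x + c'}"
    "\<And>v. v \<in> V' \<Longrightarrow> g' v + c' = (if v = a then -1 else if v = b then 1 else 0)"
    by (rule hull_half[OF V' ab(5)]) (rule that)
  show eq: "half a b V \<inter> half a b V' = half a b (V \<inter> V')" using ab by (auto simp: half_def)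
  have "convex hull (half a b V) \<inter> convex hull (half a b V')
    = (convex hull (V \<inter> V') \<inter> {x. g x + c \<le> 0}) \<inter> (convex hull (V \<inter> V') \<inter> {x. g' x + c' \<le> 0})"
    using mf unfolding meet_in_face_def g(2)[OF order_refl] g'(2)[OF order_refl] by blast
  also have "\<dots> = convex hull (half a b (V \<inter> V'))"
    using g(2)[of "V \<inter> V'"] g'(2)[of "V \<inter> V'"] by auto
  finally show "meet_in_face (half a b V) (half a b V')" by (simp add: meet_in_face_def eq)
qed

lemma meet_in_face_half_opposite:
  fixes V V' :: "'a::euclidean_space set"
  assumes V: "\<not> affine_dependent V" and V': "\<not> affine_dependent V'"
    and ab: "a \<in> V" "b \<in> V" "a \<in> V'" "b \<in> V'" "a \<noteq> b" and mf: "meet_in_face V V'"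
  shows "meet_in_face (half a b V) (half b a V')"
    "half a b V \<inter> half b a V' = insert (midpoint a b) (V \<inter> V' - {a, b})"
proof -
  obtain g c where g: "linear (g :: 'a \<Rightarrow> real)"
    "\<And>W. W \<subseteq> V \<Longrightarrow> convex hull (half a b W) = convex hull W \<inter> {x. g x + c \<le> 0}"
    "\<And>W. W \<subseteq> V \<Longrightarrow> convex hull (half b a W) = convex hull W \<inter> {x. 0 \<le> g x + c}"
    "\<And>v. v \<in> V \<Longrightarrow> g v + c = (if v = a then -1 else if v = b then 1 else 0)"
    by (rule hull_half[OF V ab(5)]) (rule that)
  obtain g' c' where g': "linear (g' :: 'a \<Rightarrow> real)"
    "\<And>W. W \<subseteq> V' \<Longrightarrow> convex hull (half a b W) = convex hull W \<inter> {x. g' x + c' \<le> 0}"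
    "\<And>W. W \<subseteq> V' \<Longrightarrow> convex hull (half b a W) = convex hull W \<inter> {x. 0 \<le> g' x + c'}"
    "\<And>v. v \<in> V' \<Longrightarrow> g' v + c' = (if v = a then -1 else if v = b then 1 else 0)"
    by (rule hull_half[OF V' ab(5)]) (rule that)
  have mab: "a \<noteq> midpoint a b" "b \<noteq> midpoint a b"
    using ab(5) midpoint_eq_endpoint[of a b] by metis+
  show eq: "half a b V \<inter> half b a V' = insert (midpoint a b) (V \<inter> V' - {a, b})"
    using ab by (auto simp: half_def midpoint_sym)
  define X where "X = half a b (V \<inter> V')"
  have X: "X = insert (midpoint a b) (V \<inter> V' - {b})" using ab by (simp add: X_def half_def)
  have fX: "finite X" using X V aff_independent_finite by auto
  have "convex hull (half a b V) \<inter> convex hull (half b a V')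
    = convex hull X \<inter> (convex hull (V \<inter> V') \<inter> {x. 0 \<le> g' x + c'})"
    using mf unfolding meet_in_face_def X_def g(2)[OF order_refl] g'(3)[OF order_refl]
      g(2)[of "V \<inter> V'", simplified] by blast
  also have "convex hull (V \<inter> V') \<inter> {x. 0 \<le> g' x + c'} = convex hull (V \<inter> V') \<inter> {x. 0 \<le> g x + c}"
    using g(3)[of "V \<inter> V'"] g'(3)[of "V \<inter> V'"] by simp
  also have "convex hull X \<inter> (convex hull (V \<inter> V') \<inter> {x. 0 \<le> g x + c})
    = convex hull X \<inter> {x. - g x + - c \<le> 0}"
    unfolding X_def g(2)[of "V \<inter> V'", simplified] by auto
  also have "\<dots> = convex hull (half b a X)"
  proof (rule hull_halfspace[OF fX])
    show "linear (\<lambda>x. - g x)" using g(1) by (rule linear_compose_neg)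
    show "b \<noteq> a" using ab by simp
    show "b \<in> X \<Longrightarrow> - g b + - c = -1" using g(4)[OF ab(2)] ab by simp
    show "a \<in> X \<Longrightarrow> - g a + - c = 1" using g(4)[OF ab(1)] ab by simp
    fix v assume v: "v \<in> X" "v \<noteq> b" "v \<noteq> a"
    show "- g v + - c = 0"
    proof (cases "v = midpoint a b")
      case True
      then show ?thesis using affine_midpoint[OF g(1), of a b c] g(4) ab by (simp split: if_splits)
    next
      case False
      then have "g v + c = 0" using v g(4)[of v] X by simp
      then show ?thesis by simp
    qed
  qed
  also have "half b a X = insert (midpoint a b) (V \<inter> V' - {a, b})"
    unfolding X half_def using mab ab(5) by (auto simp del: midpoint_eq_endpoint)
  finally show "meet_in_face (half a b V) (half b a V')" by (simp add: meet_in_face_def eq)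
qed

section \<open>Reflected neighbours\<close>

lemma differ_once_iff:
  "differ_once xs ys \<longleftrightarrow> (\<exists>ps x y qs. xs = ps @ x # qs \<and> ys = ps @ y # qs \<and> x \<noteq> y)"
proof
  assume "differ_once xs ys"
  then have l: "length xs = length ys" and "card {i. i < length xs \<and> xs ! i \<noteq> ys ! i} = 1"
    by (auto simp: differ_once_def)
  then obtain i where i: "{i. i < length xs \<and> xs ! i \<noteq> ys ! i} = {i}"
    using card_1_singletonE by blast
  then have il: "i < length xs" "xs ! i \<noteq> ys ! i" by auto
  have eq: "xs ! j = ys ! j" if "j < length xs" "j \<noteq> i" for j using i that by auto
  have "take i xs = take i ys" using l il eq by (intro nth_equalityI) auto
  moreover have "drop (Suc i) xs = drop (Suc i) ys" using l il eq by (intro nth_equalityI) auto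
  ultimately have "xs = take i xs @ xs ! i # drop (Suc i) xs"
    "ys = take i xs @ ys ! i # drop (Suc i) xs"
    using il l id_take_nth_drop[of i xs] id_take_nth_drop[of i ys] by simp_all
  then show "\<exists>ps x y qs. xs = ps @ x # qs \<and> ys = ps @ y # qs \<and> x \<noteq> y" using il(2) by blast
next
  assume "\<exists>ps x y qs. xs = ps @ x # qs \<and> ys = ps @ y # qs \<and> x \<noteq> y"
  then obtain ps x y qs where xy: "xs = ps @ x # qs" "ys = ps @ y # qs" "x \<noteq> y" by blast
  then have "{i. i < length xs \<and> xs ! i \<noteq> ys ! i} = {length ps}"
    by (auto simp: nth_append nth_Cons' split: if_splits)
  then show "differ_once xs ys" using xy by (simp add: differ_once_def)
qed

lemma differ_onceI: "x \<noteq> y \<Longrightarrow> differ_once (ps @ x # qs) (ps @ y # qs)"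
  by (auto simp: differ_once_iff)

lemma differ_once_context: "differ_once xs ys \<Longrightarrow> differ_once (ps @ xs @ qs) (ps @ ys @ qs)"
proof -
  assume "differ_once xs ys"
  then obtain p x y q where "xs = p @ x # q" "ys = p @ y # q" "x \<noteq> y" by (auto simp: differ_once_iff)
  then show ?thesis using differ_onceI[of x y "ps @ p" "q @ qs"] by simp
qed

lemma differ_once_rev_drop:
  assumes "differ_once xs ys"
  shows "differ_once (take n xs @ rev (drop n xs)) (take n ys @ rev (drop n ys))"
proof -
  obtain ps x y qs where xy: "xs = ps @ x # qs" "ys = ps @ y # qs" "x \<noteq> y"
    using assms by (auto simp: differ_once_iff)
  show ?thesis
  proof (cases "n \<le> length ps")
    case True
    then show ?thesis using differ_onceI[OF xy(3), of "take n ps @ rev qs" "rev (drop n ps)"] xy by simp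
  next
    case False
    then obtain k where "n = length ps + Suc k" by (metis add_Suc_right less_imp_Suc_add linorder_not_le)
    then show ?thesis using differ_onceI[OF xy(3), of ps "take k qs @ rev (drop k qs)"]
      by (simp add: xy)
  qed
qed

abbreviation "vset S \<equiv> set (verts S)"

definition edge_ends :: "'a::euclidean_space tsimplex \<Rightarrow> 'a set" where
  "edge_ends S = {hd (verts S), last (verts S)}"

lemma tagged_simplexE:
  fixes S :: "'a::euclidean_space tsimplex"
  assumes "tagged_simplex S"
  obtains a xs b \<gamma> where "S = TSimplex (a # xs @ [b]) \<gamma>" "length xs = DIM('a) - 1"
    "\<gamma> \<le> length xs" "\<gamma> < DIM('a)" "a \<noteq> b" "a \<notin> set xs" "b \<notin> set xs" "distinct xs"
    "\<not> affine_dependent (insert a (insert b (set xs)))"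
proof -
  obtain l \<gamma> where S: "S = TSimplex l \<gamma>" by (cases S)
  have l: "length l = DIM('a) + 1" and d: "distinct l" "\<not> affine_dependent (set l)" "\<gamma> < DIM('a)"
    using assms S by (auto simp: tagged_simplex_def)
  then obtain a l' where al: "l = a # l'" "l' \<noteq> []" by (cases l; cases "tl l") auto
  then obtain xs b where "l' = xs @ [b]" by (metis rev_exhaust)
  then show ?thesis using that[of a xs b \<gamma>] S l d al by auto
qed

lemma bisect_TSimplex:
  fixes a b :: "'a::euclidean_space"
  shows "bisect (TSimplex (a # xs @ [b]) \<gamma>) =
    {TSimplex (a # midpoint a b # xs) ((\<gamma> + 1) mod DIM('a)),
     TSimplex (b # midpoint a b # take \<gamma> xs @ rev (drop \<gamma> xs)) ((\<gamma> + 1) mod DIM('a))}"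
  by (simp add: bisect_def inner_verts_def Let_def)

lemma reflect_TSimplex:
  "reflect (TSimplex (a # xs @ [b]) \<gamma>) = TSimplex (b # take \<gamma> xs @ rev (drop \<gamma> xs) @ [a]) \<gamma>"
  by (simp add: reflect_def inner_verts_def Let_def)

lemma set_rev_drop: "set (take n xs) \<union> set (drop n xs) = set xs"
  by (metis append_take_drop_id set_append)

lemma reflect_simps:
  assumes "tagged_simplex S"
  shows "tagged_simplex (reflect S)" "bisect (reflect S) = bisect S" "vset (reflect S) = vset S"
    "edge_ends (reflect S) = edge_ends S" "stype (reflect S) = stype S"
proof -
  obtain a xs b \<gamma> where S: "S = TSimplex (a # xs @ [b]) \<gamma>" "\<gamma> \<le> length xs" "length xs = DIM('a) - 1"
    "a \<noteq> b" "a \<notin> set xs" "b \<notin> set xs" "distinct xs"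
    using assms by (rule tagged_simplexE)
  define ys where "ys = take \<gamma> xs @ rev (drop \<gamma> xs)"
  have R: "reflect S = TSimplex (b # ys @ [a]) \<gamma>" by (simp add: S reflect_TSimplex ys_def)
  have sys: "set ys = set xs" using set_rev_drop[of \<gamma> xs] by (simp add: ys_def)
  have lys: "length ys = length xs" using S(2) by (simp add: ys_def)
  have dys: "distinct ys" using card_distinct[of ys] distinct_card[OF S(7)] sys lys by simp
  have "take \<gamma> ys @ rev (drop \<gamma> ys) = xs" using S(2) by (simp add: ys_def)
  then show "bisect (reflect S) = bisect S"
    unfolding R unfolding S(1) bisect_TSimplex
    by (simp add: midpoint_sym ys_def[symmetric] insert_commute)
  have vS: "verts S = a # xs @ [b]" "stype S = \<gamma>" by (simp_all add: S(1))
  show "vset (reflect S) = vset S" unfolding R vS by (auto simp: sys)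
  show "edge_ends (reflect S) = edge_ends S" unfolding R edge_ends_def vS by auto
  show "stype (reflect S) = stype S" unfolding R vS by simp
  show "tagged_simplex (reflect S)"
    using assms lys dys sys S(4-6) unfolding tagged_simplex_def R vS by (simp add: insert_commute)
qed

lemma edge_ends_subset: "tagged_simplex S \<Longrightarrow> edge_ends S \<subseteq> vset S"
  by (rule tagged_simplexE[of S]) (auto simp: edge_ends_def)

lemma vset_bisect:
  assumes "tagged_simplex S" "C \<in> bisect S"
  obtains a b where "edge_ends S = {a, b}" "a \<noteq> b" "vset C = half a b (vset S)" "hd (verts C) = a"
    "a \<in> vset S" "b \<in> vset S"
proof -
  obtain a xs b \<gamma> where S: "S = TSimplex (a # xs @ [b]) \<gamma>" "a \<noteq> b" "a \<notin> set xs" "b \<notin> set xs"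
    using assms(1) by (rule tagged_simplexE)
  have s: "insert x (insert m (set (take \<gamma> xs) \<union> set (drop \<gamma> xs))) = insert m (insert x (set xs))" for x m
    using set_rev_drop[of \<gamma> xs] by blast
  consider "C = TSimplex (a # midpoint a b # xs) ((\<gamma> + 1) mod DIM('a))"
    | "C = TSimplex (b # midpoint a b # take \<gamma> xs @ rev (drop \<gamma> xs)) ((\<gamma> + 1) mod DIM('a))"
    using assms(2) by (auto simp: S(1) bisect_TSimplex)
  then show ?thesis
  proof cases
    case 1
    show ?thesis
      by (rule that[of a b]) (use S in \<open>auto simp: 1 edge_ends_def half_def\<close>)
  next
    case 2
    show ?thesis
      by (rule that[of b a])
        (use S set_rev_drop[of \<gamma> xs] in \<open>auto simp: 2 edge_ends_def half_def midpoint_sym\<close>)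
  qed
qed

lemma vset_bisect_ex:
  assumes "tagged_simplex S" "edge_ends S = {a, b}"
  obtains C where "C \<in> bisect S" "vset C = half a b (vset S)"
proof -
  obtain x xs y \<gamma> where S: "S = TSimplex (x # xs @ [y]) \<gamma>" "x \<noteq> y" "x \<notin> set xs" "y \<notin> set xs"
    using assms(1) by (rule tagged_simplexE)
  consider "a = x" "b = y" | "a = y" "b = x" using assms(2) S by (auto simp: edge_ends_def doubleton_eq_iff)
  then show ?thesis
  proof cases
    case 1
    show ?thesis
      by (rule that[of "TSimplex (x # midpoint x y # xs) ((\<gamma> + 1) mod DIM('a))"])
       (use S 1 in \<open>auto simp: bisect_TSimplex half_def\<close>)
  next
    case 2
    show ?thesis
      by (rule that[of "TSimplex (y # midpoint x y # take \<gamma> xs @ rev (drop \<gamma> xs)) ((\<gamma> + 1) mod DIM('a))"])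
       (use S 2 set_rev_drop[of \<gamma> xs] in \<open>auto simp: bisect_TSimplex half_def midpoint_sym\<close>)
  qed
qed

lemma bisect_eqI:
  assumes "tagged_simplex S" "C \<in> bisect S" "C' \<in> bisect S" "hd (verts C) = hd (verts C')"
  shows "C = C'"
proof -
  obtain a xs b \<gamma> where S: "S = TSimplex (a # xs @ [b]) \<gamma>" "a \<noteq> b"
    using assms(1) by (rule tagged_simplexE)
  show ?thesis using assms(2-4) S by (auto simp: bisect_TSimplex)
qed

lemma card_vset:
  fixes S :: "'a::euclidean_space tsimplex"
  shows "tagged_simplex S \<Longrightarrow> card (vset S) = DIM('a) + 1"
  by (simp add: tagged_simplex_def distinct_card)

lemma tagged_bisect:
  fixes S :: "'a::euclidean_space tsimplex"
  assumes "tagged_simplex S" "C \<in> bisect S"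
  shows "tagged_simplex C" "stype C = (stype S + 1) mod DIM('a)"
proof -
  obtain a b where ab: "edge_ends S = {a, b}" "a \<noteq> b" "vset C = half a b (vset S)" "a \<in> vset S" "b \<in> vset S"
    using assms by (rule vset_bisect)
  have ind: "\<not> affine_dependent (vset S)" using assms(1) by (simp add: tagged_simplex_def)
  have aff: "\<not> affine_dependent (vset C)"
    unfolding ab(3) using affine_independent_half[OF ind ab(4,5,2)] .
  have m: "midpoint a b \<notin> vset S" using midpoint_not_vertex[OF ind ab(4,5,2)] .
  have len: "length (verts C) = DIM('a) + 1"
    by (rule tagged_simplexE[OF assms(1)]) (use assms(2) in \<open>auto simp: bisect_TSimplex\<close>)
  have st: "stype C = (stype S + 1) mod DIM('a)"
    by (rule tagged_simplexE[OF assms(1)]) (use assms(2) in \<open>auto simp: bisect_TSimplex\<close>)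
  have "card (vset C) = DIM('a) + 1"
    unfolding ab(3) half_def using ab(4,5) m card_vset[OF assms(1)] by (simp add: card_Diff_singleton)
  then have "distinct (verts C)" using len card_distinct by metis
  then show "tagged_simplex C" "stype C = (stype S + 1) mod DIM('a)"
    using aff len st by (simp_all add: tagged_simplex_def)
qed

definition label_reflected :: "'a::euclidean_space tsimplex \<Rightarrow> 'a tsimplex \<Rightarrow> bool" where
  "label_reflected S S' \<longleftrightarrow> stype S = stype S' \<and>
     (differ_once (verts S) (verts S') \<or> differ_once (verts (reflect S)) (verts S'))"

text \<open>The condition in \<^const>\<open>well_labeled\<close> for a single pair, with all incidences expressed by
  vertices.\<close>

definition compat :: "'a::euclidean_space tsimplex \<Rightarrow> 'a tsimplex \<Rightarrow> bool" where
  "compat S S' \<longleftrightarrow>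
    (if edge_ends S \<subseteq> vset S' \<or> edge_ends S' \<subseteq> vset S then label_reflected S S'
     else \<forall>C\<in>bisect S. \<forall>C'\<in>bisect S'. vset S \<inter> vset S' \<subseteq> vset C \<inter> vset C' \<longrightarrow> label_reflected C C')"

lemma label_reflected_cases:
  assumes "tagged_simplex S" "label_reflected S S'"
  obtains S1 where "tagged_simplex S1" "bisect S1 = bisect S" "vset S1 = vset S" "edge_ends S1 = edge_ends S"
    "stype S1 = stype S'" "differ_once (verts S1) (verts S')"
  using assms reflect_simps[OF assms(1)] unfolding label_reflected_def by metis

lemma label_reflected_edge_ends:
  assumes "tagged_simplex S" "tagged_simplex S'" "label_reflected S S'" "edge_ends S \<subseteq> vset S' \<or> edge_ends S' \<subseteq> vset S"
  shows "edge_ends S' = edge_ends S"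
proof -
  obtain S1 where S1: "tagged_simplex S1" "vset S1 = vset S" "edge_ends S1 = edge_ends S"
    "differ_once (verts S1) (verts S')"
    using label_reflected_cases[OF assms(1,3)] by metis
  obtain ps x y qs where *: "verts S1 = ps @ x # qs" "verts S' = ps @ y # qs" "x \<noteq> y"
    using S1(4) by (auto simp: differ_once_iff)
  have d: "distinct (verts S1)" "distinct (verts S')" using S1(1) assms(2) by (auto simp: tagged_simplex_def)
  have xy: "x \<notin> vset S'" "y \<notin> vset S1" using d * by auto
  have l: "length (verts S') \<ge> 2" using assms(2) by (simp add: tagged_simplex_def)
  have "ps \<noteq> []"
  proof
    assume "ps = []"
    then have "x \<in> edge_ends S1" "y \<in> edge_ends S'" using * by (auto simp: edge_ends_def)
    then show False using assms(4) xy S1 by auto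
  qed
  moreover have "qs \<noteq> []"
  proof
    assume "qs = []"
    then have "x \<in> edge_ends S1" "y \<in> edge_ends S'" using * by (auto simp: edge_ends_def)
    then show False using assms(4) xy S1 by auto
  qed
  ultimately show ?thesis using * S1(3) by (simp add: edge_ends_def hd_append)
qed

lemma label_reflected_compat:
  assumes "tagged_simplex S" "tagged_simplex S'" "label_reflected S S'"
  shows "compat S S'"
proof (cases "edge_ends S \<subseteq> vset S' \<or> edge_ends S' \<subseteq> vset S")
  case True
  then show ?thesis using assms(3) by (simp add: compat_def)
next
  case False
  obtain S1 where S1: "tagged_simplex S1" "bisect S1 = bisect S" "vset S1 = vset S" "edge_ends S1 = edge_ends S"
    "stype S1 = stype S'" "differ_once (verts S1) (verts S')"
    using assms(1,3) by (rule label_reflected_cases)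
  obtain a xs b \<gamma> where A: "S1 = TSimplex (a # xs @ [b]) \<gamma>" "a \<noteq> b" "a \<notin> set xs" "b \<notin> set xs"
    "length xs = DIM('a) - 1"
    using S1(1) by (rule tagged_simplexE)
  obtain a' xs' b' \<gamma>' where A': "S' = TSimplex (a' # xs' @ [b']) \<gamma>'" "a' \<noteq> b'" "a' \<notin> set xs'" "b' \<notin> set xs'"
    "length xs' = DIM('a) - 1"
    using assms(2) by (rule tagged_simplexE)
  have \<gamma>: "\<gamma>' = \<gamma>" using S1(5) A A' by simp
  have bS: "bisect S = {TSimplex (a # midpoint a b # xs) ((\<gamma> + 1) mod DIM('a)),
     TSimplex (b # midpoint a b # take \<gamma> xs @ rev (drop \<gamma> xs)) ((\<gamma> + 1) mod DIM('a))}"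
    unfolding S1(2)[symmetric] A(1) by (rule bisect_TSimplex)
  obtain ps x y qs where *: "a # xs @ [b] = ps @ x # qs" "a' # xs' @ [b'] = ps @ y # qs" "x \<noteq> y"
    using S1(6) A A' by (auto simp: differ_once_iff)
  have "label_reflected C C'" if C: "C \<in> bisect S" "C' \<in> bisect S'" and W: "vset S \<inter> vset S' \<subseteq> vset C \<inter> vset C'" for C C'
  proof (cases ps)
    case Nil
    then have e: "xs' = xs" "b' = b" "a' \<noteq> a" using * A(5) A'(5) by auto
    have bW: "b \<in> vset C" "b \<in> vset C'" using W A A' e S1(3) by auto
    have m: "midpoint a b \<noteq> midpoint a' b" using e(3) by (simp add: midpoint_def)
    have mb: "b \<noteq> midpoint a b" "b \<noteq> midpoint a' b" using A(2) A'(2) e(2)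
      by (metis midpoint_eq_endpoint(2))+
    have "C = TSimplex (b # midpoint a b # take \<gamma> xs @ rev (drop \<gamma> xs)) ((\<gamma> + 1) mod DIM('a))"
      using C(1) bW A mb unfolding bS by auto
    moreover have "C' = TSimplex (b # midpoint a' b # take \<gamma> xs @ rev (drop \<gamma> xs)) ((\<gamma> + 1) mod DIM('a))"
      using C(2) bW A' mb e \<gamma> by (auto simp: bisect_TSimplex)
    ultimately show ?thesis using differ_onceI[OF m, of "[b]"] by (simp add: label_reflected_def)
  next
    case (Cons p ps')
    then have e: "a' = a" using * by simp
    have "qs = []"
    proof (rule ccontr)
      assume "qs \<noteq> []"
      moreover have "last (a # xs @ [b]) = last (ps @ x # qs)" "last (a' # xs' @ [b']) = last (ps @ y # qs)"
        using * by simp_all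
      ultimately have "b' = b" by simp
      then have "edge_ends S1 = edge_ends S'" using e A(1) A'(1) by (simp add: edge_ends_def)
      then show False using False S1(4) edge_ends_subset[OF assms(2)] by simp
    qed
    then have e': "xs' = xs" "b' \<noteq> b" using * Cons by auto
    have aW: "a \<in> vset C" "a \<in> vset C'" using W A A' e S1(3) by auto
    have m: "midpoint a b \<noteq> midpoint a b'" using e'(2) by (simp add: midpoint_def)
    have ma: "a \<noteq> midpoint a b" "a \<noteq> midpoint a b'" using A(2) A'(2) e
      by (metis midpoint_eq_endpoint(1))+
    have nu: "a \<notin> set (b # midpoint a b # take \<gamma> xs @ rev (drop \<gamma> xs))"
      "a \<notin> set (b' # midpoint a b' # take \<gamma> xs @ rev (drop \<gamma> xs))"
      using A(2,3) A'(2) e ma by (simp_all add: set_rev_drop flip: Un_iff)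
    have "C = TSimplex (a # midpoint a b # xs) ((\<gamma> + 1) mod DIM('a))"
      using C(1) aW(1) nu(1) unfolding bS by (elim insertE) simp_all
    moreover have "C' = TSimplex (a # midpoint a b' # xs) ((\<gamma> + 1) mod DIM('a))"
      using C(2) aW(2) nu(2) unfolding A'(1) bisect_TSimplex e e' \<gamma> by (elim insertE) simp_all
    ultimately show ?thesis using differ_onceI[OF m, of "[a]"] by (simp add: label_reflected_def)
  qed
  then show ?thesis using False by (simp add: compat_def)
qed

lemma label_reflected_bisect:
  assumes "tagged_simplex S" "tagged_simplex S'" "label_reflected S S'" "edge_ends S' = edge_ends S"
    and C: "C \<in> bisect S" "C' \<in> bisect S'" "hd (verts C) = hd (verts C')"
  shows "label_reflected C C'"
proof -
  obtain S1 where S1: "tagged_simplex S1" "bisect S1 = bisect S" "vset S1 = vset S" "edge_ends S1 = edge_ends S"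
    "stype S1 = stype S'" "differ_once (verts S1) (verts S')"
    using assms(1,3) by (rule label_reflected_cases)
  obtain a xs b \<gamma> where A: "S1 = TSimplex (a # xs @ [b]) \<gamma>" "a \<noteq> b" "a \<notin> set xs" "b \<notin> set xs"
    "length xs = DIM('a) - 1"
    using S1(1) by (rule tagged_simplexE)
  obtain a' xs' b' \<gamma>' where A': "S' = TSimplex (a' # xs' @ [b']) \<gamma>'" "a' \<noteq> b'" "a' \<notin> set xs'" "b' \<notin> set xs'"
    "length xs' = DIM('a) - 1"
    using assms(2) by (rule tagged_simplexE)
  have \<gamma>: "\<gamma>' = \<gamma>" using S1(5) A A' by simp
  have bS: "bisect S = {TSimplex (a # midpoint a b # xs) ((\<gamma> + 1) mod DIM('a)),
     TSimplex (b # midpoint a b # take \<gamma> xs @ rev (drop \<gamma> xs)) ((\<gamma> + 1) mod DIM('a))}"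
    unfolding S1(2)[symmetric] A(1) by (rule bisect_TSimplex)
  obtain ps x y qs where *: "a # xs @ [b] = ps @ x # qs" "a' # xs' @ [b'] = ps @ y # qs" "x \<noteq> y"
    using S1(6) A A' by (auto simp: differ_once_iff)
  have edge_ends: "{a', b'} = {a, b}" using assms(4) S1(4) A A' by (auto simp: edge_ends_def)
  have "ps \<noteq> []"
  proof
    assume "ps = []"
    then have "a' \<noteq> a" "b' = b" using * A(5) A'(5) by auto
    then show False using edge_ends A'(2) by (auto simp: doubleton_eq_iff)
  qed
  then obtain ps' where ps: "ps = a # ps'" "a' = a" using * by (cases ps) auto
  have "b' = b" using edge_ends ps A(2) by (auto simp: doubleton_eq_iff)
  then have "qs \<noteq> []" using * by auto
  moreover have "last (a # xs @ [b]) = last (ps @ x # qs)" using *(1) by simp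
  ultimately have "last qs = b" by simp
  then obtain qs' where "qs = qs' @ [b]" using \<open>qs \<noteq> []\<close> append_butlast_last_id by metis
  then have d: "differ_once xs xs'" using * ps \<open>b' = b\<close> by (auto simp: differ_once_iff)
  have "differ_once (a # midpoint a b # xs) (a # midpoint a b # xs')"
    using differ_once_context[OF d, of "[a, midpoint a b]" "[]"] by simp
  moreover have "differ_once (b # midpoint a b # take \<gamma> xs @ rev (drop \<gamma> xs)) (b # midpoint a b # take \<gamma> xs' @ rev (drop \<gamma> xs'))"
    using differ_once_context[OF differ_once_rev_drop[OF d], of "[b, midpoint a b]" _ "[]"] by simp
  moreover have "bisect S' = {TSimplex (a # midpoint a b # xs') ((\<gamma> + 1) mod DIM('a)),
     TSimplex (b # midpoint a b # take \<gamma> xs' @ rev (drop \<gamma> xs')) ((\<gamma> + 1) mod DIM('a))}"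
    using A' ps \<open>b' = b\<close> \<gamma> bisect_TSimplex by simp
  ultimately show ?thesis using C A(2) unfolding bS by (auto simp: label_reflected_def)
qed

text \<open>The two children of a simplex are in general not reflected neighbours of each other; only
  their children at the common hyperface are.\<close>

lemma siblings_compat:
  fixes S :: "'a::euclidean_space tsimplex"
  assumes S: "tagged_simplex S" and d: "2 \<le> DIM('a)"
    and C: "C \<in> bisect S" "C' \<in> bisect S" "C \<noteq> C'"
  shows "compat C C'"
proof -
  obtain a xs b \<gamma> where A: "S = TSimplex (a # xs @ [b]) \<gamma>" "a \<noteq> b" "a \<notin> set xs" "b \<notin> set xs"
    "length xs = DIM('a) - 1" "\<gamma> \<le> length xs" "distinct xs" "\<gamma> < DIM('a)"
    using S by (rule tagged_simplexE)
  define m where "m = midpoint a b"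
  define \<gamma>' where "\<gamma>' = (\<gamma> + 1) mod DIM('a)"
  define us where "us = take \<gamma> xs"
  define ws where "ws = drop \<gamma> xs"
  have xs: "xs = us @ ws" and lus: "length us = \<gamma>" using A(6) by (auto simp: us_def ws_def)
  define L where "L = TSimplex (a # m # us @ ws) \<gamma>'"
  define U where "U = TSimplex (b # m # us @ rev ws) \<gamma>'"
  have bis: "bisect S = {L, U}" using A(1) bisect_TSimplex[of a xs b \<gamma>]
    by (simp add: L_def U_def m_def \<gamma>'_def us_def ws_def)
  have tag: "tagged_simplex L" "tagged_simplex U" using bis tagged_bisect(1)[OF S] by auto
  then have dist: "distinct (verts L)" "distinct (verts U)" by (auto simp: tagged_simplex_def)
  have W: "vset L \<inter> vset U = insert m (set xs)" using dist A(2-4) by (auto simp: L_def U_def xs)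
  have xne: "xs \<noteq> []" using A(5) d by auto
  have notin: "a \<notin> vset U" "b \<notin> vset L" using dist A(2-4) by (auto simp: L_def U_def xs)
  have rL: "\<not> edge_ends L \<subseteq> vset U" "\<not> edge_ends U \<subseteq> vset L" using notin by (auto simp: edge_ends_def L_def U_def)
  have *: "label_reflected A B \<and> label_reflected B A" if AB: "A \<in> bisect L" "B \<in> bisect U" "insert m (set xs) \<subseteq> vset A"
    "insert m (set xs) \<subseteq> vset B" for A B
  proof -
    have "us @ ws \<noteq> []" "us @ rev ws \<noteq> []" using xne xs by auto
    then have lasts: "last (verts L) = last (us @ ws)" "last (verts U) = last (us @ rev ws)"
      unfolding L_def U_def tsimplex.sel by (simp_all only: last_ConsR list.distinct simp_thms)
    have "last (us @ ws) \<in> set (us @ ws)" "last (us @ rev ws) \<in> set (us @ rev ws)"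
      by (rule last_in_set, fact)+
    then have "last (verts L) \<in> set xs" "last (verts U) \<in> set xs"
      unfolding lasts by (simp_all add: xs)
    then have lst: "last (verts L) \<in> vset A" "last (verts U) \<in> vset B" using AB by auto
    show ?thesis
    proof (cases "ws = []")
      case True
      then have \<gamma>0: "\<gamma>' = 0" using A(5,6) xs lus d by (simp add: \<gamma>'_def)
      obtain us' w where us: "us = us' @ [w]" using xne xs True by (metis append_Nil2 rev_exhaust)
      have LU: "L = TSimplex (a # (m # us') @ [w]) 0" "U = TSimplex (b # (m # us') @ [w]) 0"
        by (simp_all add: L_def U_def True us \<gamma>0)
      have dd: "w \<noteq> a" "w \<noteq> b" "w \<notin> set (m # us')" using dist by (auto simp: LU)
      have w: "w \<in> vset A" "w \<in> vset B" using lst LU by auto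
      have mm: "w \<noteq> midpoint a w" "w \<noteq> midpoint b w" using dd by (metis midpoint_eq_endpoint(2))+
      have "A = TSimplex (w # midpoint a w # rev (m # us')) (1 mod DIM('a))"
        using AB(1) w dd mm unfolding LU bisect_TSimplex by auto
      moreover have "B = TSimplex (w # midpoint b w # rev (m # us')) (1 mod DIM('a))"
        using AB(2) w dd mm unfolding LU bisect_TSimplex by auto
      moreover have "midpoint a w \<noteq> midpoint b w" using A(2) by (simp add: midpoint_def)
      ultimately show ?thesis
        using differ_onceI[of "midpoint a w" "midpoint b w" "[w]"] differ_onceI[of "midpoint b w" "midpoint a w" "[w]"]
        by (simp add: label_reflected_def)
    next
      case False
      then have \<gamma>': "\<gamma>' = Suc \<gamma>" using A(5,6) xs lus d by (cases ws) (auto simp: \<gamma>'_def)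
      obtain w1 v1 where w1: "ws = w1 # v1" using False by (cases ws) auto
      obtain v2 w where w: "ws = v2 @ [w]" using False by (metis rev_exhaust)
      have LU: "L = TSimplex (a # (m # us @ v2) @ [w]) (Suc \<gamma>)" "U = TSimplex (b # (m # us @ rev v1) @ [w1]) (Suc \<gamma>)"
        by (simp add: L_def \<gamma>' w) (simp add: U_def \<gamma>' w1)
      have dd: "w \<noteq> a" "w1 \<noteq> b" "w \<notin> set (m # us @ v2)" "w1 \<notin> set (m # us @ rev v1)"
        using dist by (auto simp: LU)
      have ww: "w \<in> vset A" "w1 \<in> vset B" using lst LU by auto
      have mm: "w \<noteq> midpoint a w" "w1 \<noteq> midpoint b w1" using dd by (metis midpoint_eq_endpoint(2))+
      define \<mu> where "\<mu> = midpoint a w"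
      define \<mu>' where "\<mu>' = midpoint b w1"
      define \<delta> where "\<delta> = (Suc \<gamma> + 1) mod DIM('a)"
      have Aeq: "A = TSimplex (w # \<mu> # m # us @ rev v2) \<delta>"
        using AB(1) ww dd mm unfolding LU bisect_TSimplex by (auto simp: lus \<mu>_def \<delta>_def)
      have Beq: "B = TSimplex (w1 # \<mu>' # m # us @ v1) \<delta>"
        using AB(2) ww dd mm unfolding LU bisect_TSimplex by (auto simp: lus \<mu>'_def \<delta>_def)
      have tAB: "tagged_simplex A" "tagged_simplex B" using tagged_bisect(1) tag AB by blast+
      have mne: "\<mu> \<noteq> \<mu>'"
      proof
        assume "\<mu> = \<mu>'"
        then have "midpoint a w \<in> convex hull {b, w1}"
          by (simp add: \<mu>_def \<mu>'_def flip: segment_convex_hull)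
        moreover have "\<not> affine_dependent (vset S)" using S by (simp add: tagged_simplex_def)
        moreover have ws: "w \<in> set ws" "w1 \<in> set ws" by (simp add: w) (simp add: w1)
        moreover have "vset S = insert a (insert b (set us \<union> set ws))" by (auto simp: A(1) xs)
        ultimately have "a \<in> {b, w1}"
          using midpoint_in_hull[of "vset S" "{b, w1}" a w] by blast
        then show False using A(2,3) ws by (auto simp: xs)
      qed
      show ?thesis
      proof (cases v2)
        case Nil
        then have "w1 # v1 = [w]" using w1 w by simp
        then have "v1 = []" "w1 = w" by simp_all
        then show ?thesis using Aeq Beq Nil mne
          differ_onceI[of \<mu> \<mu>' "[w]"] differ_onceI[of \<mu>' \<mu> "[w]"] by (simp add: label_reflected_def)
      next
        case (Cons z v)
        then have "w1 # v1 = z # v @ [w]" using w1 w by simp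
        then have v: "v2 = w1 # v" "v1 = v @ [w]" using Cons by simp_all
        have "length us + 2 \<le> DIM('a) - 1" using A(5) xs w1 v by simp
        then have \<delta>: "\<delta> = Suc (Suc \<gamma>)" by (simp add: \<delta>_def lus)
        have "reflect A = TSimplex (w1 # \<mu> # m # us @ v @ [w]) \<delta>"
          using reflect_TSimplex[of w "\<mu> # m # us @ rev v" w1 \<delta>] by (simp add: Aeq v \<delta> lus)
        moreover have "reflect B = TSimplex (w # \<mu>' # m # us @ rev v @ [w1]) \<delta>"
          using reflect_TSimplex[of w1 "\<mu>' # m # us @ v" w \<delta>] by (simp add: Beq v \<delta> lus)
        ultimately show ?thesis using mne Aeq Beq v
          differ_onceI[of \<mu> \<mu>' "[w1]"] differ_onceI[of \<mu>' \<mu> "[w]"] by (simp add: label_reflected_def)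
      qed
    qed
  qed
  have "compat L U" unfolding compat_def W using rL * by simp
  moreover have "compat U L" unfolding compat_def Int_commute[of "vset U"] W using rL * by simp
  ultimately show ?thesis using C bis by auto
qed

lemma edge_ends_child_subset:
  fixes S :: "'a::euclidean_space tsimplex"
  assumes S: "tagged_simplex S" and d: "2 \<le> DIM('a)" and C: "C \<in> bisect S"
    and F: "F \<subseteq> vset S" "card F = DIM('a)" "\<not> edge_ends S \<subseteq> F" "F \<subseteq> vset C"
  shows "edge_ends C \<subseteq> F"
proof -
  obtain a xs b \<gamma> where A: "S = TSimplex (a # xs @ [b]) \<gamma>" "a \<noteq> b" "a \<notin> set xs" "b \<notin> set xs"
    "length xs = DIM('a) - 1"
    using S by (rule tagged_simplexE)
  have xne: "xs \<noteq> []" using A(5) d by auto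
  have edge_ends: "edge_ends S = {a, b}" using A by (simp add: edge_ends_def)
  have cV: "card (vset S) = DIM('a) + 1" using card_vset[OF S] .
  have "card (vset S - F) = 1"
    using F(1,2) cV finite_subset[OF F(1)] by (simp add: card_Diff_subset)
  then obtain z where z: "vset S - F = {z}" using card_1_singletonE by blast
  have zab: "z = a \<or> z = b" using F(3) edge_ends z A by auto
  have Feq: "F = vset S - {z}" using z F(1) by blast
  have m: "midpoint a b \<notin> vset S" using midpoint_not_vertex[of "vset S" a b] S A
    by (simp add: tagged_simplex_def)
  have "length (take \<gamma> xs @ rev (drop \<gamma> xs)) = length xs" by simp
  then have ne: "take \<gamma> xs @ rev (drop \<gamma> xs) \<noteq> []" using xne by (metis length_0_conv)
  have lst: "last (take \<gamma> xs @ rev (drop \<gamma> xs)) \<in> set xs"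
    using last_in_set[OF ne] unfolding set_append set_rev set_rev_drop .
  have mab: "a \<noteq> midpoint a b" "b \<noteq> midpoint a b" using A(2) midpoint_eq_endpoint[of a b] by metis+
  consider "C = TSimplex (a # midpoint a b # xs) ((\<gamma> + 1) mod DIM('a))"
    | "C = TSimplex (b # midpoint a b # take \<gamma> xs @ rev (drop \<gamma> xs)) ((\<gamma> + 1) mod DIM('a))"
    using C by (auto simp: A(1) bisect_TSimplex)
  then show ?thesis
  proof cases
    case 1
    then have "b \<notin> F" using F(4) A mab by auto
    then have "z = b" using zab Feq A by auto
    then show ?thesis using 1 Feq A xne by (auto simp: edge_ends_def)
  next
    case 2
    then have "a \<notin> F" using F(4) A mab set_rev_drop[of \<gamma> xs] by auto
    then have "z = a" using zab Feq A by auto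
    then show ?thesis using 2 Feq A lst ne by (auto simp: edge_ends_def)
  qed
qed

section \<open>Face-connected stars in Lipschitz domains\<close>

lemma interior_full_simplex_nonempty:
  fixes V :: "'a::euclidean_space set"
  assumes "\<not> affine_dependent V" "card V = DIM('a) + 1"
  shows "interior (convex hull V) \<noteq> {}"
proof -
  have "aff_dim V = int DIM('a)" using aff_dim_affine_independent[OF assms(1)] assms(2) by simp
  then have "affine hull (convex hull V) = UNIV"
    using aff_dim_eq_full[of "convex hull V"] aff_dim_convex_hull[of V] by simp
  then have "interior (convex hull V) = rel_interior (convex hull V)"
    by (simp add: rel_interior_interior)
  moreover have "V \<noteq> {}" using assms(2) by auto
  ultimately show ?thesis using rel_interior_eq_empty[of "convex hull V"] by simp
qed

lemma avoid_low_dimension: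
  fixes U :: "'a::euclidean_space set"
  assumes "open U" "U \<noteq> {}" "finite \<G>" "\<And>G. G \<in> \<G> \<Longrightarrow> aff_dim G < int DIM('a)"
  obtains u where "u \<in> U" "\<And>G. G \<in> \<G> \<Longrightarrow> u \<notin> affine hull G"
proof -
  have "negligible (affine hull G)" if "G \<in> \<G>" for G
  proof -
    have "interior (affine hull G) = {}"
      using aff_dim_nonempty_interior[of "affine hull G"] assms(4)[OF that] by (metis aff_dim_affine_hull less_irrefl)
    then show ?thesis using negligible_convex_interior[of "affine hull G"] affine_imp_convex[OF affine_affine_hull] by blast
  qed
  then have "negligible (\<Union>G\<in>\<G>. affine hull G)"
    using assms(3) by (intro negligible_Union) auto
  then have "\<not> U \<subseteq> (\<Union>G\<in>\<G>. affine hull G)"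
    using open_not_negligible[OF assms(1,2)] negligible_subset by blast
  then show ?thesis using that by blast
qed

lemma lipschitz_locally_connected:
  fixes \<Omega> :: "'a::euclidean_space set"
  assumes op: "open \<Omega>" and lip: "lipschitz_boundary \<Omega>" and x: "x \<in> closure \<Omega>" and "0 < \<epsilon>"
  obtains \<delta> where "0 < \<delta>"
    "\<And>p q. p \<in> \<Omega> \<inter> ball x \<delta> \<Longrightarrow> q \<in> \<Omega> \<inter> ball x \<delta> \<Longrightarrow>
       \<exists>C. connected C \<and> p \<in> C \<and> q \<in> C \<and> C \<subseteq> \<Omega> \<inter> ball x \<epsilon>"
proof (cases "x \<in> \<Omega>")
  case True
  then obtain r where r: "0 < r" "ball x r \<subseteq> \<Omega>" using op openE by blast
  show ?thesis
  proof (rule that[of "min r \<epsilon>"])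
    show "0 < min r \<epsilon>" using r assms(4) by simp
    fix p q assume "p \<in> \<Omega> \<inter> ball x (min r \<epsilon>)" "q \<in> \<Omega> \<inter> ball x (min r \<epsilon>)"
    then show "\<exists>C. connected C \<and> p \<in> C \<and> q \<in> C \<and> C \<subseteq> \<Omega> \<inter> ball x \<epsilon>"
      using r(2) by (intro exI[of _ "ball x (min r \<epsilon>)"]) auto
  qed
next
  case False
  then have "x \<in> frontier \<Omega>" using x op by (simp add: frontier_def interior_open)
  then obtain e \<phi> L r where e: "norm e = 1" and r: "0 < r" and L: "L-lipschitz_on {z. z \<bullet> e = 0} \<phi>"
    and \<Omega>: "\<Omega> \<inter> ball x r = {y \<in> ball x r. y \<bullet> e < \<phi> (y - (y \<bullet> e) *\<^sub>R e)}"
    using lip unfolding lipschitz_boundary_def by meson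
  have L0: "0 \<le> L" using L lipschitz_on_nonneg by blast
  have ee: "e \<bullet> e = 1" using e by (simp add: norm_eq_1)
  define \<pi> where "\<pi> = (\<lambda>y. y - (y \<bullet> e) *\<^sub>R e)"
  have \<pi>0: "\<pi> y \<bullet> e = 0" for y by (simp add: \<pi>_def inner_diff_left ee)
  have \<pi>shift: "\<pi> (y - s *\<^sub>R e) = \<pi> y" for y s
    by (simp add: \<pi>_def inner_diff_left ee algebra_simps)
  have \<pi>norm: "norm (\<pi> y) \<le> norm y" for y
  proof -
    have "(norm y)\<^sup>2 = (norm (\<pi> y))\<^sup>2 + (y \<bullet> e)\<^sup>2"
      using norm_add_Pythagorean[of "\<pi> y" "(y \<bullet> e) *\<^sub>R e"] \<pi>0[of y] e
      by (simp add: orthogonal_def \<pi>_def)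
    then have "(norm (\<pi> y))\<^sup>2 \<le> (norm y)\<^sup>2" by simp
    then show ?thesis by (rule power2_le_imp_le) simp
  qed
  have \<pi>dist: "dist (\<pi> y) (\<pi> z) \<le> dist y z" for y z
  proof -
    have "\<pi> y - \<pi> z = \<pi> (y - z)" by (simp add: \<pi>_def inner_diff_left algebra_simps)
    then show ?thesis using \<pi>norm[of "y - z"] by (simp add: dist_norm)
  qed
  have mem: "y \<in> \<Omega> \<inter> ball x r \<longleftrightarrow> y \<in> ball x r \<and> y \<bullet> e < \<phi> (\<pi> y)" for y
    unfolding \<Omega> \<pi>_def by blast
  have in\<Omega>: "y \<in> \<Omega>" if "y \<in> ball x r" "y \<bullet> e < \<phi> (\<pi> y)" for y using mem[of y] that by blast
  have \<Omega>in: "y \<bullet> e < \<phi> (\<pi> y)" if "y \<in> ball x r" "y \<in> \<Omega>" for y using mem[of y] that by blast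
  define \<eta> where "\<eta> = min \<epsilon> r"
  define \<delta> where "\<delta> = \<eta> / (2 * L + 4)"
  define h where "h = 2 * (L + 1) * \<delta>"
  have \<eta>: "0 < \<eta>" using r assms(4) by (simp add: \<eta>_def)
  then have \<delta>: "0 < \<delta>" using L0 by (simp add: \<delta>_def)
  then have h: "0 \<le> h" using L0 by (simp add: h_def)
  have "(2 * L + 4) * \<delta> = \<eta>" using L0 by (simp add: \<delta>_def)
  then have \<delta>h: "\<delta> + h < \<eta>" using \<delta> by (simp add: h_def algebra_simps)
  have shift: "y - s *\<^sub>R e \<in> ball x \<eta>" if "y \<in> ball x \<delta>" "0 \<le> s" "s \<le> h" for y s
  proof -
    have "dist x (y - s *\<^sub>R e) \<le> dist x y + norm (s *\<^sub>R e)"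
      using norm_triangle_ineq[of "x - y" "s *\<^sub>R e"] by (simp add: dist_norm algebra_simps)
    then show ?thesis using that \<delta>h e by simp
  qed
  show ?thesis
  proof (rule that[of \<delta>])
    show "0 < \<delta>" by fact
    fix p q assume p: "p \<in> \<Omega> \<inter> ball x \<delta>" and q: "q \<in> \<Omega> \<inter> ball x \<delta>"
    have sub: "ball x \<eta> \<subseteq> ball x r" "ball x \<eta> \<subseteq> ball x \<epsilon>" by (auto simp: \<eta>_def)
    have \<delta>\<eta>: "ball x \<delta> \<subseteq> ball x \<eta>" using \<delta>h h by auto
    have down: "closed_segment y (y - h *\<^sub>R e) \<subseteq> \<Omega> \<inter> ball x \<epsilon>" if y: "y \<in> \<Omega> \<inter> ball x \<delta>" for y
    proof
      fix z assume "z \<in> closed_segment y (y - h *\<^sub>R e)"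
      then obtain u where u: "0 \<le> u" "u \<le> 1" "z = (1 - u) *\<^sub>R y + u *\<^sub>R (y - h *\<^sub>R e)"
        by (auto simp: in_segment)
      then have z: "z = y - (u * h) *\<^sub>R e" by (simp add: algebra_simps)
      have s: "0 \<le> u * h" "u * h \<le> h" using u h by (auto simp: mult_left_le_one_le)
      have zb: "z \<in> ball x \<eta>" unfolding z using shift[OF _ s] y by blast
      have "z \<bullet> e \<le> y \<bullet> e" using s by (simp add: z inner_diff_left ee)
      also have "\<dots> < \<phi> (\<pi> y)" using \<Omega>in[of y] y \<delta>\<eta> sub by blast
      also have "\<pi> y = \<pi> z" by (simp add: z \<pi>shift)
      finally show "z \<in> \<Omega> \<inter> ball x \<epsilon>" using in\<Omega> zb sub by blast
    qed
    have across: "closed_segment (p - h *\<^sub>R e) (q - h *\<^sub>R e) \<subseteq> \<Omega> \<inter> ball x \<epsilon>"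
    proof
      fix z assume "z \<in> closed_segment (p - h *\<^sub>R e) (q - h *\<^sub>R e)"
      then obtain u where u: "0 \<le> u" "u \<le> 1" "z = (1 - u) *\<^sub>R (p - h *\<^sub>R e) + u *\<^sub>R (q - h *\<^sub>R e)"
        by (auto simp: in_segment)
      define w where "w = (1 - u) *\<^sub>R p + u *\<^sub>R q"
      have z: "z = w - h *\<^sub>R e" by (simp add: u(3) w_def algebra_simps)
      have w: "w \<in> ball x \<delta>" using convexD_alt[OF convex_ball, of p x \<delta> q u] p q u by (simp add: w_def)
      have zb: "z \<in> ball x \<eta>" unfolding z using shift[OF w h] by simp
      have wp: "dist w p \<le> 2 * \<delta>" using w p dist_triangle[of w p x] by (simp add: dist_commute)
      have "\<bar>(w - p) \<bullet> e\<bar> \<le> norm (w - p)" using Cauchy_Schwarz_ineq2[of "w - p" e] e by simp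
      then have "w \<bullet> e \<le> p \<bullet> e + 2 * \<delta>" using wp by (simp add: inner_diff_left dist_norm)
      moreover have "p \<bullet> e < \<phi> (\<pi> p)" using \<Omega>in[of p] p \<delta>\<eta> sub by blast
      moreover have "dist (\<phi> (\<pi> w)) (\<phi> (\<pi> p)) \<le> L * dist (\<pi> w) (\<pi> p)"
        using lipschitz_onD[OF L] \<pi>0 by simp
      moreover have "L * dist (\<pi> w) (\<pi> p) \<le> L * (2 * \<delta>)"
        using \<pi>dist[of w p] wp L0 by (intro mult_left_mono) auto
      ultimately have "w \<bullet> e < \<phi> (\<pi> w) + 2 * \<delta> + L * (2 * \<delta>)" by (simp add: dist_real_def)
      then have "w \<bullet> e - h < \<phi> (\<pi> w)" by (simp add: h_def algebra_simps)
      moreover have "z \<bullet> e = w \<bullet> e - h" by (simp add: z inner_diff_left ee)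
      moreover have "\<pi> z = \<pi> w" by (simp add: z \<pi>shift)
      ultimately show "z \<in> \<Omega> \<inter> ball x \<epsilon>" using in\<Omega>[of z] zb sub by auto
    qed
    let ?C = "closed_segment p (p - h *\<^sub>R e) \<union>
      (closed_segment (p - h *\<^sub>R e) (q - h *\<^sub>R e) \<union> closed_segment q (q - h *\<^sub>R e))"
    have "connected (closed_segment (p - h *\<^sub>R e) (q - h *\<^sub>R e) \<union> closed_segment q (q - h *\<^sub>R e))"
      by (rule connected_Un) (use ends_in_segment(2) in \<open>auto simp: disjoint_iff\<close>)
    then have "connected ?C"
      by (intro connected_Un[OF connected_segment(1)]) (use ends_in_segment in \<open>auto simp: disjoint_iff\<close>)
    then show "\<exists>C. connected C \<and> p \<in> C \<and> q \<in> C \<and> C \<subseteq> \<Omega> \<inter> ball x \<epsilon>"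
      using down[OF p] down[OF q] across by (intro exI[of _ ?C]) auto
  qed
qed

text \<open>Near \<open>x\<close> the domain is connected, and a generic segment avoids all faces of codimension at
  least two.\<close>

lemma star_face_connected:
  fixes \<Omega> :: "'a::euclidean_space set" and \<V> :: "'a set set"
  assumes op: "open \<Omega>" and lip: "lipschitz_boundary \<Omega>" and fin: "finite \<V>"
    and ind: "\<And>V. V \<in> \<V> \<Longrightarrow> \<not> affine_dependent V" and card: "\<And>V. V \<in> \<V> \<Longrightarrow> card V = DIM('a) + 1"
    and mf: "\<And>V W. V \<in> \<V> \<Longrightarrow> W \<in> \<V> \<Longrightarrow> meet_in_face V W"
    and cov: "(\<Union>V\<in>\<V>. convex hull V) = closure \<Omega>"
    and V0: "V0 \<in> \<A>" and \<A>: "\<A> \<subseteq> {V \<in> \<V>. x \<in> convex hull V}"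
    and step: "\<And>V W. V \<in> \<A> \<Longrightarrow> W \<in> \<V> \<Longrightarrow> x \<in> convex hull W \<Longrightarrow> card (V \<inter> W) = DIM('a) \<Longrightarrow> W \<in> \<A>"
  shows "{V \<in> \<V>. x \<in> convex hull V} \<subseteq> \<A>"
proof (rule ccontr)
  define \<B> where "\<B> = {V \<in> \<V>. x \<in> convex hull V} - \<A>"
  assume "\<not> {V \<in> \<V>. x \<in> convex hull V} \<subseteq> \<A>"
  then obtain V1 where V1: "V1 \<in> \<B>" by (auto simp: \<B>_def)
  have \<A>\<B>: "\<A> \<subseteq> \<V>" "\<B> \<subseteq> \<V>" using \<A> by (auto simp: \<B>_def)
  have fAB: "finite \<A>" "finite \<B>" using fin finite_subset \<A>\<B> by blast+
  have clV: "closed (convex hull V)" if "V \<in> \<V>" for V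
    using aff_independent_finite[OF ind[OF that]]
    by (simp add: compact_imp_closed finite_imp_compact_convex_hull)
  define FA where "FA = (\<Union>V\<in>\<A>. convex hull V)"
  define FB where "FB = (\<Union>V\<in>\<B>. convex hull V)"
  have cl: "closed FA" "closed FB" using fAB clV \<A>\<B> unfolding FA_def FB_def by (auto intro!: closed_UN)
  define FC where "FC = (\<Union>V\<in>\<V> - (\<A> \<union> \<B>). convex hull V)"
  have "closed FC" unfolding FC_def using fin clV by (intro closed_UN) auto
  then have "open (- FC)" by (rule open_Compl)
  moreover have "x \<in> - FC" using \<A> by (auto simp: \<B>_def FC_def)
  ultimately obtain \<epsilon> where \<epsilon>: "0 < \<epsilon>" "ball x \<epsilon> \<subseteq> - FC"
    unfolding open_contains_ball by blast
  have star: "\<Omega> \<inter> ball x \<epsilon> \<subseteq> FA \<union> FB"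
  proof
    fix y assume y: "y \<in> \<Omega> \<inter> ball x \<epsilon>"
    then have "y \<in> (\<Union>V\<in>\<V>. convex hull V)" using cov closure_subset by auto
    then obtain V where "V \<in> \<V>" "y \<in> convex hull V" by blast
    moreover have "y \<notin> FC" using \<epsilon>(2) y by blast
    ultimately show "y \<in> FA \<union> FB" unfolding FA_def FB_def FC_def by blast
  qed
  have dense: "interior (convex hull V) \<inter> ball y r \<noteq> {}" if "V \<in> \<V>" "y \<in> convex hull V" "0 < r" for V y r
  proof -
    have "closure (interior (convex hull V)) = closure (convex hull V)"
      using interior_full_simplex_nonempty[OF ind card] that(1) by (intro convex_closure_interior) auto
    then have "y \<in> closure (interior (convex hull V))" using that(2) closure_subset by blast
    then have "ball y r \<inter> closure (interior (convex hull V)) \<noteq> {}" using that(3) by force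
    then have "ball y r \<inter> interior (convex hull V) \<noteq> {}" using open_Int_closure_eq_empty[OF open_ball] by blast
    then show ?thesis by blast
  qed
  have point: "\<exists>p. p \<in> convex hull V \<and> p \<in> \<Omega> \<inter> ball x \<delta>" if "V \<in> \<V>" "x \<in> convex hull V" "0 < \<delta>" for V \<delta>
  proof -
    have "open (interior (convex hull V) \<inter> ball x \<delta>)" by auto
    moreover have "interior (convex hull V) \<inter> ball x \<delta> \<subseteq> closure \<Omega>"
      using interior_subset that(1) cov by blast
    ultimately have "interior (convex hull V) \<inter> ball x \<delta> \<inter> \<Omega> \<noteq> {}"
      using dense[OF that] open_Int_closure_eq_empty by blast
    then show ?thesis using interior_subset by blast
  qed
  have x: "x \<in> closure \<Omega>" using cov \<A> V0 by blast
  obtain \<delta> where \<delta>: "0 < \<delta>" "\<And>p q. p \<in> \<Omega> \<inter> ball x \<delta> \<Longrightarrow> q \<in> \<Omega> \<inter> ball x \<delta> \<Longrightarrow>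
       \<exists>C. connected C \<and> p \<in> C \<and> q \<in> C \<and> C \<subseteq> \<Omega> \<inter> ball x \<epsilon>"
    using lipschitz_locally_connected[OF op lip x \<epsilon>(1)] by blast
  obtain p where p: "p \<in> convex hull V0" "p \<in> \<Omega> \<inter> ball x \<delta>" using point[OF _ _ \<delta>(1)] V0 \<A> by blast
  obtain q where q: "q \<in> convex hull V1" "q \<in> \<Omega> \<inter> ball x \<delta>" using point[OF _ _ \<delta>(1)] V1 by (auto simp: \<B>_def)
  have split: "\<exists>y\<in>C. y \<in> FA \<and> y \<in> FB"
    if "connected C" "C \<subseteq> FA \<union> FB" "p \<in> C" "p \<in> FA" "q \<in> C" "q \<in> FB" for C p q
  proof (rule ccontr)
    assume "\<not> (\<exists>y\<in>C. y \<in> FA \<and> y \<in> FB)"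
    then have "FA \<inter> FB \<inter> C = {}" "FA \<inter> C \<noteq> {}" "FB \<inter> C \<noteq> {}" using that by auto
    then show False using that(1,2) cl unfolding connected_closed by blast
  qed
  have "\<exists>C. connected C \<and> p \<in> C \<and> q \<in> C \<and> C \<subseteq> \<Omega> \<inter> ball x \<epsilon>" by (rule \<delta>(2)[OF p(2) q(2)])
  then obtain C where "connected C \<and> p \<in> C \<and> q \<in> C \<and> C \<subseteq> \<Omega> \<inter> ball x \<epsilon>" ..
  then have C: "connected C" "p \<in> C" "q \<in> C" "C \<subseteq> \<Omega> \<inter> ball x \<epsilon>" by simp_all
  have "p \<in> FA" "q \<in> FB" using p(1) q(1) V0 V1 unfolding FA_def FB_def by auto
  then have "\<exists>y\<in>C. y \<in> FA \<and> y \<in> FB"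
    using split[OF C(1) order_trans[OF C(4) star] C(2) _ C(3)] by simp
  then obtain y where y: "y \<in> C" "y \<in> FA" "y \<in> FB" by auto
  obtain Va Vb where Vab: "Va \<in> \<A>" "y \<in> convex hull Va" "Vb \<in> \<B>" "y \<in> convex hull Vb"
    using y by (auto simp: FA_def FB_def)
  have "open (\<Omega> \<inter> ball x \<epsilon>)" "y \<in> \<Omega> \<inter> ball x \<epsilon>" using op y C by auto
  then obtain \<eta> where \<eta>: "0 < \<eta>" "ball y \<eta> \<subseteq> \<Omega> \<inter> ball x \<epsilon>" using openE by blast
  define \<G> where "\<G> = (\<lambda>(V, W). V \<inter> W) ` (\<A> \<times> \<B>)"
  have f\<G>: "finite \<G>" using fAB by (simp add: \<G>_def)
  have G: "finite G \<and> card G < DIM('a)" if "G \<in> \<G>" for G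
  proof -
    obtain V W where VW: "V \<in> \<A>" "W \<in> \<B>" "G = V \<inter> W" using \<open>G \<in> \<G>\<close> by (auto simp: \<G>_def)
    have VW': "V \<in> \<V>" "W \<in> \<V>" "x \<in> convex hull W" "W \<notin> \<A>" using VW \<A> by (auto simp: \<B>_def)
    have fV: "finite V" "finite W" using VW' ind aff_independent_finite by blast+
    have "card (V \<inter> W) \<noteq> DIM('a)" using step[OF VW(1) VW'(2,3)] VW'(4) by blast
    moreover have "card (V \<inter> W) \<noteq> DIM('a) + 1"
    proof
      assume "card (V \<inter> W) = DIM('a) + 1"
      then have "V \<inter> W = V" "V \<inter> W = W"
        using card VW' fV card_subset_eq[of V "V \<inter> W"] card_subset_eq[of W "V \<inter> W"] by auto
      then show False using VW VW' by auto
    qed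
    moreover have "card (V \<inter> W) \<le> DIM('a) + 1" using card_mono[of V "V \<inter> W"] fV card[OF VW'(1)] by simp
    ultimately show ?thesis using VW fV by simp
  qed
  have dim: "aff_dim G < int DIM('a)" "aff_dim (insert u G) < int DIM('a)" if "G \<in> \<G>" for G u
  proof -
    have "aff_dim G \<le> int (card G) - 1" using G[OF that] aff_dim_le_card by blast
    then show "aff_dim G < int DIM('a)" using G[OF that] by linarith
    have "aff_dim (insert u G) \<le> int (card (insert u G)) - 1" using G[OF that] aff_dim_le_card[of "insert u G"] by simp
    moreover have "card (insert u G) \<le> DIM('a)" using G[OF that] by (simp add: card_insert_if)
    ultimately show "aff_dim (insert u G) < int DIM('a)" by linarith
  qed
  obtain p' where p': "p' \<in> interior (convex hull Va) \<inter> ball y \<eta>" "\<And>G. G \<in> \<G> \<Longrightarrow> p' \<notin> affine hull G"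
  proof (rule avoid_low_dimension[of "interior (convex hull Va) \<inter> ball y \<eta>" \<G>])
    show "interior (convex hull Va) \<inter> ball y \<eta> \<noteq> {}" using dense[OF _ Vab(2) \<eta>(1)] Vab(1) \<A>\<B> by blast
  qed (use f\<G> dim(1) in auto)
  obtain q' where q': "q' \<in> interior (convex hull Vb) \<inter> ball y \<eta>" "\<And>G. G \<in> insert p' ` \<G> \<Longrightarrow> q' \<notin> affine hull G"
  proof (rule avoid_low_dimension[of "interior (convex hull Vb) \<inter> ball y \<eta>" "insert p' ` \<G>"])
    show "interior (convex hull Vb) \<inter> ball y \<eta> \<noteq> {}" using dense[OF _ Vab(4) \<eta>(1)] Vab(3) \<A>\<B> by blast
    show "aff_dim G < int DIM('a)" if "G \<in> insert p' ` \<G>" for G using that dim(2) by blast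
  qed (use f\<G> in auto)
  have seg: "closed_segment p' q' \<subseteq> ball y \<eta>" using p'(1) q'(1) by (intro closed_segment_subset) auto
  obtain z where z: "z \<in> closed_segment p' q'" "z \<in> FA" "z \<in> FB"
  proof -
    have "p' \<in> FA" "q' \<in> FB" using p'(1) q'(1) Vab interior_subset unfolding FA_def FB_def by blast+
    moreover have "closed_segment p' q' \<subseteq> FA \<union> FB" using seg \<eta>(2) star by blast
    ultimately show ?thesis using split[OF connected_segment(1), of p' q' p' q'] that by blast
  qed
  obtain V W where VW: "V \<in> \<A>" "z \<in> convex hull V" "W \<in> \<B>" "z \<in> convex hull W"
    using z by (auto simp: FA_def FB_def)
  then have "z \<in> convex hull (V \<inter> W)" using mf[of V W] \<A>\<B> unfolding meet_in_face_def by blast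
  then have zG: "z \<in> affine hull (V \<inter> W)" using convex_hull_subset_affine_hull by blast
  have G': "V \<inter> W \<in> \<G>" using VW by (auto simp: \<G>_def)
  then have "z \<noteq> p'" using zG p'(2) by blast
  obtain u where u: "z = (1 - u) *\<^sub>R p' + u *\<^sub>R q'" using z(1) by (auto simp: in_segment)
  then have u0: "u \<noteq> 0" using \<open>z \<noteq> p'\<close> by auto
  have "q' = (1 - 1 / u) *\<^sub>R p' + (1 / u) *\<^sub>R z"
    using u0 by (simp add: u algebra_simps flip: scaleR_left.add)
  moreover have "(1 - 1 / u) *\<^sub>R p' + (1 / u) *\<^sub>R z \<in> affine hull (insert p' (V \<inter> W))"
    using zG hull_mono[of "V \<inter> W" "insert p' (V \<inter> W)" affine]
    by (intro mem_affine[OF affine_affine_hull]) (auto intro: hull_inc)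
  ultimately show False using q'(2) G' by blast
qed

section \<open>Refinement trees and forests\<close>

definition generation :: "('b \<Rightarrow> 'b set) \<Rightarrow> 'b set \<Rightarrow> nat \<Rightarrow> 'b set" where
  "generation f X n = (\<Union>x\<in>X. iterated f n x)"

lemma generation_0 [simp]: "generation f X 0 = X"
  by (simp add: generation_def)

lemma generation_Suc: "generation f X (Suc n) = (\<Union>x\<in>generation f X n. f x)"
  by (auto simp: generation_def)

locale refinement_tree =
  fixes X0 :: "'b set" and f :: "'b \<Rightarrow> 'b set" and p :: "'b \<Rightarrow> 'c set" and ov :: "'c set \<Rightarrow> bool"
  assumes finite_X0: "finite X0"
    and finite_f: "x \<in> generation f X0 n \<Longrightarrow> finite (f x)"
    and cover: "x \<in> generation f X0 n \<Longrightarrow> (\<Union>y\<in>f x. p y) = p x"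
    and ov_self: "x \<in> generation f X0 n \<Longrightarrow> ov (p x)"
    and not_ov_empty: "\<not> ov {}"
    and ov_mono: "ov A \<Longrightarrow> A \<subseteq> B \<Longrightarrow> ov B"
    and separated: "x \<in> generation f X0 n \<Longrightarrow> y \<in> generation f X0 n \<Longrightarrow> ov (p x \<inter> p y) \<Longrightarrow> x = y"
begin

abbreviation "gen \<equiv> generation f X0"

lemma finite_gen: "finite (gen n)"
  by (induction n) (auto simp: finite_X0 generation_Suc finite_f)

lemma child_gen: "x \<in> gen n \<Longrightarrow> y \<in> f x \<Longrightarrow> y \<in> gen (Suc n)"
  by (auto simp: generation_Suc)

lemma child_subset: "x \<in> gen n \<Longrightarrow> y \<in> f x \<Longrightarrow> p y \<subseteq> p x"
  using cover by blast

lemma child_ex: "x \<in> gen n \<Longrightarrow> a \<in> p x \<Longrightarrow> \<exists>y\<in>f x. a \<in> p y"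
  using cover by blast

lemma gen_nonempty: "x \<in> gen n \<Longrightarrow> p x \<noteq> {}"
  using ov_self not_ov_empty by metis

lemma ov_subset: "x \<in> gen n \<Longrightarrow> p x \<subseteq> A \<Longrightarrow> ov A"
  using ov_self ov_mono by blast

lemma ancestor_ex:
  assumes "x \<in> gen n" "k \<le> n"
  shows "\<exists>y\<in>gen k. p x \<subseteq> p y"
  using assms
proof (induction n arbitrary: x)
  case (Suc n)
  show ?case
  proof (cases "k = Suc n")
    case False
    obtain z where z: "z \<in> gen n" "x \<in> f z" using Suc.prems(1) by (auto simp: generation_Suc)
    have "p x \<subseteq> p z" using z child_subset by blast
    moreover obtain y where "y \<in> gen k" "p z \<subseteq> p y" using Suc.IH[OF z(1)] Suc.prems(2) False by auto
    ultimately show ?thesis by blast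
  qed (use Suc.prems in auto)
qed auto

lemma ancestor_unique:
  assumes "x \<in> gen n" "y \<in> gen k" "y' \<in> gen k" "p x \<subseteq> p y" "p x \<subseteq> p y'"
  shows "y = y'"
  using separated[OF assms(2,3)] ov_subset[OF assms(1), of "p y \<inter> p y'"] assms(4,5) by blast

lemma subset_if_ov:
  assumes "x \<in> gen n" "y \<in> gen k" "k \<le> n" "ov (p x \<inter> p y)"
  shows "p x \<subseteq> p y"
proof -
  obtain y' where y': "y' \<in> gen k" "p x \<subseteq> p y'" using ancestor_ex assms(1,3) by blast
  then have "p x \<inter> p y \<subseteq> p y' \<inter> p y" by blast
  then have "y' = y" using separated[OF y'(1) assms(2)] ov_mono[OF assms(4)] by blast
  then show ?thesis using y' by simp
qed

lemma children_eq:
  assumes "x \<in> gen n"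
  shows "f x = {y \<in> gen (Suc n). p y \<subseteq> p x}"
proof
  show "f x \<subseteq> {y \<in> gen (Suc n). p y \<subseteq> p x}" using assms child_gen child_subset by blast
  show "{y \<in> gen (Suc n). p y \<subseteq> p x} \<subseteq> f x"
  proof
    fix y assume y: "y \<in> {y \<in> gen (Suc n). p y \<subseteq> p x}"
    then obtain x' where x': "x' \<in> gen n" "y \<in> f x'" by (auto simp: generation_Suc)
    have "x = x'" using ancestor_unique[of y "Suc n" x n x'] y x' assms child_subset[OF x'] by blast
    then show "y \<in> f x" using x' by simp
  qed
qed

lemma iterated_eq:
  assumes "x \<in> gen n"
  shows "iterated f m x = {y \<in> gen (n + m). p y \<subseteq> p x}"
proof (induction m)
  case 0
  have "y = x" if "y \<in> gen n" "p y \<subseteq> p x" for y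
    using ancestor_unique[of y n y n x] that assms by blast
  then show ?case using assms by auto
next
  case (Suc m)
  show ?case
  proof
    show "iterated f (Suc m) x \<subseteq> {y \<in> gen (n + Suc m). p y \<subseteq> p x}"
    proof
      fix y assume "y \<in> iterated f (Suc m) x"
      then obtain z where z: "z \<in> gen (n + m)" "p z \<subseteq> p x" "y \<in> f z" using Suc by auto
      then show "y \<in> {y \<in> gen (n + Suc m). p y \<subseteq> p x}"
        using child_gen[OF z(1,3)] child_subset[OF z(1,3)] by auto
    qed
    show "{y \<in> gen (n + Suc m). p y \<subseteq> p x} \<subseteq> iterated f (Suc m) x"
    proof
      fix y assume y: "y \<in> {y \<in> gen (n + Suc m). p y \<subseteq> p x}"
      then obtain z where z: "z \<in> gen (n + m)" "y \<in> f z" by (auto simp: generation_Suc)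
      have "p y \<subseteq> p z \<inter> p x" using y z child_subset by blast
      then have "ov (p z \<inter> p x)" using y ov_subset by blast
      then have "p z \<subseteq> p x" using subset_if_ov[OF z(1) assms] by simp
      then show "y \<in> iterated f (Suc m) x" using z Suc by auto
    qed
  qed
qed

lemma descendant_ex:
  assumes "x \<in> gen n" "n \<le> m" "a \<in> p x"
  shows "\<exists>y\<in>gen m. p y \<subseteq> p x \<and> a \<in> p y"
  using assms(2)
proof (induction m rule: dec_induct)
  case base
  then show ?case using assms by blast
next
  case (step m)
  then obtain y where y: "y \<in> gen m" "p y \<subseteq> p x" "a \<in> p y" by blast
  obtain z where "z \<in> f y" "a \<in> p z" using child_ex[OF y(1,3)] by blast
  then show ?case using y child_gen child_subset by blast
qed

end

locale forest =
  fixes N :: "nat \<Rightarrow> 'q set" and le :: "'q \<Rightarrow> 'q \<Rightarrow> bool"  (infix "\<sqsubseteq>" 50)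
  assumes finite_N: "finite (N n)"
    and le_refl [simp]: "Q \<sqsubseteq> Q"
    and le_trans: "Q \<sqsubseteq> Q' \<Longrightarrow> Q' \<sqsubseteq> Q'' \<Longrightarrow> Q \<sqsubseteq> Q''"
    and anc_ex: "Q \<in> N n \<Longrightarrow> k \<le> n \<Longrightarrow> \<exists>A\<in>N k. Q \<sqsubseteq> A"
    and anc_unique: "Q \<in> N n \<Longrightarrow> A \<in> N k \<Longrightarrow> B \<in> N k \<Longrightarrow> Q \<sqsubseteq> A \<Longrightarrow> Q \<sqsubseteq> B \<Longrightarrow> A = B"
    and level_mono: "Q \<in> N n \<Longrightarrow> A \<in> N k \<Longrightarrow> Q \<sqsubseteq> A \<Longrightarrow> k \<le> n"
    and child_ex: "Q \<in> N n \<Longrightarrow> \<exists>C\<in>N (Suc n). C \<sqsubseteq> Q"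
begin

definition "nodes = (\<Union>n. N n)"

lemma nodesI: "Q \<in> N n \<Longrightarrow> Q \<in> nodes" by (auto simp: nodes_def)

lemma level_unique: "Q \<in> N n \<Longrightarrow> Q \<in> N k \<Longrightarrow> n = k"
  using level_mono[of Q n Q k] level_mono[of Q k Q n] by simp

lemma anc_chain:
  assumes "Q \<in> N n" "A \<in> N k" "B \<in> N j" "Q \<sqsubseteq> A" "Q \<sqsubseteq> B" "j \<le> k"
  shows "A \<sqsubseteq> B"
proof -
  obtain B' where "B' \<in> N j" "A \<sqsubseteq> B'" using anc_ex assms by blast
  then show ?thesis using anc_unique[OF assms(1) _ assms(3), of B'] le_trans assms by metis
qed

lemma anc_same_level: "Q \<in> N n \<Longrightarrow> A \<in> N n \<Longrightarrow> Q \<sqsubseteq> A \<Longrightarrow> A = Q"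
  using anc_unique[of Q n A n Q] by simp

definition lower :: "'q set \<Rightarrow> bool" where
  "lower R \<longleftrightarrow> finite R \<and> R \<subseteq> nodes \<and> (\<forall>Q\<in>R. \<forall>A\<in>nodes. Q \<sqsubseteq> A \<longrightarrow> A \<in> R)"

definition leaves :: "'q set \<Rightarrow> 'q set" where
  "leaves R = {Q \<in> nodes - R. \<forall>A\<in>nodes. Q \<sqsubseteq> A \<and> A \<noteq> Q \<longrightarrow> A \<in> R}"

definition children :: "'q \<Rightarrow> 'q set" where
  "children Q = {C. \<exists>n. Q \<in> N n \<and> C \<in> N (Suc n) \<and> C \<sqsubseteq> Q}"

lemma lowerD: "lower R \<Longrightarrow> Q \<in> R \<Longrightarrow> A \<in> nodes \<Longrightarrow> Q \<sqsubseteq> A \<Longrightarrow> A \<in> R"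
  by (auto simp: lower_def)

lemma lower_nodes: "lower R \<Longrightarrow> Q \<in> R \<Longrightarrow> Q \<in> nodes"
  by (auto simp: lower_def)

lemma leavesD:
  assumes "Q \<in> leaves R"
  shows "Q \<in> nodes" "Q \<notin> R" "A \<in> nodes \<Longrightarrow> Q \<sqsubseteq> A \<Longrightarrow> A \<noteq> Q \<Longrightarrow> A \<in> R"
  using assms by (auto simp: leaves_def)

lemma lower_empty: "lower {}"
  by (simp add: lower_def)

lemma leaves_empty: "leaves {} = N 0"
proof
  show "leaves {} \<subseteq> N 0"
  proof
    fix Q assume Q: "Q \<in> leaves {}"
    then obtain n where n: "Q \<in> N n" by (auto simp: leaves_def nodes_def)
    obtain A where A: "A \<in> N 0" "Q \<sqsubseteq> A" using anc_ex[OF n] by blast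
    then have "A = Q" using leavesD(3)[OF Q nodesI[OF A(1)] A(2)] by blast
    then show "Q \<in> N 0" using A by simp
  qed
  show "N 0 \<subseteq> leaves {}"
  proof
    fix Q assume Q: "Q \<in> N 0"
    have "A = Q" if A: "A \<in> nodes" "Q \<sqsubseteq> A" for A
    proof -
      obtain k where "A \<in> N k" using A by (auto simp: nodes_def)
      moreover from this have "k = 0" using level_mono[OF Q _ A(2)] by simp
      ultimately show ?thesis using anc_same_level[OF Q _ A(2)] by simp
    qed
    then show "Q \<in> leaves {}" using nodesI[OF Q] by (auto simp: leaves_def)
  qed
qed

lemma leaf_antichain:
  assumes "Q \<in> leaves R" "Q' \<in> leaves R" "Q \<sqsubseteq> Q'"
  shows "Q = Q'"
  using leavesD(3)[OF assms(1) leavesD(1)[OF assms(2)] assms(3)] leavesD(2)[OF assms(2)] by blast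

lemma leaf_above:
  assumes "Q \<in> nodes" "Q \<notin> R"
  obtains L where "L \<in> leaves R" "Q \<sqsubseteq> L"
proof -
  obtain n where n: "Q \<in> N n" using assms(1) by (auto simp: nodes_def)
  define P where "P = (\<lambda>k. \<exists>A\<in>N k. Q \<sqsubseteq> A \<and> A \<notin> R)"
  have "P n" unfolding P_def using n assms(2) by (intro bexI[of _ Q]) simp_all
  then have "P (LEAST k. P k)" by (rule LeastI)
  then obtain L where L: "L \<in> N (LEAST k. P k)" "Q \<sqsubseteq> L" "L \<notin> R" by (auto simp: P_def)
  have "A \<in> R" if A: "A \<in> nodes" "L \<sqsubseteq> A" "A \<noteq> L" for A
  proof (rule ccontr)
    assume nA: "A \<notin> R"
    obtain k where k: "A \<in> N k" using A(1) by (auto simp: nodes_def)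
    have "k \<noteq> (LEAST k. P k)" using anc_same_level[OF L(1) _ A(2)] A(3) k by blast
    then have "k < (LEAST k. P k)" using level_mono[OF L(1) k A(2)] by simp
    moreover have "P k" using k nA le_trans[OF L(2) A(2)] by (auto simp: P_def)
    ultimately show False using not_less_Least by blast
  qed
  then have "L \<in> leaves R" using L nodesI by (auto simp: leaves_def)
  then show ?thesis using that L by blast
qed

lemma child_anc:
  assumes "Q \<in> N n" "C \<in> N (Suc n)" "C \<sqsubseteq> Q" "A \<in> nodes" "C \<sqsubseteq> A" "A \<noteq> C"
  shows "Q \<sqsubseteq> A"
proof -
  obtain k where k: "A \<in> N k" using assms(4) by (auto simp: nodes_def)
  have "k \<noteq> Suc n" using anc_same_level[OF assms(2) _ assms(5)] k assms(6) by blast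
  then have "k \<le> n" using level_mono[OF assms(2) k assms(5)] by simp
  then show ?thesis using anc_chain[OF assms(2,1) k assms(3,5)] by blast
qed

lemma leaf_descend:
  assumes R: "lower R" and Q: "Q \<in> N n" "Q \<in> R" "Pr Q"
    and step: "\<And>C k. C \<in> N k \<Longrightarrow> n \<le> k \<Longrightarrow> C \<sqsubseteq> Q \<Longrightarrow> Pr C \<Longrightarrow> \<exists>D\<in>N (Suc k). D \<sqsubseteq> C \<and> Pr D"
  obtains L k where "L \<in> leaves R" "L \<in> N k" "n < k" "L \<sqsubseteq> Q" "Pr L"
proof -
  have fR: "finite R" using R by (simp add: lower_def)
  define X where "X = {k. \<exists>C\<in>N k. n \<le> k \<and> C \<in> R \<and> C \<sqsubseteq> Q \<and> Pr C}"
  have "X \<subseteq> (\<lambda>C. THE k. C \<in> N k) ` R"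
  proof
    fix k assume "k \<in> X"
    then obtain C where C: "C \<in> N k" "C \<in> R" by (auto simp: X_def)
    have "(THE k. C \<in> N k) = k" using C level_unique by (intro the_equality) auto
    then show "k \<in> (\<lambda>C. THE k. C \<in> N k) ` R" using C by force
  qed
  then have fX: "finite X" using fR finite_surj by blast
  have nX: "n \<in> X" using Q by (auto simp: X_def)
  then have "Max X \<in> X" using fX Max_in by blast
  then obtain C where C: "C \<in> N (Max X)" "n \<le> Max X" "C \<in> R" "C \<sqsubseteq> Q" "Pr C" by (auto simp: X_def)
  obtain D where D: "D \<in> N (Suc (Max X))" "D \<sqsubseteq> C" "Pr D" using step[OF C(1,2,4,5)] by blast
  have DQ: "D \<sqsubseteq> Q" using le_trans D C by blast
  have "D \<notin> R"
  proof
    assume "D \<in> R"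
    then have "Suc (Max X) \<in> X" using D DQ C(2) by (auto simp: X_def)
    then show False using Max_ge[OF fX] by (metis not_less_eq_eq order_refl)
  qed
  moreover have "A \<in> R" if "A \<in> nodes" "D \<sqsubseteq> A" "A \<noteq> D" for A
    using child_anc[OF C(1) D(1,2) that] lowerD[OF R C(3) that(1)] by blast
  ultimately have "D \<in> leaves R" using nodesI[OF D(1)] by (auto simp: leaves_def)
  then show ?thesis using that[OF _ D(1) _ DQ D(3)] C(2) by simp
qed

lemma lower_insert:
  assumes "lower R" "Q \<in> leaves R"
  shows "lower (insert Q R)"
  using assms leavesD[OF assms(2)] unfolding lower_def by auto

lemma leaves_insert:
  assumes R: "lower R" and Q: "Q \<in> leaves R"
  shows "leaves (insert Q R) = (leaves R - {Q}) \<union> children Q"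
proof
  obtain n where n: "Q \<in> N n" using leavesD(1)[OF Q] by (auto simp: nodes_def)
  show "leaves (insert Q R) \<subseteq> (leaves R - {Q}) \<union> children Q"
  proof
    fix L assume L: "L \<in> leaves (insert Q R)"
    show "L \<in> (leaves R - {Q}) \<union> children Q"
    proof (cases "L \<sqsubseteq> Q")
      case False
      then have "\<forall>A\<in>nodes. L \<sqsubseteq> A \<and> A \<noteq> L \<longrightarrow> A \<in> R" using L by (auto simp: leaves_def)
      then show ?thesis using L False by (auto simp: leaves_def)
    next
      case True
      have LQ: "L \<noteq> Q" using L by (auto simp: leaves_def)
      obtain k where k: "L \<in> N k" using leavesD(1)[OF L] by (auto simp: nodes_def)
      have "n \<noteq> k" using anc_same_level[OF k _ True] n LQ by blast
      then have nk: "Suc n \<le> k" using level_mono[OF k n True] by simp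
      obtain C where C: "C \<in> N (Suc n)" "L \<sqsubseteq> C" using anc_ex[OF k nk] by blast
      have CQ: "C \<sqsubseteq> Q" using anc_chain[OF k C(1) n C(2) True] by simp
      have "C = L"
      proof (rule ccontr)
        assume "C \<noteq> L"
        then have "C \<in> insert Q R" using leavesD(3)[OF L nodesI[OF C(1)] C(2)] by blast
        moreover have "C \<noteq> Q" using level_unique[OF n, of "Suc n"] C(1) by auto
        ultimately have "Q \<in> R" using lowerD[OF R _ nodesI[OF n] CQ] by blast
        then show False using leavesD(2)[OF Q] by blast
      qed
      then show ?thesis using C CQ n by (auto simp: children_def)
    qed
  qed
  show "(leaves R - {Q}) \<union> children Q \<subseteq> leaves (insert Q R)"
  proof
    fix L assume "L \<in> (leaves R - {Q}) \<union> children Q"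
    then consider "L \<in> leaves R" "L \<noteq> Q" | "L \<in> children Q" by blast
    then show "L \<in> leaves (insert Q R)"
    proof cases
      case 1
      then show ?thesis by (auto simp: leaves_def)
    next
      case 2
      then obtain m where m: "Q \<in> N m" "L \<in> N (Suc m)" "L \<sqsubseteq> Q" by (auto simp: children_def)
      have "L \<notin> R" using lowerD[OF R _ nodesI[OF n] m(3)] leavesD(2)[OF Q] by blast
      moreover have "L \<noteq> Q" using level_unique[OF m(1), of "Suc m"] m(2) by auto
      moreover have "A \<in> insert Q R" if "A \<in> nodes" "L \<sqsubseteq> A" "A \<noteq> L" for A
        using child_anc[OF m that] leavesD(3)[OF Q that(1)] by blast
      ultimately show ?thesis using nodesI[OF m(2)] by (auto simp: leaves_def)
    qed
  qed
qed

lemma children_not_leaf: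
  assumes "Q \<in> leaves R" "C \<in> children Q"
  shows "C \<notin> leaves R"
proof
  assume "C \<in> leaves R"
  moreover obtain n where n: "Q \<in> N n" "C \<in> N (Suc n)" "C \<sqsubseteq> Q" using assms by (auto simp: children_def)
  ultimately have "C = Q" using leaf_antichain assms by blast
  then show False using level_unique[OF n(1), of "Suc n"] n(2) by simp
qed

end

locale mesh_forest = forest N le for N :: "nat \<Rightarrow> 'q set" and le :: "'q \<Rightarrow> 'q \<Rightarrow> bool"  (infix "\<sqsubseteq>" 50) +
  fixes \<nu> :: "'q \<Rightarrow> 'q \<Rightarrow> bool" and patch_mates :: "'q \<Rightarrow> 'q set"
  assumes \<nu>_sym: "\<nu> Q A \<Longrightarrow> \<nu> A Q"
    and \<nu>_refine: "Q \<in> N n \<Longrightarrow> A \<in> N k \<Longrightarrow> \<nu> Q A \<Longrightarrow> k \<le> m \<Longrightarrow> Suc m = n \<Longrightarrow> \<exists>B\<in>N m. \<nu> Q B \<and> B \<sqsubseteq> A"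
    and \<nu>_coarsen: "Q \<in> N n \<Longrightarrow> A \<in> N k \<Longrightarrow> \<nu> Q A \<Longrightarrow> B \<in> N j \<Longrightarrow> Q \<sqsubseteq> B \<Longrightarrow> k \<le> j \<Longrightarrow> B \<sqsubseteq> A \<or> \<nu> B A"
    and \<nu>_coarsen2: "Q \<in> N n \<Longrightarrow> A \<in> N k \<Longrightarrow> \<nu> Q A \<Longrightarrow> B \<in> N j \<Longrightarrow> A \<sqsubseteq> B \<Longrightarrow> j \<le> n \<Longrightarrow> Q \<sqsubseteq> B \<or> \<nu> Q B"
    and \<nu>_child: "Q \<in> N n \<Longrightarrow> A \<in> N k \<Longrightarrow> \<nu> Q A \<Longrightarrow> k \<le> n \<Longrightarrow> \<exists>C\<in>N (Suc n). C \<sqsubseteq> Q \<and> \<nu> C A"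
    and patch_mates_self: "Q \<in> N n \<Longrightarrow> Q \<in> patch_mates Q"
    and patch_mates_level: "Q \<in> N n \<Longrightarrow> patch_mates Q \<subseteq> N n"
    and patch_mates_eq: "Q \<in> N n \<Longrightarrow> Q' \<in> patch_mates Q \<Longrightarrow> patch_mates Q' = patch_mates Q"
begin

definition coarse_deps :: "'q \<Rightarrow> 'q set" where
  "coarse_deps Q = {Q'. \<exists>n. Q \<in> N (Suc n) \<and> Q' \<in> N n \<and> \<nu> Q Q'}"

definition dep_closed :: "'q set \<Rightarrow> bool" where
  "dep_closed R \<longleftrightarrow> lower R \<and> (\<forall>Q\<in>R. coarse_deps Q \<subseteq> R \<and> patch_mates Q \<subseteq> R)"

definition graded :: "'q set \<Rightarrow> bool" where
  "graded P \<longleftrightarrow> (\<forall>Q\<in>P. \<forall>Q'\<in>P. \<forall>n k. Q \<in> N n \<longrightarrow> Q' \<in> N k \<longrightarrow> \<nu> Q Q' \<longrightarrow> n \<le> k + 1)"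

lemma graded_coarse_deps:
  assumes R: "lower R" and g: "graded (leaves R)" and Q: "Q \<in> R"
  shows "coarse_deps Q \<subseteq> R"
proof
  fix Q' assume "Q' \<in> coarse_deps Q"
  then obtain n where n: "Q \<in> N (Suc n)" "Q' \<in> N n" "\<nu> Q Q'" by (auto simp: coarse_deps_def)
  show "Q' \<in> R"
  proof (rule ccontr)
    assume "Q' \<notin> R"
    then obtain L where L: "L \<in> leaves R" "Q' \<sqsubseteq> L" using leaf_above nodesI[OF n(2)] by blast
    obtain k where k: "L \<in> N k" using leavesD(1)[OF L(1)] by (auto simp: nodes_def)
    have kn: "k \<le> n" using level_mono[OF n(2) k L(2)] .
    have "\<not> Q \<sqsubseteq> L" using lowerD[OF R Q nodesI[OF k]] leavesD(2)[OF L(1)] by blast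
    then have \<nu>: "\<nu> Q L" using \<nu>_coarsen2[OF n k L(2)] kn by auto
    obtain L' j where L': "L' \<in> leaves R" "L' \<in> N j" "Suc n < j" "\<nu> L' L"
    proof (rule leaf_descend[OF R n(1) Q, of "\<lambda>C. \<nu> C L"])
      show "\<nu> Q L" by fact
      fix C i assume "C \<in> N i" "Suc n \<le> i" "\<nu> C L"
      then show "\<exists>D\<in>N (Suc i). D \<sqsubseteq> C \<and> \<nu> D L" using \<nu>_child[OF _ k] kn by auto
    qed blast
    then have "j \<le> k + 1" using g L(1) k unfolding graded_def by blast
    then show False using L'(3) kn by simp
  qed
qed

lemma dep_closed_\<nu>:
  assumes R: "dep_closed R" and Q: "Q \<in> R" "Q \<in> N n" and A: "A \<in> N k" "k < n" "\<nu> Q A"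
  shows "A \<in> R"
proof -
  obtain m where m: "n = Suc m" using A(2) by (cases n) auto
  obtain B where B: "B \<in> N m" "\<nu> Q B" "B \<sqsubseteq> A" using \<nu>_refine[OF Q(2) A(1,3)] A(2) m by auto
  then have "B \<in> coarse_deps Q" using Q m by (auto simp: coarse_deps_def)
  then have "B \<in> R" using R Q by (auto simp: dep_closed_def)
  then show ?thesis using R B(3) nodesI[OF A(1)] by (auto simp: dep_closed_def lower_def)
qed

lemma parent:
  assumes "Q \<in> leaves R" "Q \<in> N (Suc n)"
  obtains P where "P \<in> N n" "Q \<sqsubseteq> P" "P \<in> R"
proof -
  obtain P where P: "P \<in> N n" "Q \<sqsubseteq> P" using anc_ex[OF assms(2), of n] by auto
  moreover have "P \<noteq> Q" using level_unique[OF assms(2), of n] P(1) by auto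
  ultimately show ?thesis using that leavesD(3)[OF assms(1) nodesI[OF P(1)]] by blast
qed

lemma dep_closed_graded:
  assumes R: "dep_closed R"
  shows "graded (leaves R)"
  unfolding graded_def
proof (intro ballI allI impI)
  fix Q Q' n k assume Q: "Q \<in> leaves R" "Q' \<in> leaves R" and nk: "Q \<in> N n" "Q' \<in> N k" and \<nu>: "\<nu> Q Q'"
  show "n \<le> k + 1"
  proof (rule ccontr)
    assume c: "\<not> n \<le> k + 1"
    then obtain m where m: "n = Suc m" "k < m" by (cases n) auto
    obtain P where P: "P \<in> N m" "Q \<sqsubseteq> P" "P \<in> R" using parent[OF Q(1)] nk m by blast
    have "P \<sqsubseteq> Q' \<or> \<nu> P Q'" using \<nu>_coarsen[OF nk \<nu> P(1,2)] m by simp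
    then have "Q' \<in> R"
      using dep_closed_\<nu>[OF R P(3,1) nk(2) m(2)] R P(3) nodesI[OF nk(2)] by (auto simp: dep_closed_def lower_def)
    then show False using leavesD(2)[OF Q(2)] by blast
  qed
qed

lemma coarse_deps_leaf:
  assumes R: "dep_closed R" and Q: "Q \<in> leaves R"
  shows "coarse_deps Q \<subseteq> R \<union> leaves R"
proof
  fix Q' assume "Q' \<in> coarse_deps Q"
  then obtain n where n: "Q \<in> N (Suc n)" "Q' \<in> N n" "\<nu> Q Q'" by (auto simp: coarse_deps_def)
  obtain P where P: "P \<in> N n" "Q \<sqsubseteq> P" "P \<in> R" using parent[OF Q n(1)] by blast
  have "A \<in> R" if A: "A \<in> nodes" "Q' \<sqsubseteq> A" "A \<noteq> Q'" for A
  proof -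
    obtain k where k: "A \<in> N k" using A(1) by (auto simp: nodes_def)
    have "k \<noteq> n" using anc_same_level[OF n(2) _ A(2)] k A(3) by blast
    then have kn: "k < n" using level_mono[OF n(2) k A(2)] by simp
    have "Q \<sqsubseteq> A \<or> \<nu> Q A" using \<nu>_coarsen2[OF n k A(2)] kn by simp
    then have "P \<sqsubseteq> A \<or> \<nu> P A"
      using \<nu>_coarsen[OF n(1) k _ P(1,2)] anc_chain[OF n(1) P(1) k P(2)] kn by auto
    then show "A \<in> R" using dep_closed_\<nu>[OF R P(3,1) k kn] R P(3) A(1) by (auto simp: dep_closed_def lower_def)
  qed
  then show "Q' \<in> R \<union> leaves R" using nodesI[OF n(2)] by (auto simp: leaves_def)
qed

end

section \<open>Uniform refinements\<close>

lemma meet_in_faceI: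
  fixes V W :: "'a::euclidean_space set"
  assumes V: "\<not> affine_dependent V" and W: "\<not> affine_dependent W"
    and f: "(convex hull V \<inter> convex hull W) face_of (convex hull V)"
      "(convex hull V \<inter> convex hull W) face_of (convex hull W)"
  shows "meet_in_face V W"
proof -
  obtain c where c: "c \<subseteq> V" "convex hull V \<inter> convex hull W = convex hull c"
    using f(1) face_of_convex_hull_affine_independent[OF V] by blast
  obtain c' where c': "c' \<subseteq> W" "convex hull V \<inter> convex hull W = convex hull c'"
    using f(2) face_of_convex_hull_affine_independent[OF W] by blast
  have "\<not> affine_dependent c" using V c(1) affine_independent_subset by blast
  then have "v \<in> c'" if "v \<in> c" for v
    using extreme_point_of_convex_hull[of v c'] extreme_point_of_convex_hull_affine_independent[of c v] that c(2) c'(2)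
    by simp
  then have "c \<subseteq> V \<inter> W" using c(1) c'(1) by blast
  then have "convex hull c \<subseteq> convex hull (V \<inter> W)" by (rule hull_mono)
  moreover have "convex hull (V \<inter> W) \<subseteq> convex hull V \<inter> convex hull W" by (simp add: hull_mono)
  ultimately show ?thesis using c(2) by (auto simp: meet_in_face_def)
qed

lemma meet_in_face_faces:
  fixes V W :: "'a::euclidean_space set"
  assumes V: "\<not> affine_dependent V" and W: "\<not> affine_dependent W" and "meet_in_face V W"
  shows "(convex hull V \<inter> convex hull W) face_of (convex hull V)"
    "(convex hull V \<inter> convex hull W) face_of (convex hull W)"
proof -
  have eq: "convex hull V \<inter> convex hull W = convex hull (V \<inter> W)"
    using assms(3) by (simp add: meet_in_face_def)
  show "(convex hull V \<inter> convex hull W) face_of (convex hull V)"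
    unfolding eq face_of_convex_hull_affine_independent[OF V] by (intro exI[of _ "V \<inter> W"]) simp
  show "(convex hull V \<inter> convex hull W) face_of (convex hull W)"
    unfolding eq face_of_convex_hull_affine_independent[OF W] by (intro exI[of _ "V \<inter> W"]) simp
qed

definition mid :: "'a::euclidean_space tsimplex \<Rightarrow> 'a" where
  "mid S = midpoint (hd (verts S)) (last (verts S))"

lemma independent_vset: "tagged_simplex S \<Longrightarrow> \<not> affine_dependent (vset S)"
  by (simp add: tagged_simplex_def)

lemma edge_ends_distinct: "tagged_simplex S \<Longrightarrow> hd (verts S) \<noteq> last (verts S)"
  by (rule tagged_simplexE[of S]) auto

lemma mid_eq: "edge_ends S = {a, b} \<Longrightarrow> mid S = midpoint a b"
  unfolding edge_ends_def mid_def by (auto simp: doubleton_eq_iff midpoint_sym)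

lemma mid_in_pts:
  assumes "edge_ends S \<subseteq> vset W"
  shows "mid S \<in> pts W"
proof -
  have "mid S \<in> closed_segment (hd (verts S)) (last (verts S))" by (simp add: mid_def)
  also have "\<dots> \<subseteq> convex hull (vset W)"
    unfolding segment_convex_hull using assms by (intro hull_mono) (auto simp: edge_ends_def)
  finally show ?thesis by (simp add: pts_def)
qed

lemma edge_ends_subset_if_mid:
  assumes "tagged_simplex S" "meet_in_face (vset S) (vset W)" "mid S \<in> pts W"
  shows "edge_ends S \<subseteq> vset W"
proof -
  have "mid S \<in> pts S" using mid_in_pts edge_ends_subset assms(1) by blast
  then have "mid S \<in> convex hull (vset S \<inter> vset W)"
    using assms(2,3) unfolding meet_in_face_def pts_def by blast
  then show ?thesis
    using midpoint_in_hull[OF independent_vset[OF assms(1)] Int_lower1, of "hd (verts S)" "last (verts S)"]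
      edge_ends_subset[OF assms(1)] by (auto simp: edge_ends_def mid_def)
qed

lemma RE_subset_iff:
  fixes S :: "'a::euclidean_space tsimplex"
  assumes "tagged_simplex S" "meet_in_face (vset S) (vset W)" "2 \<le> DIM('a)"
  shows "RE S \<subseteq> pts W \<longleftrightarrow> edge_ends S \<subseteq> vset W"
proof
  have RE: "RE S = closed_segment (hd (verts S)) (last (verts S))" using assms(3) by (simp add: RE_def)
  show "edge_ends S \<subseteq> vset W" if "RE S \<subseteq> pts W"
    by (rule edge_ends_subset_if_mid[OF assms(1,2)]) (use that in \<open>auto simp: RE mid_def\<close>)
  show "RE S \<subseteq> pts W" if "edge_ends S \<subseteq> vset W"
    unfolding RE segment_convex_hull pts_def using that by (intro hull_mono) (auto simp: edge_ends_def)
qed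

lemma finite_bisect: "finite (bisect S)"
  by (simp add: bisect_def Let_def)

lemma pts_bisect:
  assumes "tagged_simplex S"
  shows "(\<Union>C\<in>bisect S. pts C) = pts S"
proof -
  obtain a b where ab: "edge_ends S = {a, b}" "a \<noteq> b" using edge_ends_distinct[OF assms] by (auto simp: edge_ends_def)
  have un: "convex hull (half a b (vset S)) \<union> convex hull (half b a (vset S)) = pts S"
    unfolding pts_def by (rule hull_half_Un[OF independent_vset[OF assms] ab(2)])
  obtain C1 where C1: "C1 \<in> bisect S" "vset C1 = half a b (vset S)" by (rule vset_bisect_ex[OF assms ab(1)])
  have ba: "edge_ends S = {b, a}" using ab by blast
  obtain C2 where C2: "C2 \<in> bisect S" "vset C2 = half b a (vset S)" by (rule vset_bisect_ex[OF assms ba])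
  show ?thesis
  proof
    show "(\<Union>C\<in>bisect S. pts C) \<subseteq> pts S"
    proof
      fix y assume "y \<in> (\<Union>C\<in>bisect S. pts C)"
      then obtain C where C: "C \<in> bisect S" "y \<in> pts C" by blast
      obtain a' b' where ab': "edge_ends S = {a', b'}" "a' \<noteq> b'" "vset C = half a' b' (vset S)" "hd (verts C) = a'"
      "a' \<in> vset S" "b' \<in> vset S"
      by (rule vset_bisect[OF assms C(1)])
      have "convex hull (half a' b' (vset S)) \<subseteq> convex hull (vset S)"
        unfolding hull_half_Un[OF independent_vset[OF assms] ab'(2), symmetric] by (rule Un_upper1)
      then show "y \<in> pts S" using C(2) unfolding pts_def ab'(3) by (rule subsetD)
    qed
    have "pts S = pts C1 \<union> pts C2" using un by (simp add: pts_def C1(2) C2(2))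
    then show "pts S \<subseteq> (\<Union>C\<in>bisect S. pts C)" using C1(1) C2(1) by blast
  qed
qed

lemma aff_dim_pts:
  fixes S :: "'a::euclidean_space tsimplex"
  assumes "tagged_simplex S"
  shows "aff_dim (pts S) = int DIM('a)"
  using aff_dim_affine_independent[OF independent_vset[OF assms]] card_vset[OF assms]
  by (simp add: pts_def aff_dim_convex_hull)

lemma aff_dim_hull_le:
  fixes W :: "'a::euclidean_space set"
  assumes "finite W"
  shows "aff_dim (convex hull W) \<le> int (card W) - 1"
  using aff_dim_le_card[OF assms] by (simp add: aff_dim_convex_hull)

lemma vertex_child:
  assumes S: "tagged_simplex S" and "v \<in> vset S"
  shows "\<exists>C\<in>bisect S. v \<in> vset C"
proof -
  obtain a b where ab: "edge_ends S = {a, b}" "a \<noteq> b" using edge_ends_distinct[OF S] by (auto simp: edge_ends_def)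
  have ba: "edge_ends S = {b, a}" using ab by blast
  obtain C2 where C2: "C2 \<in> bisect S" "vset C2 = half b a (vset S)" by (rule vset_bisect_ex[OF S ba])
  obtain C1 where C1: "C1 \<in> bisect S" "vset C1 = half a b (vset S)" by (rule vset_bisect_ex[OF S ab(1)])
  have "v \<in> vset C1 \<or> v \<in> vset C2" unfolding C1(2) C2(2) half_def using assms(2) ab(2) by auto
  then show ?thesis using C1(1) C2(1) by blast
qed

lemma mid_child:
  assumes S: "tagged_simplex S" and C: "C \<in> bisect S"
  shows "mid S \<in> vset C"
proof -
  obtain a b where ab: "edge_ends S = {a, b}" "a \<noteq> b" "vset C = half a b (vset S)" "hd (verts C) = a"
      "a \<in> vset S" "b \<in> vset S"
      by (rule vset_bisect[OF S C])
  then show ?thesis by (simp add: mid_eq half_def)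
qed

lemma common_face_bisect:
  fixes S S' :: "'a::euclidean_space tsimplex"
  assumes S: "tagged_simplex S" "tagged_simplex S'" and mf: "meet_in_face (vset S) (vset S')"
    and ne: "\<not> edge_ends S \<subseteq> vset S'" and C: "C \<in> bisect S" "pts C' \<subseteq> pts S'"
    and card: "card (vset C \<inter> vset C') = DIM('a)" "card (vset S \<inter> vset S') = DIM('a)"
  shows "vset C \<inter> vset C' = vset S \<inter> vset S'"
proof (rule card_subset_eq)
  show "vset C \<inter> vset C' \<subseteq> vset S \<inter> vset S'"
  proof
    fix v assume v: "v \<in> vset C \<inter> vset C'"
    have "v \<in> pts C" "v \<in> pts C'" using v by (auto simp: pts_def intro: hull_inc)
    then have "v \<in> pts S" "v \<in> pts S'" using C pts_bisect[OF S(1)] by blast+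
    then have vW: "v \<in> convex hull (vset S \<inter> vset S')" using mf unfolding meet_in_face_def pts_def by blast
    obtain a b where ab: "edge_ends S = {a, b}" "a \<noteq> b" "vset C = half a b (vset S)" "hd (verts C) = a"
      "a \<in> vset S" "b \<in> vset S"
      by (rule vset_bisect[OF S(1) C(1)])
    have "v \<noteq> midpoint a b"
      using midpoint_in_hull[OF independent_vset[OF S(1)] Int_lower1 ab(5,6)] vW ne ab(1) by auto
    then have "v \<in> vset S" using v ab(3) by (auto simp: half_def split: if_splits)
    then show "v \<in> vset S \<inter> vset S'"
      using vertex_in_hull[OF independent_vset[OF S(1)] Int_lower1 _ vW] by blast
  qed
qed (use card in simp_all)

lemma card_Int_vset:
  fixes S S' :: "'a::euclidean_space tsimplex"
  assumes "tagged_simplex S" "tagged_simplex S'" "vset S \<noteq> vset S'"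
  shows "card (vset S \<inter> vset S') \<le> DIM('a)"
proof (rule ccontr)
  assume "\<not> card (vset S \<inter> vset S') \<le> DIM('a)"
  moreover have "card (vset S \<inter> vset S') \<le> card (vset S)" by (intro card_mono) auto
  ultimately have "card (vset S \<inter> vset S') = card (vset S)" "card (vset S \<inter> vset S') = card (vset S')"
    using card_vset[OF assms(1)] card_vset[OF assms(2)] by simp_all
  then have "vset S \<inter> vset S' = vset S" "vset S \<inter> vset S' = vset S'"
    using card_subset_eq[of "vset S" "vset S \<inter> vset S'"] card_subset_eq[of "vset S'" "vset S \<inter> vset S'"] by auto
  then show False using assms(3) by blast
qed

lemma card_Int_coarse:
  fixes S S' :: "'a::euclidean_space tsimplex"
  assumes "tagged_simplex S" "tagged_simplex S'" "vset S \<noteq> vset S'" "meet_in_face (vset S) (vset S')"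
    and C: "tagged_simplex C" "pts C \<subseteq> pts S" "pts C' \<subseteq> pts S'" "card (vset C \<inter> vset C') = DIM('a)"
  shows "card (vset S \<inter> vset S') = DIM('a)"
proof -
  have "\<not> affine_dependent (vset C \<inter> vset C')"
    using independent_vset[OF C(1)] affine_independent_subset by blast
  then have "aff_dim (convex hull (vset C \<inter> vset C')) = int DIM('a) - 1"
    using C(4) aff_dim_affine_independent[of "vset C \<inter> vset C'"] by (simp add: aff_dim_convex_hull)
  moreover
  have "convex hull (vset C \<inter> vset C') \<subseteq> convex hull (vset S \<inter> vset S')"
  proof -
    have "convex hull (vset C \<inter> vset C') \<subseteq> pts C \<inter> pts C'" unfolding pts_def by (simp add: hull_mono)
    also have "\<dots> \<subseteq> pts S \<inter> pts S'" using C by blast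
    finally show ?thesis using assms(4) unfolding meet_in_face_def pts_def by (rule ord_le_eq_trans)
  qed
  then have "aff_dim (convex hull (vset C \<inter> vset C')) \<le> aff_dim (convex hull (vset S \<inter> vset S'))"
    by (rule aff_dim_subset)
  ultimately have "int DIM('a) - 1 \<le> int (card (vset S \<inter> vset S')) - 1"
    using aff_dim_hull_le[of "vset S \<inter> vset S'"] by simp
  then show ?thesis using card_Int_vset[OF assms(1-3)] by simp
qed

locale initial_mesh =
  fixes \<Omega> :: "'a::euclidean_space set" and \<T>\<^sub>0 :: "'a tsimplex set"
  assumes open_domain: "open \<Omega>" and lipschitz: "lipschitz_boundary \<Omega>"
    and initial: "initial_triangulation \<Omega> \<T>\<^sub>0"
begin

abbreviation "uniform \<equiv> generation bisect \<T>\<^sub>0"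

definition regular :: "'a tsimplex set \<Rightarrow> bool" where
  "regular \<T> \<longleftrightarrow> finite \<T> \<and> (\<forall>S\<in>\<T>. tagged_simplex S) \<and>
    (\<forall>S\<in>\<T>. \<forall>S'\<in>\<T>. meet_in_face (vset S) (vset S')) \<and>
    (\<forall>S\<in>\<T>. \<forall>S'\<in>\<T>. vset S = vset S' \<longrightarrow> S = S') \<and>
    (\<Union>S\<in>\<T>. pts S) = closure \<Omega> \<and>
    (2 \<le> DIM('a) \<longrightarrow> (\<forall>S\<in>\<T>. \<forall>S'\<in>\<T>. S \<noteq> S' \<longrightarrow> card (vset S \<inter> vset S') = DIM('a) \<longrightarrow> compat S S'))"

lemma regularD:
  assumes "regular \<T>" "S \<in> \<T>"
  shows "tagged_simplex S" "S' \<in> \<T> \<Longrightarrow> meet_in_face (vset S) (vset S')"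
    "S' \<in> \<T> \<Longrightarrow> vset S = vset S' \<Longrightarrow> S = S'"
    "2 \<le> DIM('a) \<Longrightarrow> S' \<in> \<T> \<Longrightarrow> S \<noteq> S' \<Longrightarrow> card (vset S \<inter> vset S') = DIM('a) \<Longrightarrow> compat S S'"
  using assms unfolding regular_def by auto

lemma star_induct:
  assumes r: "regular \<T>" and S: "S \<in> \<T>"
    and A: "S \<in> A" "A \<subseteq> {W \<in> \<T>. edge_ends S \<subseteq> vset W}"
    and step: "\<And>W W'. W \<in> A \<Longrightarrow> W' \<in> \<T> \<Longrightarrow> edge_ends S \<subseteq> vset W' \<Longrightarrow> W \<noteq> W' \<Longrightarrow>
      card (vset W \<inter> vset W') = DIM('a) \<Longrightarrow> W' \<in> A"
  shows "{W \<in> \<T>. edge_ends S \<subseteq> vset W} \<subseteq> A"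
proof
  note tag = regularD(1)[OF r]
  have edge_ends_iff: "mid S \<in> convex hull (vset W) \<longleftrightarrow> edge_ends S \<subseteq> vset W" if "W \<in> \<T>" for W
    using edge_ends_subset_if_mid[OF tag[OF S] regularD(2)[OF r S that]] mid_in_pts[of S W] by (auto simp: pts_def)
  have "{V \<in> vset ` \<T>. mid S \<in> convex hull V} \<subseteq> vset ` A"
  proof (rule star_face_connected[OF open_domain lipschitz])
    show "finite (vset ` \<T>)" using r by (simp add: regular_def)
    show "\<not> affine_dependent V" "card V = DIM('a) + 1" if "V \<in> vset ` \<T>" for V
      using that tag independent_vset card_vset by auto
    show "meet_in_face V W" if "V \<in> vset ` \<T>" "W \<in> vset ` \<T>" for V W
      using that regularD(2)[OF r] by auto
    show "(\<Union>V\<in>vset ` \<T>. convex hull V) = closure \<Omega>" using r by (simp add: regular_def pts_def)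
    show "vset S \<in> vset ` A" using A(1) by blast
    show "vset ` A \<subseteq> {V \<in> vset ` \<T>. mid S \<in> convex hull V}" using A(2) edge_ends_iff by auto
    fix V U assume V: "V \<in> vset ` A" and U: "U \<in> vset ` \<T>" "mid S \<in> convex hull U" and c: "card (V \<inter> U) = DIM('a)"
    obtain W where W: "W \<in> A" "V = vset W" using V by blast
    obtain W' where W': "W' \<in> \<T>" "U = vset W'" using U by blast
    have "W \<noteq> W'" using c W W' card_vset[OF tag[OF W'(1)]] by auto
    then have "W' \<in> A" using step[OF W(1) W'(1)] edge_ends_iff[OF W'(1)] U(2) c W W' by simp
    then show "U \<in> vset ` A" using W' by blast
  qed
  moreover fix W assume W: "W \<in> {W \<in> \<T>. edge_ends S \<subseteq> vset W}"
  ultimately have "vset W \<in> vset ` A" using edge_ends_iff by blast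
  then obtain W' where W': "W' \<in> A" "vset W = vset W'" by blast
  then have "W = W'" using regularD(3)[OF r, of W W'] W A(2) by blast
  then show "W \<in> A" using W' by simp
qed

lemma star_edge_ends:
  assumes r: "regular \<T>" and d: "2 \<le> DIM('a)" and S: "S \<in> \<T>" "W \<in> \<T>" "edge_ends S \<subseteq> vset W"
  shows "edge_ends W = edge_ends S"
proof -
  note tag = regularD(1)[OF r]
  have "{W \<in> \<T>. edge_ends S \<subseteq> vset W} \<subseteq> {W \<in> \<T>. edge_ends W = edge_ends S}"
  proof (rule star_induct[OF r S(1)])
    show "{W \<in> \<T>. edge_ends W = edge_ends S} \<subseteq> {W \<in> \<T>. edge_ends S \<subseteq> vset W}" using edge_ends_subset[OF tag] by auto
    fix W W' assume W: "W \<in> {W \<in> \<T>. edge_ends W = edge_ends S}" and W': "W' \<in> \<T>" "edge_ends S \<subseteq> vset W'"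
      and ne: "W \<noteq> W'" and c: "card (vset W \<inter> vset W') = DIM('a)"
    have "compat W W'" using regularD(4)[OF r _ d W'(1) ne c] W by blast
    moreover have "edge_ends W \<subseteq> vset W'" using W W'(2) by simp
    ultimately have "label_reflected W W'" by (simp add: compat_def)
    then have "edge_ends W' = edge_ends W" using label_reflected_edge_ends[OF tag tag[OF W'(1)], of W] W \<open>edge_ends W \<subseteq> vset W'\<close> by blast
    then show "W' \<in> {W \<in> \<T>. edge_ends W = edge_ends S}" using W W' by simp
  qed (use S in simp)
  then show ?thesis using S by blast
qed

lemma edge_dichotomy:
  assumes r: "regular \<T>" and S: "S \<in> \<T>" "S' \<in> \<T>" "S \<noteq> S'" and sub: "edge_ends S \<subseteq> vset S'"
  shows "2 \<le> DIM('a)" "edge_ends S' = edge_ends S"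
proof -
  note tag = regularD(1)[OF r]
  show d: "2 \<le> DIM('a)"
  proof (rule ccontr)
    assume "\<not> 2 \<le> DIM('a)"
    moreover have "0 < DIM('a)" by simp
    ultimately have "DIM('a) = 1" by linarith
    then have c: "card (vset S) = 2" "card (vset S') = 2" using card_vset tag S by fastforce+
    have "card (edge_ends S) = 2" using edge_ends_distinct[OF tag[OF S(1)]] by (simp add: edge_ends_def)
    then have "edge_ends S = vset S" "edge_ends S = vset S'"
      using card_subset_eq[of "vset S" "edge_ends S"] card_subset_eq[of "vset S'" "edge_ends S"] edge_ends_subset[OF tag[OF S(1)]] c sub by auto
    then show False using regularD(3)[OF r S(1,2)] S(3) by simp
  qed
  show "edge_ends S' = edge_ends S" using star_edge_ends[OF r d S(1,2) sub] .
qed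

lemma pts_child_subset: "tagged_simplex S \<Longrightarrow> C \<in> bisect S \<Longrightarrow> pts C \<subseteq> pts S"
  using pts_bisect[of S] by blast

lemma regular_distinct_dim:
  assumes r: "regular \<T>" and S: "S \<in> \<T>" "S' \<in> \<T>" "aff_dim (pts S \<inter> pts S') = int DIM('a)"
  shows "S = S'"
proof (rule ccontr)
  assume "S \<noteq> S'"
  then have "vset S \<noteq> vset S'" using regularD(3)[OF r S(1,2)] by blast
  then have "card (vset S \<inter> vset S') \<le> DIM('a)" using card_Int_vset regularD(1)[OF r] S by blast
  moreover have "pts S \<inter> pts S' = convex hull (vset S \<inter> vset S')"
    using regularD(2)[OF r S(1,2)] by (simp add: meet_in_face_def pts_def)
  ultimately show False using aff_dim_hull_le[of "vset S \<inter> vset S'"] S(3) by simp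
qed

lemma regular_bisect:
  assumes r: "regular \<T>"
  shows "regular (\<Union>S\<in>\<T>. bisect S)"
proof -
  note tag = regularD(1)[OF r]
  note ind = independent_vset[OF tag]
  have mf: "meet_in_face (vset C) (vset C')"
    if S: "S \<in> \<T>" "S' \<in> \<T>" and C: "C \<in> bisect S" "C' \<in> bisect S'" for S S' C C'
  proof -
    obtain a b where ab: "edge_ends S = {a, b}" "a \<noteq> b" "vset C = half a b (vset S)" "hd (verts C) = a"
      "a \<in> vset S" "b \<in> vset S"
      by (rule vset_bisect[OF tag[OF S(1)] C(1)])
    obtain a' b' where ab': "edge_ends S' = {a', b'}" "a' \<noteq> b'" "vset C' = half a' b' (vset S')" "hd (verts C') = a'"
      "a' \<in> vset S'" "b' \<in> vset S'"
      by (rule vset_bisect[OF tag[OF S(2)] C(2)])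
    note m = regularD(2)[OF r S(1,2)]
    show ?thesis
    proof (cases "edge_ends S = edge_ends S'")
      case True
      then consider "a' = a" "b' = b" | "a' = b" "b' = a" using ab(1) ab'(1) by (auto simp: doubleton_eq_iff)
      then show ?thesis
      proof cases
        case 1
        then show ?thesis using meet_in_face_half_same(1)[OF ind[OF S(1)] ind[OF S(2)], of a b] m ab ab' by simp
      next
        case 2
        then show ?thesis using meet_in_face_half_opposite(1)[OF ind[OF S(1)] ind[OF S(2)], of a b] m ab ab' by simp
      qed
    next
      case False
      then have "S \<noteq> S'" by blast
      then have "\<not> edge_ends S \<subseteq> vset S'" "\<not> edge_ends S' \<subseteq> vset S"
        using edge_dichotomy(2)[OF r S] edge_dichotomy(2)[OF r S(2,1)] False by auto
      then show ?thesis
        unfolding ab(3) ab'(3) using ab(1) ab'(1)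
        by (intro meet_in_face_half_half[OF ind[OF S(1)] ab(5,6,2) ind[OF S(2)] ab'(5,6,2) m]) auto
    qed
  qed
  have dist: "C = C'" if S: "S \<in> \<T>" "S' \<in> \<T>" and C: "C \<in> bisect S" "C' \<in> bisect S'" "vset C = vset C'" for S S' C C'
  proof (cases "S = S'")
    case True
    obtain a b where ab: "edge_ends S = {a, b}" "a \<noteq> b" "vset C = half a b (vset S)" "hd (verts C) = a"
      "a \<in> vset S" "b \<in> vset S"
      by (rule vset_bisect[OF tag[OF S(1)] C(1)])
    obtain a' b' where ab': "edge_ends S' = {a', b'}" "a' \<noteq> b'" "vset C' = half a' b' (vset S')" "hd (verts C') = a'"
      "a' \<in> vset S'" "b' \<in> vset S'"
      by (rule vset_bisect[OF tag[OF S(2)] C(2)])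
    have "a' = a"
    proof (rule ccontr)
      assume "a' \<noteq> a"
      then have "a' = b" "b' = a" using ab(1) ab'(1) True by (auto simp: doubleton_eq_iff)
      then have "vset C = insert (midpoint a b) (vset S - {a})" using ab' C(3) True ab(5,6) by (simp add: half_def midpoint_sym)
      moreover have "a \<in> vset C" using ab by (simp add: half_def)
      ultimately have "a = midpoint a b" by blast
      then show False using ab(2) by (metis midpoint_eq_endpoint(1))
    qed
    then show ?thesis using bisect_eqI[OF tag[OF S(1)] C(1)] C(2) True ab(4) ab'(4) by simp
  next
    case False
    have "pts C \<subseteq> pts S \<inter> pts S'"
      using pts_child_subset[OF tag[OF S(1)] C(1)] pts_child_subset[OF tag[OF S(2)] C(2)] C(3) by (simp add: pts_def)
    then have "int DIM('a) \<le> aff_dim (pts S \<inter> pts S')"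
      using aff_dim_pts[OF tagged_bisect(1)[OF tag[OF S(1)] C(1)]] aff_dim_subset by metis
    then have "aff_dim (pts S \<inter> pts S') = int DIM('a)"
      using aff_dim_le_DIM[of "pts S \<inter> pts S'"] by simp
    then show ?thesis using regular_distinct_dim[OF r S] False by blast
  qed
  have comp: "compat C C'"
    if d: "2 \<le> DIM('a)" and S: "S \<in> \<T>" "S' \<in> \<T>" and C: "C \<in> bisect S" "C' \<in> bisect S'" "C \<noteq> C'"
      and c: "card (vset C \<inter> vset C') = DIM('a)" for S S' C C'
  proof (cases "S = S'")
    case True
    then show ?thesis using siblings_compat[OF tag[OF S(1)] d C(1) _ C(3)] C(2) by simp
  next
    case False
    note tC = tagged_bisect(1)[OF tag[OF S(1)] C(1)] and tC' = tagged_bisect(1)[OF tag[OF S(2)] C(2)]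
    have V: "vset S \<noteq> vset S'" using regularD(3)[OF r S] False by blast
    note m = regularD(2)[OF r S]
    have cW: "card (vset S \<inter> vset S') = DIM('a)"
      using card_Int_coarse[OF tag[OF S(1)] tag[OF S(2)] V m tC pts_child_subset[OF tag[OF S(1)] C(1)]
        pts_child_subset[OF tag[OF S(2)] C(2)] c] .
    have co: "compat S S'" using regularD(4)[OF r S(1) d S(2) False cW] .
    show ?thesis
    proof (cases "edge_ends S \<subseteq> vset S' \<or> edge_ends S' \<subseteq> vset S")
      case True
      then have label_reflected: "label_reflected S S'" using co by (simp add: compat_def)
      have edge_ends: "edge_ends S' = edge_ends S" using label_reflected_edge_ends[OF tag[OF S(1)] tag[OF S(2)] label_reflected True] .
      obtain a b where ab: "edge_ends S = {a, b}" "a \<noteq> b" "vset C = half a b (vset S)" "hd (verts C) = a"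
      "a \<in> vset S" "b \<in> vset S"
      by (rule vset_bisect[OF tag[OF S(1)] C(1)])
      obtain a' b' where ab': "edge_ends S' = {a', b'}" "a' \<noteq> b'" "vset C' = half a' b' (vset S')" "hd (verts C') = a'"
      "a' \<in> vset S'" "b' \<in> vset S'"
      by (rule vset_bisect[OF tag[OF S(2)] C(2)])
      have "a' = a"
      proof (rule ccontr)
        assume "a' \<noteq> a"
        then have e: "a' = b" "b' = a" using ab(1) ab'(1) edge_ends by (auto simp: doubleton_eq_iff)
        then have "vset C \<inter> vset C' = insert (midpoint a b) (vset S \<inter> vset S' - {a, b})"
          using meet_in_face_half_opposite(2)[OF ind[OF S(1)] ind[OF S(2)], of a b] m ab ab' by simp
        moreover have "card (insert (midpoint a b) (vset S \<inter> vset S' - {a, b})) \<le> Suc (card (vset S \<inter> vset S' - {a, b}))"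
          by (simp add: card_insert_if)
        moreover have "card (vset S \<inter> vset S' - {a, b}) = DIM('a) - 2"
          using cW e ab(2,5,6) ab'(5,6) by (subst card_Diff_subset) auto
        ultimately show False using c d by simp
      qed
      then show ?thesis
        using label_reflected_compat[OF tC tC' label_reflected_bisect[OF tag[OF S(1)] tag[OF S(2)] label_reflected edge_ends C(1,2)]] ab(4) ab'(4) by simp
    next
      case False
      have eq: "vset C \<inter> vset C' = vset S \<inter> vset S'"
        using common_face_bisect[OF tag[OF S(1)] tag[OF S(2)] m _ C(1) pts_child_subset[OF tag[OF S(2)] C(2)] c cW] False by blast
      have all: "\<forall>C\<in>bisect S. \<forall>C'\<in>bisect S'. vset S \<inter> vset S' \<subseteq> vset C \<inter> vset C' \<longrightarrow> label_reflected C C'"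
        using co False unfolding compat_def by simp
      have "label_reflected C C'" by (rule all[rule_format, OF C(1,2) equalityD2[OF eq]])
      then show ?thesis using label_reflected_compat[OF tC tC'] by blast
    qed
  qed
  have "(\<Union>C\<in>(\<Union>S\<in>\<T>. bisect S). pts C) = (\<Union>S\<in>\<T>. pts S)" using pts_bisect[OF tag] by auto
  then have cov: "(\<Union>C\<in>(\<Union>S\<in>\<T>. bisect S). pts C) = closure \<Omega>" using r by (simp add: regular_def)
  have "finite (\<Union>S\<in>\<T>. bisect S)" using r finite_bisect by (auto simp: regular_def)
  moreover have "\<forall>C\<in>(\<Union>S\<in>\<T>. bisect S). tagged_simplex C" using tag tagged_bisect(1) by blast
  moreover have "meet_in_face (vset C) (vset C')"
    if "C \<in> (\<Union>S\<in>\<T>. bisect S)" "C' \<in> (\<Union>S\<in>\<T>. bisect S)" for C C'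
    using that by (elim UN_E) (rule mf)
  moreover have "C = C'"
    if "C \<in> (\<Union>S\<in>\<T>. bisect S)" "C' \<in> (\<Union>S\<in>\<T>. bisect S)" "vset C = vset C'" for C C'
    using that(1,2) by (elim UN_E) (rule dist[OF _ _ _ _ that(3)])
  moreover have "compat C C'"
    if "2 \<le> DIM('a)" "C \<in> (\<Union>S\<in>\<T>. bisect S)" "C' \<in> (\<Union>S\<in>\<T>. bisect S)" "C \<noteq> C'"
      "card (vset C \<inter> vset C') = DIM('a)" for C C'
    using that(2,3) by (elim UN_E) (rule comp[OF that(1) _ _ _ _ that(4,5)])
  ultimately show ?thesis
    unfolding regular_def using cov by simp
qed

lemma regular_initial: "regular \<T>\<^sub>0"
proof -
  have fin: "finite \<T>\<^sub>0" and tag: "\<And>S. S \<in> \<T>\<^sub>0 \<Longrightarrow> tagged_simplex S"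
    and no: "\<And>S S'. S \<in> \<T>\<^sub>0 \<Longrightarrow> S' \<in> \<T>\<^sub>0 \<Longrightarrow> S \<noteq> S' \<Longrightarrow> nonoverlapping (pts S) (pts S')"
    and cov: "(\<Union>S\<in>\<T>\<^sub>0. pts S) = closure \<Omega>" and conf: "conforming \<T>\<^sub>0"
    and wl: "2 \<le> DIM('a) \<Longrightarrow> well_labeled \<T>\<^sub>0"
    using initial by (auto simp: initial_triangulation_def)
  note ind = independent_vset[OF tag]
  have eq: "S = S'" if S: "S \<in> \<T>\<^sub>0" "S' \<in> \<T>\<^sub>0" "pts S = pts S'" for S S'
  proof (rule ccontr)
    assume "S \<noteq> S'"
    then have "interior (pts S) = {}" using no[OF S(1,2)] S(3) by (simp add: nonoverlapping_def)
    then show False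
      using interior_full_simplex_nonempty[OF ind[OF S(1)] card_vset[OF tag[OF S(1)]]] by (simp add: pts_def)
  qed
  have mf: "meet_in_face (vset S) (vset S')" if S: "S \<in> \<T>\<^sub>0" "S' \<in> \<T>\<^sub>0" for S S'
  proof -
    consider "pts S = pts S'" | "pts S \<inter> pts S' = {}"
      | "(pts S \<inter> pts S') face_of pts S" "(pts S \<inter> pts S') face_of pts S'"
      using conf S unfolding conforming_def by blast
    then show ?thesis
    proof cases
      case 1
      then show ?thesis using eq[OF S] meet_in_face_self by simp
    next
      case 2
      have "vset S \<inter> vset S' \<subseteq> pts S \<inter> pts S'" unfolding pts_def by (simp add: hull_subset le_infI1 le_infI2)
      then have "vset S \<inter> vset S' = {}" using 2 by blast
      then show ?thesis using 2 by (simp add: meet_in_face_def pts_def)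
    next
      case 3
      then show ?thesis unfolding pts_def by (rule meet_in_faceI[OF ind[OF S(1)] ind[OF S(2)]])
    qed
  qed
  have comp: "compat S S'" if d: "2 \<le> DIM('a)" and S: "S \<in> \<T>\<^sub>0" "S' \<in> \<T>\<^sub>0" "S \<noteq> S'"
    and c: "card (vset S \<inter> vset S') = DIM('a)" for S S'
  proof -
    have W: "pts S \<inter> pts S' = convex hull (vset S \<inter> vset S')"
      using mf[OF S(1,2)] by (simp add: meet_in_face_def pts_def)
    have facet: "convex hull (vset U \<inter> vset U') facet_of pts U"
      if U: "U \<in> \<T>\<^sub>0" "card (vset U \<inter> vset U') = DIM('a)" for U U'
    proof -
      have "card (vset U - vset U') = 1"
        using card_Diff_subset_Int[of "vset U" "vset U'"] card_vset[OF tag[OF U(1)]] U(2) by simp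
      then obtain u where u: "vset U - vset U' = {u}" using card_1_singletonE by blast
      then have "vset U \<inter> vset U' = vset U - {u}" by blast
      moreover have "vset U \<inter> vset U' \<noteq> {}" using U(2) DIM_positive[where 'a='a] by (metis card.empty less_irrefl)
      ultimately show ?thesis
        unfolding pts_def facet_of_convex_hull_affine_independent[OF ind[OF U(1)]] using u by auto
    qed
    have "share_hyperface S S'"
      unfolding share_hyperface_def using facet[OF S(1) c] facet[OF S(2), of S] c by (simp add: Int_commute[of "vset S'"] W)
    then have *: "if RE S \<subseteq> pts S \<inter> pts S' \<or> RE S' \<subseteq> pts S \<inter> pts S' then reflected_neighbours S S'
        else (\<forall>C\<in>bisect S. \<forall>C'\<in>bisect S'.
                pts S \<inter> pts S' \<subseteq> pts C \<and> pts S \<inter> pts S' \<subseteq> pts C' \<longrightarrow> reflected_neighbours C C')"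
      using wl[OF d] S unfolding well_labeled_def by blast
    have RE: "RE S \<subseteq> pts S \<inter> pts S' \<longleftrightarrow> edge_ends S \<subseteq> vset S'" "RE S' \<subseteq> pts S \<inter> pts S' \<longleftrightarrow> edge_ends S' \<subseteq> vset S"
      using RE_subset_iff[OF tag[OF S(1)] mf[OF S(1,2)] d] RE_subset_iff[OF tag[OF S(1)] mf[OF S(1,1)] d]
        RE_subset_iff[OF tag[OF S(2)] mf[OF S(2,1)] d] RE_subset_iff[OF tag[OF S(2)] mf[OF S(2,2)] d]
        edge_ends_subset[OF tag[OF S(1)]] edge_ends_subset[OF tag[OF S(2)]] by auto
    have label_reflected: "reflected_neighbours A B \<Longrightarrow> label_reflected A B" for A B :: "'a tsimplex"
      by (auto simp: reflected_neighbours_def label_reflected_def)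
    show ?thesis
    proof (cases "edge_ends S \<subseteq> vset S' \<or> edge_ends S' \<subseteq> vset S")
      case True
      then show ?thesis using * label_reflected unfolding RE compat_def by simp
    next
      case False
      have "label_reflected C C'" if C: "C \<in> bisect S" "C' \<in> bisect S'" "vset S \<inter> vset S' \<subseteq> vset C \<inter> vset C'" for C C'
      proof -
        have "pts S \<inter> pts S' \<subseteq> pts C" "pts S \<inter> pts S' \<subseteq> pts C'"
          unfolding W unfolding pts_def using C(3) by (intro hull_mono; blast)+
        then show ?thesis using * False C(1,2) label_reflected unfolding RE by simp
      qed
      then show ?thesis using False by (simp add: compat_def)
    qed
  qed
  show ?thesis
    unfolding regular_def
  proof (intro conjI ballI impI)
    show "S = S'" if "S \<in> \<T>\<^sub>0" "S' \<in> \<T>\<^sub>0" "vset S = vset S'" for S S' using eq that by (simp add: pts_def)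
  qed (use fin tag mf cov comp in auto)
qed

lemma regular_uniform: "regular (uniform n)"
  by (induction n) (simp_all add: regular_initial generation_Suc regular_bisect)

lemma tagged_uniform: "S \<in> uniform n \<Longrightarrow> tagged_simplex S"
  using regularD(1)[OF regular_uniform] .

lemma independent_uniform: "S \<in> uniform n \<Longrightarrow> \<not> affine_dependent (vset S)"
  using independent_vset[OF tagged_uniform] .

lemma meet_uniform: "S \<in> uniform n \<Longrightarrow> S' \<in> uniform n \<Longrightarrow> meet_in_face (vset S) (vset S')"
  using regularD(2)[OF regular_uniform] .

lemma cover_uniform: "(\<Union>S\<in>uniform n. pts S) = closure \<Omega>"
  using regular_uniform by (simp add: regular_def)

sublocale simp: refinement_tree \<T>\<^sub>0 bisect pts "\<lambda>A. aff_dim A = int DIM('a)"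
proof
  show "finite \<T>\<^sub>0" using regular_initial by (simp add: regular_def)
  show "aff_dim B = int DIM('a)" if "aff_dim A = int DIM('a)" "A \<subseteq> B" for A B :: "'a set"
    using aff_dim_subset[OF that(2)] aff_dim_le_DIM[of B] that(1) by simp
  show "x = y" if "x \<in> uniform n" "y \<in> uniform n" "aff_dim (pts x \<inter> pts y) = int DIM('a)" for x y n
    using regular_distinct_dim[OF regular_uniform that] .
  show "aff_dim (pts x) = int DIM('a)" if "x \<in> uniform n" for x n
    using aff_dim_pts[OF tagged_uniform[OF that]] .
qed (use pts_bisect tagged_uniform finite_bisect in auto)

end


context initial_mesh
begin

lemma child_strict:
  assumes "S \<in> uniform n" "C \<in> bisect S"
  shows "\<not> pts S \<subseteq> pts C"
proof
  note tS = tagged_uniform[OF assms(1)]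
  assume sub: "pts S \<subseteq> pts C"
  obtain a b where ab: "edge_ends S = {a, b}" "a \<noteq> b" "vset C = half a b (vset S)" "hd (verts C) = a"
    "a \<in> vset S" "b \<in> vset S"
    by (rule vset_bisect[OF tS assms(2)])
  obtain g c where g: "linear (g :: 'a \<Rightarrow> real)"
    "\<And>W. W \<subseteq> vset S \<Longrightarrow> convex hull (half a b W) = convex hull W \<inter> {x. g x + c \<le> 0}"
    "\<And>W. W \<subseteq> vset S \<Longrightarrow> convex hull (half b a W) = convex hull W \<inter> {x. 0 \<le> g x + c}"
    "\<And>v. v \<in> vset S \<Longrightarrow> g v + c = (if v = a then -1 else if v = b then 1 else 0)"
    by (rule hull_half[OF independent_vset[OF tS] ab(2)]) (rule that)
  have "b \<in> pts C" using sub ab(6) by (auto simp: pts_def intro: hull_inc)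
  then have "g b + c \<le> 0" unfolding pts_def ab(3) g(2)[OF order_refl] by simp
  then show False using g(4)[OF ab(6)] ab(2) by simp
qed

lemma level_le:
  assumes "S \<in> uniform n" "S' \<in> uniform k" "pts S \<subseteq> pts S'"
  shows "k \<le> n"
proof (rule ccontr)
  assume "\<not> k \<le> n"
  then have k: "n \<le> k" "Suc n \<le> k" by simp_all
  obtain A where A: "A \<in> uniform n" "pts S' \<subseteq> pts A" using simp.ancestor_ex[OF assms(2) k(1)] by blast
  have "A = S" using simp.ancestor_unique[OF assms(1) A(1) assms(1)] A(2) assms(3) by blast
  then have eq: "pts S' = pts S" using A(2) assms(3) by blast
  obtain C where C: "C \<in> uniform (Suc n)" "pts S' \<subseteq> pts C" using simp.ancestor_ex[OF assms(2) k(2)] by blast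
  have "pts S' \<subseteq> pts C \<inter> pts S" using C(2) eq by blast
  then have "aff_dim (pts C \<inter> pts S) = int DIM('a)" by (rule simp.ov_subset[OF assms(2)])
  then have "pts C \<subseteq> pts S" using simp.subset_if_ov[OF C(1) assms(1)] by simp
  then have "C \<in> bisect S" using simp.children_eq[OF assms(1)] C(1) by blast
  then show False using child_strict[OF assms(1)] C(2) eq by blast
qed

lemma simplex_level_uniform:
  assumes "S \<in> uniform n"
  shows "simplex_level \<T>\<^sub>0 S = n"
proof -
  have *: "(\<exists>S\<^sub>0\<in>\<T>\<^sub>0. S \<in> iterated bisect k S\<^sub>0) \<longleftrightarrow> S \<in> uniform k" for k
    by (simp add: generation_def)
  show ?thesis
    unfolding simplex_level_def * using assms level_le[of S _ S n] by (intro Least_equality) auto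
qed

lemma vertex_descend:
  assumes "S \<in> uniform k" "v \<in> vset S" "k \<le> n"
  shows "\<exists>S'\<in>uniform n. pts S' \<subseteq> pts S \<and> v \<in> vset S'"
  using assms(3)
proof (induction n rule: dec_induct)
  case base
  then show ?case using assms by blast
next
  case (step n)
  then obtain S' where S': "S' \<in> uniform n" "pts S' \<subseteq> pts S" "v \<in> vset S'" by blast
  obtain C where C: "C \<in> bisect S'" "v \<in> vset C" using vertex_child[OF tagged_uniform[OF S'(1)] S'(3)] by blast
  then show ?case using simp.child_gen[OF S'(1) C(1)] simp.child_subset[OF S'(1) C(1)] S'(2) by blast
qed

lemma vertex_in_both:
  assumes "S \<in> uniform n" "S' \<in> uniform n" "v \<in> vset S" "v \<in> pts S'"
  shows "v \<in> vset S'"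
proof -
  have "v \<in> pts S" using assms(3) by (simp add: pts_def hull_inc)
  then have "v \<in> convex hull (vset S \<inter> vset S')"
    using meet_uniform[OF assms(1,2)] assms(4) by (auto simp: meet_in_face_def pts_def)
  then show ?thesis
    using vertex_in_hull[OF independent_uniform[OF assms(1)] Int_lower1 assms(3)] by blast
qed

lemma vertex_persists:
  assumes "S \<in> uniform k" "v \<in> vset S" "S' \<in> uniform n" "k \<le> n" "v \<in> pts S'"
  shows "v \<in> vset S'"
  using vertex_descend[OF assms(1,2,4)] vertex_in_both[OF _ assms(3) _ assms(5)] by blast

lemma mid_notin: "S \<in> uniform k \<Longrightarrow> edge_ends S \<subseteq> vset W \<Longrightarrow> W \<in> uniform n \<Longrightarrow> mid S \<notin> vset W"
  using midpoint_not_vertex[OF independent_uniform, of W n "hd (verts S)" "last (verts S)"]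
    edge_ends_distinct[OF tagged_uniform, of S k] by (auto simp: edge_ends_def mid_def)

lemma mid_not_coarse_vertex:
  assumes "S \<in> uniform k" "W \<in> uniform j" "j \<le> k"
  shows "mid S \<notin> vset W"
proof
  assume "mid S \<in> vset W"
  moreover have "mid S \<in> pts S" using mid_in_pts edge_ends_subset[OF tagged_uniform[OF assms(1)]] .
  ultimately have "mid S \<in> vset S" using vertex_persists[OF assms(2) _ assms(1,3)] by blast
  then show False using mid_notin[OF assms(1) edge_ends_subset[OF tagged_uniform[OF assms(1)]] assms(1)] by blast
qed

lemma edge_level:
  assumes "S \<in> uniform k" "W \<in> uniform j" "edge_ends S \<subseteq> pts W" "mid S \<in> pts W"
  shows "j \<le> k"
proof (rule ccontr)
  assume "\<not> j \<le> k"
  then have j: "k \<le> j" "Suc k \<le> j" by simp_all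
  note tS = tagged_uniform[OF assms(1)]
  have "edge_ends S \<subseteq> vset W"
    using vertex_persists[OF assms(1) _ assms(2) j(1)] edge_ends_subset[OF tS] assms(3) by blast
  moreover obtain C where C: "C \<in> bisect S" using simp.child_ex[OF assms(1)] mid_in_pts[OF edge_ends_subset[OF tS]] by blast
  then have "mid S \<in> vset W"
    using vertex_persists[OF simp.child_gen[OF assms(1) C] mid_child[OF tS C] assms(2) j(2) assms(4)] by blast
  ultimately show False using mid_notin[OF assms(1) _ assms(2)] by blast
qed

lemma patch_member_below:
  assumes "2 \<le> DIM('a)" "S \<in> uniform k" "W \<in> uniform j" "j \<le> k" "mid S \<in> pts W"
  shows "\<exists>S'\<in>uniform k. pts S' \<subseteq> pts W \<and> edge_ends S' = edge_ends S"
proof -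
  obtain S' where S': "S' \<in> uniform k" "pts S' \<subseteq> pts W" "mid S \<in> pts S'"
    using simp.descendant_ex[OF assms(3-5)] by blast
  have "edge_ends S \<subseteq> vset S'"
    using edge_ends_subset_if_mid[OF tagged_uniform[OF assms(2)] meet_uniform[OF assms(2) S'(1)] S'(3)] .
  then have "edge_ends S' = edge_ends S" using star_edge_ends[OF regular_uniform assms(1,2) S'(1)] by blast
  then show ?thesis using S' by blast
qed

lemma patch_induct:
  assumes d: "2 \<le> DIM('a)" and S: "S \<in> uniform n" "S' \<in> uniform n" "edge_ends S' = edge_ends S" and base: "Pr S"
    and step: "\<And>W W'. W \<in> uniform n \<Longrightarrow> W' \<in> uniform n \<Longrightarrow> edge_ends W = edge_ends S \<Longrightarrow> edge_ends W' = edge_ends S \<Longrightarrow> Pr W \<Longrightarrow>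
      card (vset W \<inter> vset W') = DIM('a) \<Longrightarrow> Pr W'"
  shows "Pr S'"
proof -
  note sub = edge_ends_subset[OF tagged_uniform]
  have "{W \<in> uniform n. edge_ends S \<subseteq> vset W} \<subseteq> {W \<in> uniform n. edge_ends W = edge_ends S \<and> Pr W}"
  proof (rule star_induct[OF regular_uniform S(1)])
    show "S \<in> {W \<in> uniform n. edge_ends W = edge_ends S \<and> Pr W}" using S base by simp
    show "{W \<in> uniform n. edge_ends W = edge_ends S \<and> Pr W} \<subseteq> {W \<in> uniform n. edge_ends S \<subseteq> vset W}"
      using sub by auto
    fix W W' assume W: "W \<in> {W \<in> uniform n. edge_ends W = edge_ends S \<and> Pr W}" and W': "W' \<in> uniform n" "edge_ends S \<subseteq> vset W'"
      and c: "card (vset W \<inter> vset W') = DIM('a)"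
    have "edge_ends W' = edge_ends S" using star_edge_ends[OF regular_uniform d S(1) W'] .
    then show "W' \<in> {W \<in> uniform n. edge_ends W = edge_ends S \<and> Pr W}" using step[of W W'] W W'(1) c by blast
  qed
  moreover have "edge_ends S \<subseteq> vset S'" using sub[OF S(2)] S(3) by simp
  ultimately show ?thesis using S(2) by blast
qed

text \<open>A common hyperface that avoids the refinement edges at one level contains those of the next
  level, so of two consecutive bisections at least one is common to both sides.\<close>

lemma neighbour_ancestors:
  assumes d: "2 \<le> DIM('a)" and S: "S \<in> uniform (Suc (Suc n))" "S' \<in> uniform (Suc (Suc n))"
    and c: "card (vset S \<inter> vset S') = DIM('a)"
    and p1: "p1 \<in> uniform (Suc n)" "pts S \<subseteq> pts p1" and q1: "q1 \<in> uniform (Suc n)" "pts S' \<subseteq> pts q1"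
    and p2: "p2 \<in> uniform n" "pts p1 \<subseteq> pts p2" and q2: "q2 \<in> uniform n" "pts q1 \<subseteq> pts q2"
  shows "edge_ends p1 = edge_ends q1 \<or> edge_ends p2 = edge_ends q2"
proof (rule ccontr)
  assume "\<not> (edge_ends p1 = edge_ends q1 \<or> edge_ends p2 = edge_ends q2)"
  then have ne: "edge_ends p1 \<noteq> edge_ends q1" "edge_ends p2 \<noteq> edge_ends q2" by auto
  then have pq: "p1 \<noteq> q1" "p2 \<noteq> q2" by auto
  note tag = tagged_uniform
  have v: "vset p1 \<noteq> vset q1" "vset p2 \<noteq> vset q2"
    using regularD(3)[OF regular_uniform p1(1) q1(1)] regularD(3)[OF regular_uniform p2(1) q2(1)] pq by auto
  have c1: "card (vset p1 \<inter> vset q1) = DIM('a)"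
    using card_Int_coarse[OF tag[OF p1(1)] tag[OF q1(1)] v(1) meet_uniform[OF p1(1) q1(1)] tag[OF S(1)] p1(2) q1(2) c] .
  have c2: "card (vset p2 \<inter> vset q2) = DIM('a)"
    using card_Int_coarse[OF tag[OF p2(1)] tag[OF q2(1)] v(2) meet_uniform[OF p2(1) q2(1)] tag[OF p1(1)] p2(2) q2(2) c1] .
  have n1: "\<not> edge_ends p1 \<subseteq> vset q1" using star_edge_ends[OF regular_uniform d p1(1) q1(1)] ne by auto
  have n2: "\<not> edge_ends p2 \<subseteq> vset q2" using star_edge_ends[OF regular_uniform d p2(1) q2(1)] ne by auto
  have C: "p1 \<in> bisect p2" using simp.children_eq[OF p2(1)] p1(1) p2(2) by blast
  have eq: "vset p1 \<inter> vset q1 = vset p2 \<inter> vset q2"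
    using common_face_bisect[OF tag[OF p2(1)] tag[OF q2(1)] meet_uniform[OF p2(1) q2(1)] n2 C q2(2) c1 c2] .
  have "edge_ends p1 \<subseteq> vset p2 \<inter> vset q2"
  proof (rule edge_ends_child_subset[OF tag[OF p2(1)] d C _ c2])
    show "\<not> edge_ends p2 \<subseteq> vset p2 \<inter> vset q2" using n2 by blast
    show "vset p2 \<inter> vset q2 \<subseteq> vset p1" using eq by blast
  qed blast
  then have "edge_ends p1 \<subseteq> vset q1" unfolding eq[symmetric] by blast
  then show False using n1 by blast
qed

end

section \<open>Time intervals\<close>

definition iv :: "real \<Rightarrow> real \<Rightarrow> real \<Rightarrow> real set" where
  "iv T a b = (if b = T then {a..b} else {a..<b})"

lemma iv_simps:
  assumes "a < b"
  shows "closure (iv T a b) = {a..b}" "Inf (iv T a b) = a" "Sup (iv T a b) = b" "iv T a b \<noteq> {}"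
    "measure lebesgue (iv T a b) = b - a" "interior (iv T a b) = {a<..<b}" "iv T a b \<subseteq> {a..b}"
    "{a..<b} \<subseteq> iv T a b" "is_interval (iv T a b)" "b \<in> iv T a b \<longleftrightarrow> b = T"
  using assms by (auto simp: iv_def interior_atLeastLessThan is_interval_cc is_interval_co)

lemma iv_subset:
  assumes "a < b" "c < d" "iv T a b \<subseteq> iv T c d"
  shows "c \<le> a" "b \<le> d"
proof -
  have "closure (iv T a b) \<subseteq> closure (iv T c d)" using assms(3) by (rule closure_mono)
  then show "c \<le> a" "b \<le> d" using iv_simps(1) assms(1,2) by auto
qed

definition abut :: "real set \<Rightarrow> real set \<Rightarrow> bool" where
  "abut I J \<longleftrightarrow> card (closure I \<inter> closure J) = 1"

lemma abut_sym: "abut I J \<Longrightarrow> abut J I"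
  by (simp add: abut_def Int_commute)

lemma abut_iv:
  assumes "a < b" "c < d"
  shows "abut (iv T a b) (iv T c d) \<longleftrightarrow> b = c \<or> d = a"
proof -
  have I: "{a..b} \<inter> {c..d} = {max a c..min b d}" by simp
  show ?thesis
  proof
    assume "abut (iv T a b) (iv T c d)"
    then obtain x where x: "{max a c..min b d} = {x}"
      unfolding abut_def iv_simps(1)[OF assms(1)] iv_simps(1)[OF assms(2)] I using card_1_singletonE by blast
    then have "max a c = x" "min b d = x" by (metis atLeastatMost_empty_iff2 insert_not_empty atLeastAtMost_singleton_iff)+
    then show "b = c \<or> d = a" using assms by (auto simp: max_def min_def split: if_splits)
  next
    assume "b = c \<or> d = a"
    then have "max a c = min b d" using assms by auto
    then show "abut (iv T a b) (iv T c d)"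
      unfolding abut_def iv_simps(1)[OF assms(1)] iv_simps(1)[OF assms(2)] I by simp
  qed
qed

lemma bisect_interval_iv:
  assumes "a < b" "b \<le> T"
  shows "bisect_interval (iv T a b) = {iv T a ((a + b) / 2), iv T ((a + b) / 2) b}"
proof -
  have "(a + b) / 2 \<noteq> T" using assms by (simp add: field_simps)
  then show ?thesis
    unfolding bisect_interval_def Let_def iv_simps(2,3,10)[OF assms(1)] by (simp add: iv_def)
qed

locale time_mesh =
  fixes T :: real and M :: nat and t :: "nat \<Rightarrow> real"
  assumes grid: "time_grid T M t"
begin

abbreviation "\<I>\<^sub>0 \<equiv> initial_intervals M t"
abbreviation "intervals \<equiv> generation bisect_interval \<I>\<^sub>0"

lemma t_less:
  assumes "i < j" "j \<le> M"
  shows "t i < t j"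
  using assms
proof (induction j)
  case (Suc j)
  have "t j < t (Suc j)" using grid Suc.prems(2) by (simp add: time_grid_def)
  then show ?case using Suc by (cases "i = j") auto
qed simp

lemma t_le: "i \<le> j \<Longrightarrow> j \<le> M \<Longrightarrow> t i \<le> t j"
  using t_less[of i j] by (cases "i = j") auto

lemma t_T: "i < M \<Longrightarrow> t i < T"
  using t_less[of i M] grid by (simp add: time_grid_def)

lemma initial_eq: "\<I>\<^sub>0 = (\<lambda>i. iv T (t i) (t (Suc i))) ` {..<M}"
proof -
  have M: "1 \<le> M" "t M = T" using grid by (auto simp: time_grid_def)
  have 1: "iv T (t i) (t (Suc i)) = {t i..<t (Suc i)}" if "Suc i < M" for i
    using t_T[OF that] by (simp add: iv_def)
  have 2: "iv T (t (M - 1)) (t (Suc (M - 1))) = {t (M - 1)..t M}" using M by (simp add: iv_def)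
  have "{..<M} = insert (M - 1) {i. Suc i < M}" using M by auto
  then have "(\<lambda>i. iv T (t i) (t (Suc i))) ` {..<M}
    = insert {t (M - 1)..t M} ((\<lambda>i. iv T (t i) (t (Suc i))) ` {i. Suc i < M})"
    using 2 by simp
  also have "(\<lambda>i. iv T (t i) (t (Suc i))) ` {i. Suc i < M} = {{t i..<t (Suc i)} |i. Suc i < M}"
    using 1 by (auto simp: image_iff)
  finally show ?thesis by (simp add: initial_intervals_def)
qed

lemma initial_form:
  assumes "i < M"
  shows "0 \<le> t i" "t i < t (Suc i)" "t (Suc i) \<le> T"
  using grid t_le[of 0 i] t_le[of "Suc i" M] assms by (auto simp: time_grid_def)

lemma interval_form:
  assumes "I \<in> intervals n"
  obtains a b where "0 \<le> a" "a < b" "b \<le> T" "I = iv T a b"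
proof -
  have "\<exists>a b. 0 \<le> a \<and> a < b \<and> b \<le> T \<and> I = iv T a b"
    using assms
  proof (induction n arbitrary: I)
    case 0
    then obtain i where "i < M" "I = iv T (t i) (t (Suc i))" by (auto simp: initial_eq)
    then show ?case using initial_form by blast
  next
    case (Suc n)
    then obtain J where J: "J \<in> intervals n" "I \<in> bisect_interval J" by (auto simp: generation_Suc)
    obtain a b where ab: "0 \<le> a" "a < b" "b \<le> T" "J = iv T a b" using Suc.IH[OF J(1)] by blast
    have "I = iv T a ((a + b) / 2) \<or> I = iv T ((a + b) / 2) b"
      using J(2) bisect_interval_iv[OF ab(2,3)] ab(4) by simp
    moreover have "0 \<le> (a + b) / 2" "a < (a + b) / 2" "(a + b) / 2 < b" "(a + b) / 2 \<le> T" using ab by auto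
    ultimately show ?case using ab by blast
  qed
  then show ?thesis using that by blast
qed

lemma cover_bisect_interval:
  assumes "I \<in> intervals n"
  shows "(\<Union>J\<in>bisect_interval I. J) = I"
proof -
  obtain a b where ab: "0 \<le> a" "a < b" "b \<le> T" "I = iv T a b" using assms by (rule interval_form)
  have "(a + b) / 2 < T" "a < (a + b) / 2" "(a + b) / 2 < b" using ab by auto
  then have "iv T a ((a + b) / 2) \<union> iv T ((a + b) / 2) b = iv T a b" by (auto simp: iv_def)
  then show ?thesis using bisect_interval_iv[OF ab(2,3)] ab(4) by simp
qed

lemma separated_intervals:
  assumes "I \<in> intervals n" "J \<in> intervals n" "I \<inter> J \<noteq> {}"
  shows "I = J"
  using assms
proof (induction n arbitrary: I J)
  case 0
  obtain i j where ij: "i < M" "I = iv T (t i) (t (Suc i))" "j < M" "J = iv T (t j) (t (Suc j))"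
    using 0 by (auto simp: initial_eq)
  have less: "iv T (t i) (t (Suc i)) \<inter> iv T (t j) (t (Suc j)) = {}" if "i < j" "j < M" for i j
  proof -
    have "t (Suc i) \<le> t j" using that by (intro t_le) auto
    moreover have "t (Suc i) < T" using that by (intro t_T) auto
    ultimately show ?thesis by (auto simp: iv_def)
  qed
  have "i = j" using less[of i j] less[of j i] ij 0(3) by (metis Int_commute linorder_neqE_nat)
  then show ?case using ij by simp
next
  case (Suc n)
  obtain I' where I': "I' \<in> intervals n" "I \<in> bisect_interval I'" using Suc.prems(1) by (auto simp: generation_Suc)
  obtain J' where J': "J' \<in> intervals n" "J \<in> bisect_interval J'" using Suc.prems(2) by (auto simp: generation_Suc)
  have "I \<subseteq> I'" "J \<subseteq> J'" using cover_bisect_interval I' J' by blast+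
  then have "I' = J'" using Suc.IH[OF I'(1) J'(1)] Suc.prems(3) by blast
  obtain a b where ab: "0 \<le> a" "a < b" "b \<le> T" "I' = iv T a b" using I'(1) by (rule interval_form)
  have "(a + b) / 2 < T" using ab by auto
  then have "iv T a ((a + b) / 2) \<inter> iv T ((a + b) / 2) b = {}" by (auto simp: iv_def)
  then show ?case
    using I'(2) J'(2) \<open>I' = J'\<close> ab(4) bisect_interval_iv[OF ab(2,3)] Suc.prems(3) by auto
qed

sublocale tim: refinement_tree \<I>\<^sub>0 bisect_interval "\<lambda>I. I" "\<lambda>A. A \<noteq> {}"
proof
  show "finite \<I>\<^sub>0" by (simp add: initial_eq)
  show "I \<noteq> {}" if "I \<in> intervals n" for I n
    using that by (rule interval_form) (simp add: iv_simps)
  show "finite (bisect_interval I)" for I by (simp add: bisect_interval_def Let_def)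
qed (use cover_bisect_interval separated_intervals in auto)

lemma cover_initial_intervals: "\<Union>\<I>\<^sub>0 = {0..T}"
proof
  show "\<Union>\<I>\<^sub>0 \<subseteq> {0..T}"
  proof
    fix x assume "x \<in> \<Union>\<I>\<^sub>0"
    then obtain i where "i < M" "x \<in> iv T (t i) (t (Suc i))" by (auto simp: initial_eq)
    then show "x \<in> {0..T}" using initial_form[of i] iv_simps(7)[of "t i" "t (Suc i)" T] by fastforce
  qed
  have "{0..<t k} \<subseteq> \<Union>\<I>\<^sub>0" if "k \<le> M" for k
    using that
  proof (induction k)
    case 0
    then show ?case using grid by (simp add: time_grid_def)
  next
    case (Suc k)
    have "{t k..<t (Suc k)} \<subseteq> iv T (t k) (t (Suc k))" using iv_simps(8) initial_form(2)[of k] Suc.prems by simp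
    moreover have "iv T (t k) (t (Suc k)) \<in> \<I>\<^sub>0" using Suc.prems by (auto simp: initial_eq)
    ultimately have "{t k..<t (Suc k)} \<subseteq> \<Union>\<I>\<^sub>0" by blast
    moreover have "{0..<t (Suc k)} \<subseteq> {0..<t k} \<union> {t k..<t (Suc k)}" by auto
    ultimately show ?case using Suc by auto
  qed
  then have "{0..<T} \<subseteq> \<Union>\<I>\<^sub>0" using grid by (auto simp: time_grid_def)
  moreover have "T \<in> {t (M - 1)..t M}" using grid initial_form[of "M - 1"] by (auto simp: time_grid_def)
  then have "T \<in> \<Union>\<I>\<^sub>0" by (auto simp: initial_intervals_def)
  moreover have "{0..T} \<subseteq> insert T {0..<T}" by auto
  ultimately show "{0..T} \<subseteq> \<Union>\<I>\<^sub>0" by blast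
qed

lemma nested_intervals:
  assumes "I \<in> intervals n" "J \<in> intervals k" "k \<le> n" "I \<inter> J \<noteq> {}"
  shows "I \<subseteq> J"
  using tim.subset_if_ov[OF assms(1,2,3)] assms(4) by simp

lemma measure_overlap:
  assumes "I \<in> intervals n" "J \<in> intervals k"
  shows "measure lebesgue (I \<inter> J) > 0 \<longleftrightarrow> I \<inter> J \<noteq> {}"
proof
  show "I \<inter> J \<noteq> {}" if "measure lebesgue (I \<inter> J) > 0" using that by auto
  have pos: "measure lebesgue I > 0" if "I \<in> intervals n" for I n
    using that by (rule interval_form) (simp add: iv_simps)
  assume "I \<inter> J \<noteq> {}"
  then have "I \<subseteq> J \<or> J \<subseteq> I"
    using nested_intervals[OF assms] nested_intervals[OF assms(2,1)] by (cases "k \<le> n") (auto simp: Int_commute)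
  then have "I \<inter> J = I \<or> I \<inter> J = J" by blast
  then show "measure lebesgue (I \<inter> J) > 0" using pos assms by auto
qed

lemma abut_coarsen:
  assumes I: "I \<in> intervals n" and J: "J \<in> intervals k" "abut I J" and J': "J' \<in> intervals j" "J \<subseteq> J'"
    and disj: "I \<inter> J' = {}"
  shows "abut I J'"
proof -
  obtain a b where ab: "a < b" "I = iv T a b" using I by (rule interval_form)
  obtain c d where cd: "c < d" "J = iv T c d" using J(1) by (rule interval_form)
  obtain c' d' where cd': "c' < d'" "J' = iv T c' d'" using J'(1) by (rule interval_form)
  have le: "c' \<le> c" "d \<le> d'" using iv_subset[OF cd(1) cd'(1)] J'(2) cd cd' by auto
  have "b = c \<or> d = a" using J(2) abut_iv[OF ab(1) cd(1)] ab cd by simp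
  then have "b = c' \<or> d' = a"
  proof
    assume bc: "b = c"
    have "\<not> c' < b"
    proof
      assume "c' < b"
      then have "max a c' \<in> {a..<b}" "max a c' \<in> {c'..<d'}" using ab(1) bc cd(1) le by auto
      then show False using disj iv_simps(8)[OF ab(1)] iv_simps(8)[OF cd'(1)] ab(2) cd'(2) by blast
    qed
    then show ?thesis using le bc by simp
  next
    assume da: "d = a"
    have "\<not> a < d'"
    proof
      assume "a < d'"
      then have "a \<in> {a..<b}" "a \<in> {c'..<d'}" using ab(1) da cd(1) le by auto
      then show False using disj iv_simps(8)[OF ab(1)] iv_simps(8)[OF cd'(1)] ab(2) cd'(2) by blast
    qed
    then show ?thesis using le da by simp
  qed
  then show ?thesis using abut_iv[OF ab(1) cd'(1)] ab cd' by simp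
qed

lemma abut_refine:
  assumes I: "I \<in> intervals n" and J: "J \<in> intervals k" "abut I J" and "k \<le> m"
  shows "\<exists>J'\<in>intervals m. J' \<subseteq> J \<and> abut I J'"
  using assms(4)
proof (induction m rule: dec_induct)
  case base
  then show ?case using J by blast
next
  case (step m)
  then obtain K where K: "K \<in> intervals m" "K \<subseteq> J" "abut I K" by blast
  obtain a b where ab: "a < b" "I = iv T a b" using I by (rule interval_form)
  obtain c d where cd: "c < d" "d \<le> T" "K = iv T c d" using K(1) by (rule interval_form)
  have bis: "bisect_interval K = {iv T c ((c + d) / 2), iv T ((c + d) / 2) d}"
    using bisect_interval_iv cd by simp
  have m: "c < (c + d) / 2" "(c + d) / 2 < d" using cd by auto
  have "b = c \<or> d = a" using K(3) abut_iv[OF ab(1) cd(1)] ab cd by simp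
  then have "abut I (iv T c ((c + d) / 2)) \<or> abut I (iv T ((c + d) / 2) d)"
    using abut_iv[OF ab(1) m(1)] abut_iv[OF ab(1) m(2)] ab by auto
  then obtain J' where "J' \<in> bisect_interval K" "abut I J'" using bis by blast
  then show ?case using tim.child_gen[OF K(1)] tim.child_subset[OF K(1)] K(2) by blast
qed

end

section \<open>Prisms\<close>

locale space_time = initial_mesh \<Omega> \<T>\<^sub>0 + time_mesh T M t
  for \<Omega> :: "'a::euclidean_space set" and \<T>\<^sub>0 :: "'a tsimplex set" and T :: real and M :: nat and t :: "nat \<Rightarrow> real" +
  fixes s1 s2 :: real
  assumes s1: "0 < s1" and s2: "0 < s2"
begin

definition time_level :: "nat \<Rightarrow> nat" where
  "time_level n = nat \<lceil>real n * s2 / (s1 * real DIM('a))\<rceil>"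

lemma time_level_0 [simp]: "time_level 0 = 0"
  by (simp add: time_level_def)

lemma ceiling_mono': "n \<le> k \<Longrightarrow> \<lceil>real n * s2 / (s1 * real DIM('a))\<rceil> \<le> \<lceil>real k * s2 / (s1 * real DIM('a))\<rceil>"
  using s1 s2 by (intro ceiling_mono divide_right_mono mult_right_mono) auto

lemma time_level_mono: "n \<le> k \<Longrightarrow> time_level n \<le> time_level k"
  unfolding time_level_def by (intro nat_mono ceiling_mono')

lemma time_level_diff:
  "nat (\<lceil>real (n + 1) * s2 / (s1 * real DIM('a))\<rceil> - \<lceil>real n * s2 / (s1 * real DIM('a))\<rceil>)
    = time_level (Suc n) - time_level n"
proof -
  have "0 \<le> real n * s2 / (s1 * real DIM('a))" using s1 s2 by simp
  then have "0 \<le> \<lceil>real n * s2 / (s1 * real DIM('a))\<rceil>" by linarith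
  then show ?thesis using ceiling_mono'[of n "n + 1"] by (simp add: time_level_def nat_diff_distrib)
qed

definition prisms :: "nat \<Rightarrow> 'a prism set" where
  "prisms n = intervals (time_level n) \<times> uniform n"

definition below :: "'a prism \<Rightarrow> 'a prism \<Rightarrow> bool" where
  "below Q Q' \<longleftrightarrow> fst Q \<subseteq> fst Q' \<and> pts (snd Q) \<subseteq> pts (snd Q')"

definition touching :: "'a prism \<Rightarrow> 'a prism \<Rightarrow> bool" where
  "touching Q Q' \<longleftrightarrow> touch_in_time Q Q' \<or>
    DIM('a) = 1 \<and> overlap_in_time Q Q' \<and> card (pts (snd Q) \<inter> pts (snd Q')) = 1"

lemma touchingE:
  assumes "touching Q A"
  obtains "touch_in_time Q A"
    | "DIM('a) = 1 \<and> overlap_in_time Q A \<and> card (pts (snd Q) \<inter> pts (snd A)) = 1"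
  using assms unfolding touching_def by blast

definition patch :: "'a prism \<Rightarrow> 'a prism set" where
  "patch Q = {Q'. fst Q' = fst Q \<and> edge_ends (snd Q') = edge_ends (snd Q) \<and> (\<exists>n. Q \<in> prisms n \<and> Q' \<in> prisms n)}"

lemma prismsD:
  assumes "Q \<in> prisms n"
  shows "fst Q \<in> intervals (time_level n)" "snd Q \<in> uniform n"
  using assms by (auto simp: prisms_def)

lemma prismsI: "I \<in> intervals (time_level n) \<Longrightarrow> S \<in> uniform n \<Longrightarrow> (I, S) \<in> prisms n"
  by (simp add: prisms_def)

lemma touch_iff:
  fixes Q Q' :: "'a prism"
  shows "touch_in_time Q Q' \<longleftrightarrow> abut (fst Q) (fst Q') \<and> aff_dim (pts (snd Q) \<inter> pts (snd Q')) = int DIM('a)"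
  by (simp add: touch_in_time_def abut_def)

lemma overlap_iff:
  assumes "Q \<in> prisms n" "Q' \<in> prisms k"
  shows "overlap_in_time Q Q' \<longleftrightarrow> fst Q \<inter> fst Q' \<noteq> {}"
  unfolding overlap_in_time_def using measure_overlap prismsD(1)[OF assms(1)] prismsD(1)[OF assms(2)] by blast

lemma time_nested:
  assumes "Q \<in> prisms n" "Q' \<in> prisms k" "k \<le> n" "fst Q \<inter> fst Q' \<noteq> {}"
  shows "fst Q \<subseteq> fst Q'"
  using nested_intervals[OF prismsD(1)[OF assms(1)] prismsD(1)[OF assms(2)] time_level_mono[OF assms(3)] assms(4)] .

lemma space_nested:
  assumes "Q \<in> prisms n" "Q' \<in> prisms k" "k \<le> n" "aff_dim (pts (snd Q) \<inter> pts (snd Q')) = int DIM('a)"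
  shows "pts (snd Q) \<subseteq> pts (snd Q')"
  using simp.subset_if_ov[OF prismsD(2)[OF assms(1)] prismsD(2)[OF assms(2)] assms(3,4)] .

lemma full_dim:
  assumes "Q \<in> prisms n" "pts (snd Q) \<subseteq> A"
  shows "aff_dim A = int DIM('a)"
  using simp.ov_subset[OF prismsD(2)[OF assms(1)] assms(2)] .

lemma full_dim_mono:
  fixes A B :: "'a set"
  shows "aff_dim A = int DIM('a) \<Longrightarrow> A \<subseteq> B \<Longrightarrow> aff_dim B = int DIM('a)"
  by (rule simp.ov_mono)

lemma single_point:
  assumes d: "DIM('a) = 1" and Q: "Q \<in> prisms n" "Q' \<in> prisms k" "k \<le> n" "\<not> pts (snd Q) \<subseteq> pts (snd Q')"
    and x: "x \<in> pts (snd Q)" "x \<in> pts (snd Q')"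
  shows "card (pts (snd Q) \<inter> pts (snd Q')) = 1"
proof -
  have "aff_dim (pts (snd Q) \<inter> pts (snd Q')) \<noteq> 1" using space_nested[OF Q(1-3)] Q(4) d by auto
  moreover have "aff_dim (pts (snd Q) \<inter> pts (snd Q')) \<le> 1"
    using aff_dim_le_DIM[of "pts (snd Q) \<inter> pts (snd Q')"] d by simp
  moreover have "aff_dim (pts (snd Q) \<inter> pts (snd Q')) \<noteq> -1" using x aff_dim_empty[of "pts (snd Q) \<inter> pts (snd Q')"] by auto
  moreover have "-1 \<le> aff_dim (pts (snd Q) \<inter> pts (snd Q'))" by (rule aff_dim_geq)
  ultimately have "aff_dim (pts (snd Q) \<inter> pts (snd Q')) = 0" by linarith
  then show ?thesis unfolding aff_dim_eq_0 by auto
qed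

lemma prism_nonempty: "Q \<in> prisms n \<Longrightarrow> fst Q \<noteq> {}"
  using tim.gen_nonempty[OF prismsD(1)] .

lemma prism_child:
  assumes "Q \<in> prisms n" "s \<in> fst Q" "C \<in> bisect (snd Q)"
  shows "\<exists>J. (J, C) \<in> prisms (Suc n) \<and> s \<in> J \<and> below (J, C) Q"
proof -
  obtain J where "J \<in> intervals (time_level (Suc n))" "J \<subseteq> fst Q" "s \<in> J"
    using tim.descendant_ex[OF prismsD(1)[OF assms(1)] time_level_mono[of n "Suc n"] assms(2)] by auto
  moreover have "C \<in> uniform (Suc n)" "pts C \<subseteq> pts (snd Q)"
    using simp.child_gen[OF prismsD(2)[OF assms(1)] assms(3)] simp.child_subset[OF prismsD(2)[OF assms(1)] assms(3)] .
  ultimately show ?thesis using prismsI by (intro exI[of _ J]) (auto simp: below_def)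
qed

lemma bisect_ex:
  assumes "Q \<in> prisms n"
  obtains C where "C \<in> bisect (snd Q)"
proof -
  have "pts (snd Q) \<noteq> {}" using simp.gen_nonempty[OF prismsD(2)[OF assms]] .
  then show ?thesis using simp.child_ex[OF prismsD(2)[OF assms]] that by blast
qed

lemma prism_ancestor:
  assumes "Q \<in> prisms n" "k \<le> n"
  shows "\<exists>A\<in>prisms k. below Q A"
proof -
  obtain J where "J \<in> intervals (time_level k)" "fst Q \<subseteq> J"
    using tim.ancestor_ex[OF prismsD(1)[OF assms(1)] time_level_mono[OF assms(2)]] by blast
  moreover obtain W where "W \<in> uniform k" "pts (snd Q) \<subseteq> pts W"
    using simp.ancestor_ex[OF prismsD(2)[OF assms(1)] assms(2)] by blast
  ultimately show ?thesis using prismsI by (intro bexI[of _ "(J, W)"]) (auto simp: below_def)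
qed

lemma prism_ancestor_unique:
  assumes "Q \<in> prisms n" "A \<in> prisms k" "B \<in> prisms k" "below Q A" "below Q B"
  shows "A = B"
proof (rule prod_eqI)
  show "fst A = fst B"
    by (rule tim.ancestor_unique[OF prismsD(1)[OF assms(1)] prismsD(1)[OF assms(2)] prismsD(1)[OF assms(3)]])
      (use assms(4,5) in \<open>simp_all add: below_def\<close>)
  show "snd A = snd B"
    by (rule simp.ancestor_unique[OF prismsD(2)[OF assms(1)] prismsD(2)[OF assms(2)] prismsD(2)[OF assms(3)]])
      (use assms(4,5) in \<open>simp_all add: below_def\<close>)
qed

lemma prism_level_unique: "Q \<in> prisms n \<Longrightarrow> Q \<in> prisms k \<Longrightarrow> n = k"
  using level_le[of "snd Q" n "snd Q" k] level_le[of "snd Q" k "snd Q" n] prismsD(2)[of Q n] prismsD(2)[of Q k] by simp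

lemma patch_eq:
  assumes "Q \<in> prisms n"
  shows "patch Q = {X \<in> prisms n. fst X = fst Q \<and> edge_ends (snd X) = edge_ends (snd Q)}"
proof -
  have "(\<exists>k. Q \<in> prisms k \<and> X \<in> prisms k) \<longleftrightarrow> X \<in> prisms n" for X
    using assms prism_level_unique[OF assms] by blast
  then show ?thesis unfolding patch_def by blast
qed

lemma touching_refine:
  assumes Q: "Q \<in> prisms n" and A: "A \<in> prisms k" and "touching Q A" and m: "k \<le> m" "Suc m = n"
  shows "\<exists>B\<in>prisms m. touching Q B \<and> below B A"
  using \<open>touching Q A\<close>
proof (rule touchingE)
  assume "touch_in_time Q A"
  then have ab: "abut (fst Q) (fst A)" and full: "aff_dim (pts (snd Q) \<inter> pts (snd A)) = int DIM('a)"
    by (simp_all add: touch_iff)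
  obtain J where J: "J \<in> intervals (time_level m)" "J \<subseteq> fst A" "abut (fst Q) J"
    using abut_refine[OF prismsD(1)[OF Q] prismsD(1)[OF A] ab time_level_mono[OF m(1)]] by blast
  obtain W where W: "W \<in> uniform m" "pts (snd Q) \<subseteq> pts W"
    using simp.ancestor_ex[OF prismsD(2)[OF Q], of m] m(2) by auto
  have QA: "pts (snd Q) \<subseteq> pts (snd A)" using space_nested[OF Q A _ full] m by simp
  have "pts W \<subseteq> pts (snd A)"
    using simp.subset_if_ov[OF W(1) prismsD(2)[OF A] m(1)] full_dim[OF Q, of "pts W \<inter> pts (snd A)"] QA W(2) by simp
  moreover have "aff_dim (pts (snd Q) \<inter> pts W) = int DIM('a)" using full_dim[OF Q] W(2) by simp
  ultimately show ?thesis
    using J W(1) prismsI[OF J(1) W(1)] by (intro bexI[of _ "(J, W)"]) (auto simp: below_def touching_def touch_iff)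
next
  assume *: "DIM('a) = 1 \<and> overlap_in_time Q A \<and> card (pts (snd Q) \<inter> pts (snd A)) = 1"
  then obtain x where x: "pts (snd Q) \<inter> pts (snd A) = {x}" using card_1_singletonE by blast
  have ov: "fst Q \<inter> fst A \<noteq> {}" using * overlap_iff[OF Q A] by blast
  obtain J where J: "J \<in> intervals (time_level m)" "fst Q \<subseteq> J"
    using tim.ancestor_ex[OF prismsD(1)[OF Q], of "time_level m"] time_level_mono[of m n] m(2) by auto
  have JA: "J \<subseteq> fst A"
    using nested_intervals[OF J(1) prismsD(1)[OF A] time_level_mono[OF m(1)]] ov J(2) by blast
  obtain W where W: "W \<in> uniform m" "pts W \<subseteq> pts (snd A)" "x \<in> pts W"
    using simp.descendant_ex[OF prismsD(2)[OF A] m(1), of x] x by blast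
  have "pts (snd Q) \<inter> pts W = {x}" using x W by blast
  moreover have B: "(J, W) \<in> prisms m" using prismsI[OF J(1) W(1)] .
  moreover have "overlap_in_time Q (J, W)" using overlap_iff[OF Q B] J(2) prism_nonempty[OF Q] by auto
  ultimately show ?thesis
    using * JA W(2) by (intro bexI[of _ "(J, W)"]) (auto simp: below_def touching_def)
qed

lemma touching_coarsen2:
  assumes Q: "Q \<in> prisms n" and A: "A \<in> prisms k" and "touching Q A"
    and B: "B \<in> prisms j" "below A B" "j \<le> n"
  shows "below Q B \<or> touching Q B"
  using \<open>touching Q A\<close>
proof (rule touchingE)
  have AB: "fst A \<subseteq> fst B" "pts (snd A) \<subseteq> pts (snd B)" using B(2) by (auto simp: below_def)
  assume "touch_in_time Q A"
  then have ab: "abut (fst Q) (fst A)" and full: "aff_dim (pts (snd Q) \<inter> pts (snd A)) = int DIM('a)"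
    by (simp_all add: touch_iff)
  have full': "aff_dim (pts (snd Q) \<inter> pts (snd B)) = int DIM('a)" using full_dim_mono[OF full] AB(2) by blast
  then have sub: "pts (snd Q) \<subseteq> pts (snd B)" using space_nested[OF Q B(1,3)] by simp
  show ?thesis
  proof (cases "fst Q \<inter> fst B = {}")
    case True
    then have "abut (fst Q) (fst B)"
      using abut_coarsen[OF prismsD(1)[OF Q] prismsD(1)[OF A] ab prismsD(1)[OF B(1)] AB(1)] by simp
    then show ?thesis using full' by (simp add: touching_def touch_iff)
  next
    case False
    then show ?thesis using time_nested[OF Q B(1,3)] sub by (simp add: below_def)
  qed
next
  have AB: "fst A \<subseteq> fst B" "pts (snd A) \<subseteq> pts (snd B)" using B(2) by (auto simp: below_def)
  assume *: "DIM('a) = 1 \<and> overlap_in_time Q A \<and> card (pts (snd Q) \<inter> pts (snd A)) = 1"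
  then obtain x where x: "pts (snd Q) \<inter> pts (snd A) = {x}" using card_1_singletonE by blast
  have ov: "fst Q \<inter> fst B \<noteq> {}" using * overlap_iff[OF Q A] AB(1) by blast
  show ?thesis
  proof (cases "pts (snd Q) \<subseteq> pts (snd B)")
    case True
    then show ?thesis using time_nested[OF Q B(1,3) ov] by (simp add: below_def)
  next
    case False
    have "card (pts (snd Q) \<inter> pts (snd B)) = 1"
      using single_point[OF _ Q B(1,3) False, of x] * x AB(2) by blast
    then show ?thesis using * ov overlap_iff[OF Q B(1)] by (simp add: touching_def)
  qed
qed

lemma touching_sym: "touching Q A \<Longrightarrow> touching A Q"
  by (simp add: touching_def touch_in_time_def overlap_in_time_def Int_commute)

lemma touching_coarsen:
  assumes Q: "Q \<in> prisms n" and A: "A \<in> prisms k" and "touching Q A"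
    and B: "B \<in> prisms j" "below Q B" "k \<le> j"
  shows "below B A \<or> touching B A"
  using \<open>touching Q A\<close>
proof (rule touchingE)
  have QB: "fst Q \<subseteq> fst B" "pts (snd Q) \<subseteq> pts (snd B)" using B(2) by (auto simp: below_def)
  assume "touch_in_time Q A"
  then have ab: "abut (fst A) (fst Q)" and full: "aff_dim (pts (snd Q) \<inter> pts (snd A)) = int DIM('a)"
    by (simp_all add: touch_iff abut_sym)
  have full': "aff_dim (pts (snd B) \<inter> pts (snd A)) = int DIM('a)" using full_dim_mono[OF full] QB(2) by blast
  then have sub: "pts (snd B) \<subseteq> pts (snd A)" using space_nested[OF B(1) A B(3)] by simp
  show ?thesis
  proof (cases "fst A \<inter> fst B = {}")
    case True
    then have "abut (fst A) (fst B)"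
      using abut_coarsen[OF prismsD(1)[OF A] prismsD(1)[OF Q] ab prismsD(1)[OF B(1)] QB(1)] by simp
    then show ?thesis using full' abut_sym by (simp add: touching_def touch_iff)
  next
    case False
    then have "fst B \<inter> fst A \<noteq> {}" by (simp add: Int_commute)
    then show ?thesis using time_nested[OF B(1) A B(3)] sub by (simp add: below_def)
  qed
next
  have QB: "fst Q \<subseteq> fst B" "pts (snd Q) \<subseteq> pts (snd B)" using B(2) by (auto simp: below_def)
  assume *: "DIM('a) = 1 \<and> overlap_in_time Q A \<and> card (pts (snd Q) \<inter> pts (snd A)) = 1"
  then obtain x where x: "pts (snd Q) \<inter> pts (snd A) = {x}" using card_1_singletonE by blast
  have ov: "fst B \<inter> fst A \<noteq> {}" using * overlap_iff[OF Q A] QB(1) by blast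
  show ?thesis
  proof (cases "pts (snd B) \<subseteq> pts (snd A)")
    case True
    then show ?thesis using time_nested[OF B(1) A B(3) ov] by (simp add: below_def)
  next
    case False
    have "card (pts (snd B) \<inter> pts (snd A)) = 1"
      using single_point[OF _ B(1) A B(3) False, of x] * x QB(2) by blast
    then show ?thesis using * ov overlap_iff[OF B(1) A] by (simp add: touching_def)
  qed
qed

lemma touching_child:
  assumes Q: "Q \<in> prisms n" and A: "A \<in> prisms k" and "touching Q A" and "k \<le> n"
  shows "\<exists>C\<in>prisms (Suc n). below C Q \<and> touching C A"
  using \<open>touching Q A\<close>
proof (rule touchingE)
  assume "touch_in_time Q A"
  then have ab: "abut (fst A) (fst Q)" and full: "aff_dim (pts (snd Q) \<inter> pts (snd A)) = int DIM('a)"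
    by (simp_all add: touch_iff abut_sym)
  obtain J where J: "J \<in> intervals (time_level (Suc n))" "J \<subseteq> fst Q" "abut (fst A) J"
    using abut_refine[OF prismsD(1)[OF A] prismsD(1)[OF Q] ab, of "time_level (Suc n)"] time_level_mono[of n "Suc n"] by auto
  obtain C where C: "C \<in> bisect (snd Q)" using bisect_ex[OF Q] .
  have C': "C \<in> uniform (Suc n)" "pts C \<subseteq> pts (snd Q)"
    using simp.child_gen[OF prismsD(2)[OF Q] C] simp.child_subset[OF prismsD(2)[OF Q] C] .
  have "pts (snd Q) \<subseteq> pts (snd A)" using space_nested[OF Q A \<open>k \<le> n\<close> full] .
  then have "pts C \<subseteq> pts C \<inter> pts (snd A)" using C'(2) by blast
  then have "aff_dim (pts C \<inter> pts (snd A)) = int DIM('a)" using simp.ov_subset[OF C'(1)] by simp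
  then show ?thesis
    using J C' prismsI[OF J(1) C'(1)] abut_sym[OF J(3)]
    by (intro bexI[of _ "(J, C)"]) (auto simp: below_def touching_def touch_iff)
next
  assume *: "DIM('a) = 1 \<and> overlap_in_time Q A \<and> card (pts (snd Q) \<inter> pts (snd A)) = 1"
  then obtain x where x: "pts (snd Q) \<inter> pts (snd A) = {x}" using card_1_singletonE by blast
  have "fst Q \<inter> fst A \<noteq> {}" using * overlap_iff[OF Q A] by blast
  then have QA: "fst Q \<subseteq> fst A" using time_nested[OF Q A \<open>k \<le> n\<close>] by simp
  obtain s where s: "s \<in> fst Q" using prism_nonempty[OF Q] by blast
  obtain C where C: "C \<in> bisect (snd Q)" "x \<in> pts C" using simp.child_ex[OF prismsD(2)[OF Q], of x] x by blast
  obtain J where J: "(J, C) \<in> prisms (Suc n)" "s \<in> J" "below (J, C) Q" using prism_child[OF Q s C(1)] by blast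
  have "pts C \<subseteq> pts (snd Q)" using J(3) by (simp add: below_def)
  then have "pts C \<inter> pts (snd A) = {x}" using x C(2) by blast
  moreover have "overlap_in_time (J, C) A" using overlap_iff[OF J(1) A] J(2) s QA by auto
  ultimately show ?thesis using * J by (intro bexI[of _ "(J, C)"]) (auto simp: touching_def)
qed

sublocale mesh_forest prisms below touching patch
proof
  show "finite (prisms n)" for n
    unfolding prisms_def using tim.finite_gen simp.finite_gen by blast
  show "below Q Q" for Q by (simp add: below_def)
  show "below Q Q''" if "below Q Q'" "below Q' Q''" for Q Q' Q'' using that by (auto simp: below_def)
  show "\<exists>A\<in>prisms k. below Q A" if "Q \<in> prisms n" "k \<le> n" for Q n k using prism_ancestor[OF that] .
  show "A = B" if "Q \<in> prisms n" "A \<in> prisms k" "B \<in> prisms k" "below Q A" "below Q B" for Q n A B k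
    using prism_ancestor_unique[OF that] .
  show "k \<le> n" if "Q \<in> prisms n" "A \<in> prisms k" "below Q A" for Q n A k
    using level_le[OF prismsD(2)[OF that(1)] prismsD(2)[OF that(2)]] that(3) by (simp add: below_def)
  show "\<exists>C\<in>prisms (Suc n). below C Q" if Q: "Q \<in> prisms n" for Q n
  proof -
    obtain s where "s \<in> fst Q" using prism_nonempty[OF Q] by blast
    moreover obtain C where "C \<in> bisect (snd Q)" using bisect_ex[OF Q] .
    ultimately show ?thesis using prism_child[OF Q] by blast
  qed
  show "Q \<in> patch Q" if "Q \<in> prisms n" for Q n using that by (simp add: patch_eq)
  show "patch Q \<subseteq> prisms n" if "Q \<in> prisms n" for Q n using patch_eq[OF that] by simp
  show "patch Q' = patch Q" if Q: "Q \<in> prisms n" "Q' \<in> patch Q" for Q Q' n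
  proof -
    have "Q' \<in> prisms n" "fst Q' = fst Q" "edge_ends (snd Q') = edge_ends (snd Q)" using Q(2) by (simp_all add: patch_eq[OF Q(1)])
    then show ?thesis by (simp add: patch_eq[OF Q(1)] patch_eq[of Q' n])
  qed
qed (fact touching_sym touching_refine touching_coarsen touching_coarsen2 touching_child)+

lemma level_prism: "Q \<in> prisms n \<Longrightarrow> level \<T>\<^sub>0 Q = n"
  unfolding level_def using simplex_level_uniform prismsD(2) by blast

lemma children_prisms:
  assumes "Q \<in> prisms n"
  shows "children Q = {C \<in> prisms (Suc n). below C Q}"
proof -
  have "(\<exists>k. Q \<in> prisms k \<and> C \<in> prisms (Suc k) \<and> below C Q) \<longleftrightarrow> C \<in> prisms (Suc n) \<and> below C Q" for C
    using assms prism_level_unique[OF assms] by blast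
  then show ?thesis by (simp add: children_def)
qed

lemma split_eq:
  assumes "Q \<in> prisms n"
  shows "atomic_split \<T>\<^sub>0 s1 s2 Q = children Q"
proof -
  have lev: "simplex_level \<T>\<^sub>0 (snd Q) = n" using level_prism[OF assms] by (simp add: level_def)
  have "atomic_split \<T>\<^sub>0 s1 s2 Q = iterated bisect_interval (time_level (Suc n) - time_level n) (fst Q) \<times> bisect (snd Q)"
    unfolding atomic_split_def Let_def lev time_level_diff[symmetric] by simp
  also have "iterated bisect_interval (time_level (Suc n) - time_level n) (fst Q)
    = {J \<in> intervals (time_level (Suc n)). J \<subseteq> fst Q}"
    using tim.iterated_eq[OF prismsD(1)[OF assms], of "time_level (Suc n) - time_level n"] time_level_mono[of n "Suc n"] by simp
  also have "bisect (snd Q) = {C \<in> uniform (Suc n). pts C \<subseteq> pts (snd Q)}"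
    using simp.children_eq[OF prismsD(2)[OF assms]] .
  also have "{J \<in> intervals (time_level (Suc n)). J \<subseteq> fst Q} \<times> {C \<in> uniform (Suc n). pts C \<subseteq> pts (snd Q)}
    = {C \<in> prisms (Suc n). below C Q}"
    by (auto simp: prisms_def below_def)
  also have "\<dots> = children Q" by (rule children_prisms[OF assms, symmetric])
  finally show ?thesis .
qed

lemma initial_prisms: "\<I>\<^sub>0 \<times> \<T>\<^sub>0 = leaves {}"
  by (simp add: leaves_empty prisms_def)

lemma nodesE:
  assumes "Q \<in> nodes"
  obtains n where "Q \<in> prisms n"
  using assms by (auto simp: nodes_def)

lemma step_leaves:
  assumes R: "lower R" and Q: "Q \<in> leaves R"
  shows "lower (insert Q R)" "leaves R - {Q} \<union> atomic_split \<T>\<^sub>0 s1 s2 Q = leaves (insert Q R)"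
proof -
  obtain n where "Q \<in> prisms n" using leavesD(1)[OF Q] by (rule nodesE)
  then show "leaves R - {Q} \<union> atomic_split \<T>\<^sub>0 s1 s2 Q = leaves (insert Q R)"
    using leaves_insert[OF R Q] split_eq by simp
  show "lower (insert Q R)" using lower_insert[OF R Q] .
qed

lemma atomic_step_leaves:
  assumes R: "lower R"
  shows "atomic_step \<T>\<^sub>0 s1 s2 (leaves R) P' \<longleftrightarrow> (\<exists>Q\<in>leaves R. P' = leaves (insert Q R))"
  unfolding atomic_step_def using step_leaves(2)[OF R] by auto

lemma steps_leaves:
  assumes "lower R" "(atomic_step \<T>\<^sub>0 s1 s2 ^^ k) (leaves R) P'"
  shows "\<exists>R'. lower R' \<and> R \<subseteq> R' \<and> card (R' - R) = k \<and> P' = leaves R'"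
  using assms(2)
proof (induction k arbitrary: P')
  case 0
  then show ?case using assms(1) by auto
next
  case (Suc k)
  then obtain P1 where "(atomic_step \<T>\<^sub>0 s1 s2 ^^ k) (leaves R) P1" "atomic_step \<T>\<^sub>0 s1 s2 P1 P'" by auto
  then obtain R' where R': "lower R'" "R \<subseteq> R'" "card (R' - R) = k" "atomic_step \<T>\<^sub>0 s1 s2 (leaves R') P'"
    using Suc.IH by blast
  then obtain Q where Q: "Q \<in> leaves R'" "P' = leaves (insert Q R')" using atomic_step_leaves by blast
  have "Q \<notin> R'" using leavesD(2)[OF Q(1)] .
  then have "insert Q R' - R = insert Q (R' - R)" "Q \<notin> R' - R" using R'(2) by auto
  moreover have "finite (R' - R)" using R'(1) by (simp add: lower_def)
  ultimately have "card (insert Q R' - R) = Suc k" using R'(3) by simp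
  then show ?case using lower_insert[OF R'(1) Q(1)] R'(2) Q(2) by (intro exI[of _ "insert Q R'"]) auto
qed

lemma reachable_leaves:
  assumes "(atomic_step \<T>\<^sub>0 s1 s2)\<^sup>*\<^sup>* (\<I>\<^sub>0 \<times> \<T>\<^sub>0) P"
  obtains R where "lower R" "P = leaves R"
proof -
  obtain k where "(atomic_step \<T>\<^sub>0 s1 s2 ^^ k) (leaves {}) P"
    using assms unfolding initial_prisms by (auto simp: rtranclp_power)
  then show ?thesis using steps_leaves[OF lower_empty] that by blast
qed

lemma refine_leaves:
  assumes R: "lower R" and K: "K \<subseteq> leaves R" "finite K"
  shows "lower (R \<union> K)" "refine_all \<T>\<^sub>0 s1 s2 (leaves R) K = leaves (R \<union> K)"
proof -
  have "lower (R \<union> K) \<and> refine_all \<T>\<^sub>0 s1 s2 (leaves R) K = leaves (R \<union> K)"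
    using K(2,1)
  proof (induction K rule: finite_induct)
    case empty
    then show ?case using R by (simp add: refine_all_def)
  next
    case (insert Q K)
    have IH: "lower (R \<union> K)" "refine_all \<T>\<^sub>0 s1 s2 (leaves R) K = leaves (R \<union> K)"
      using insert by auto
    have Q: "Q \<in> leaves R" using insert by simp
    have QK: "Q \<in> leaves (R \<union> K)"
      unfolding IH(2)[symmetric] refine_all_def using Q insert.hyps by simp
    have disj: "L \<notin> atomic_split \<T>\<^sub>0 s1 s2 L'" if LL': "L \<in> leaves R" "L' \<in> leaves R" for L L'
    proof -
      obtain n where n: "L' \<in> prisms n" using leavesD(1)[OF LL'(2)] by (rule nodesE)
      then show ?thesis using children_not_leaf[OF LL'(2)] LL'(1) split_eq[OF n] by blast
    qed
    have "refine_all \<T>\<^sub>0 s1 s2 (leaves R) (insert Q K) = refine_all \<T>\<^sub>0 s1 s2 (leaves R) K - {Q} \<union> atomic_split \<T>\<^sub>0 s1 s2 Q"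
      unfolding refine_all_def using disj[OF Q] insert.prems by blast
    also have "\<dots> = leaves (insert Q (R \<union> K))" unfolding IH(2) using step_leaves(2)[OF IH(1) QK] .
    finally have "refine_all \<T>\<^sub>0 s1 s2 (leaves R) (insert Q K) = leaves (R \<union> insert Q K)" by simp
    then show ?case using lower_insert[OF IH(1) QK] by simp
  qed
  then show "lower (R \<union> K)" "refine_all \<T>\<^sub>0 s1 s2 (leaves R) K = leaves (R \<union> K)" by auto
qed

lemma finite_leaves:
  assumes R: "lower R"
  shows "finite (leaves R)"
proof -
  have "leaves R \<subseteq> prisms 0 \<union> (\<Union>Q\<in>R. children Q)"
  proof
    fix L assume L: "L \<in> leaves R"
    obtain n where n: "L \<in> prisms n" using leavesD(1)[OF L] by (rule nodesE)
    show "L \<in> prisms 0 \<union> (\<Union>Q\<in>R. children Q)"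
    proof (cases n)
      case 0
      then show ?thesis using n by simp
    next
      case (Suc m)
      obtain P where "P \<in> prisms m" "below L P" "P \<in> R" using parent[OF L] n Suc by blast
      then show ?thesis using n Suc children_prisms[of P m] by blast
    qed
  qed
  moreover have "finite (children Q)" if QR: "Q \<in> R" for Q
  proof -
    obtain n where n: "Q \<in> prisms n" using lower_nodes[OF R QR] by (rule nodesE)
    have "children Q \<subseteq> prisms (Suc n)" using children_prisms[OF n] by blast
    then show ?thesis using finite_N finite_subset by blast
  qed
  moreover have "finite R" using R by (simp add: lower_def)
  ultimately show ?thesis using finite_N finite_subset by blast
qed

lemma leaves_cover:
  assumes R: "lower R" and x: "s \<in> {0..T}" "x \<in> closure \<Omega>"
  obtains I S where "(I, S) \<in> leaves R" "s \<in> I" "x \<in> pts S"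
proof -
  obtain I where I: "I \<in> \<I>\<^sub>0" "s \<in> I" using cover_initial_intervals x(1) by blast
  have "x \<in> (\<Union>S\<in>uniform 0. pts S)" using x(2) by (simp only: cover_uniform)
  then obtain S where S: "S \<in> uniform 0" "x \<in> pts S" by blast
  have IS: "(I, S) \<in> prisms 0" using I(1) S(1) by (simp add: prisms_def)
  show ?thesis
  proof (cases "(I, S) \<in> R")
    case False
    then obtain L where "L \<in> leaves R" "below (I, S) L" using leaf_above nodesI[OF IS] by blast
    then show ?thesis using that[of "fst L" "snd L"] I S by (auto simp: below_def)
  next
    case True
    obtain L k where "L \<in> leaves R" "L \<in> prisms k" "0 < k" "below L (I, S)" "s \<in> fst L \<and> x \<in> pts (snd L)"
    proof (rule leaf_descend[OF R IS True, of "\<lambda>Q. s \<in> fst Q \<and> x \<in> pts (snd Q)"])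
      show "s \<in> fst (I, S) \<and> x \<in> pts (snd (I, S))" using I S by simp
      fix Q k assume Q: "Q \<in> prisms k" "s \<in> fst Q \<and> x \<in> pts (snd Q)"
      then obtain C where "C \<in> bisect (snd Q)" "x \<in> pts C" using simp.child_ex[OF prismsD(2)[OF Q(1)]] by blast
      then show "\<exists>D\<in>prisms (Suc k). below D Q \<and> s \<in> fst D \<and> x \<in> pts (snd D)"
        using prism_child[OF Q(1), of s C] Q(2) by fastforce
    qed
    then show ?thesis using that[of "fst L" "snd L"] by simp
  qed
qed

lemma partition_leaves:
  assumes R: "lower R"
  shows "space_time_partition T \<Omega> (leaves R)"
proof -
  have node: "\<exists>n. (I, S) \<in> prisms n" if "(I, S) \<in> leaves R" for I S
    using leavesD(1)[OF that] by (auto simp: nodes_def)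
  have ivl: "is_interval I \<and> I \<subseteq> {0..T}" if IS: "(I, S) \<in> prisms n" for I S n
  proof -
    have "I \<in> intervals (time_level n)" using prismsD(1)[OF IS] by simp
    then obtain a b where ab: "0 \<le> a" "a < b" "b \<le> T" "I = iv T a b" by (rule interval_form)
    show ?thesis unfolding ab(4) using iv_simps(7,9)[OF ab(2), of T] ab(1,3) by auto
  qed
  have nonover: "nonoverlapping (I \<times> pts S) (I' \<times> pts S')"
    if L: "(I, S) \<in> leaves R" "(I', S') \<in> leaves R" "(I, S) \<noteq> (I', S')"
      and n: "(I, S) \<in> prisms n" "(I', S') \<in> prisms k" "k \<le> n" for I S I' S' n k
  proof (rule ccontr)
    assume "\<not> ?thesis"
    then have ne: "interior I \<inter> interior I' \<noteq> {}" "interior (pts S) \<inter> interior (pts S') \<noteq> {}"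
      unfolding nonoverlapping_def interior_Times Times_Int_Times by auto
    have "I \<inter> I' \<noteq> {}" using ne(1) interior_subset by blast
    then have "I \<subseteq> I'" using time_nested[OF n] by simp
    moreover have "interior (pts S \<inter> pts S') \<noteq> {}" using ne(2) by simp
    then have "aff_dim (pts S \<inter> pts S') = int DIM('a)" by (rule aff_dim_nonempty_interior)
    then have "pts S \<subseteq> pts S'" using space_nested[OF n] by simp
    ultimately show False using leaf_antichain[OF L(1,2)] L(3) by (simp add: below_def)
  qed
  have cov: "(\<Union>(I, S)\<in>leaves R. I \<times> pts S) = {0..T} \<times> closure \<Omega>"
  proof
    show "(\<Union>(I, S)\<in>leaves R. I \<times> pts S) \<subseteq> {0..T} \<times> closure \<Omega>"
    proof clarify
      fix I S s x assume L: "(I, S) \<in> leaves R" "s \<in> I" "x \<in> pts S"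
      obtain n where n: "(I, S) \<in> prisms n" using node[OF L(1)] by blast
      have "pts S \<subseteq> closure \<Omega>" unfolding cover_uniform[of n, symmetric] using prismsD(2)[OF n] by auto
      then show "s \<in> {0..T} \<and> x \<in> closure \<Omega>" using ivl[OF n] L by blast
    qed
    show "{0..T} \<times> closure \<Omega> \<subseteq> (\<Union>(I, S)\<in>leaves R. I \<times> pts S)"
    proof clarify
      fix s x assume "s \<in> {0..T}" "x \<in> closure \<Omega>"
      then obtain I S where "(I, S) \<in> leaves R" "s \<in> I" "x \<in> pts S" using leaves_cover[OF R] by blast
      then show "(s, x) \<in> (\<Union>(I, S)\<in>leaves R. I \<times> pts S)" by blast
    qed
  qed
  have no: "nonoverlapping (I \<times> pts S) (I' \<times> pts S')"
    if L: "(I, S) \<in> leaves R" "(I', S') \<in> leaves R" "(I, S) \<noteq> (I', S')" for I S I' S'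
  proof -
    obtain n k where nk: "(I, S) \<in> prisms n" "(I', S') \<in> prisms k" using node L by blast
    show ?thesis
    proof (cases "k \<le> n")
      case False
      then show ?thesis using nonover[OF L(2,1) L(3)[symmetric] nk(2,1)] by (simp add: nonoverlapping_def Int_commute)
    qed (use nonover[OF L nk] in simp)
  qed
  have form: "is_interval I \<and> I \<subseteq> {0..T} \<and> tagged_simplex S" if L: "(I, S) \<in> leaves R" for I S
  proof -
    obtain n where n: "(I, S) \<in> prisms n" using node[OF L] by blast
    then show ?thesis using ivl[OF n] tagged_uniform[OF prismsD(2)[OF n]] by simp
  qed
  show ?thesis
    unfolding space_time_partition_def
  proof (intro conjI)
    show "\<forall>(I, S)\<in>leaves R. is_interval I \<and> I \<subseteq> {0..T} \<and> tagged_simplex S" using form by blast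
    show "\<forall>(I, S)\<in>leaves R. \<forall>(I', S')\<in>leaves R. (I, S) \<noteq> (I', S') \<longrightarrow> nonoverlapping (I \<times> pts S) (I' \<times> pts S')"
      using no by blast
  qed (fact finite_leaves[OF R] cov)+
qed

end

section \<open>Admissible partitions and neighbourhoods\<close>

lemma conforming_vertex:
  fixes S S' :: "'a::euclidean_space tsimplex"
  assumes "tagged_simplex S" "tagged_simplex S'" and c: "conforming \<T>" "S \<in> \<T>" "S' \<in> \<T>"
    and v: "v \<in> vset S" "v \<in> pts S'"
  shows "v \<in> vset S'"
proof -
  have vS: "v \<in> pts S" using v(1) by (simp add: pts_def hull_inc)
  have ext: "v extreme_point_of pts S"
    using extreme_point_of_convex_hull_affine_independent[OF independent_vset[OF assms(1)]] v(1) by (simp add: pts_def)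
  have "pts S = pts S' \<or> (pts S \<inter> pts S') face_of pts S \<and> (pts S \<inter> pts S') face_of pts S'"
    using c vS v(2) unfolding conforming_def by blast
  then have "v extreme_point_of pts S'"
  proof
    assume "pts S = pts S'"
    then show ?thesis using ext by simp
  next
    assume f: "(pts S \<inter> pts S') face_of pts S \<and> (pts S \<inter> pts S') face_of pts S'"
    then have "v extreme_point_of (pts S \<inter> pts S')" using extreme_point_of_face ext vS v(2) by blast
    then show ?thesis using extreme_point_of_face f by blast
  qed
  then show ?thesis unfolding pts_def by (rule extreme_point_of_convex_hull)
qed

lemma edge_ends_eq_vset:
  fixes S :: "'a::euclidean_space tsimplex"
  assumes "tagged_simplex S" "DIM('a) = 1"
  shows "edge_ends S = vset S"
proof (rule card_subset_eq)
  show "edge_ends S \<subseteq> vset S" using edge_ends_subset[OF assms(1)] .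
  show "card (edge_ends S) = card (vset S)"
    using edge_ends_distinct[OF assms(1)] card_vset[OF assms(1)] assms(2) by (simp add: edge_ends_def)
qed simp

context space_time
begin

lemma lower_above:
  assumes "lower R" "Q \<in> R" "A \<in> prisms n" "below Q A"
  shows "A \<in> R"
  using lowerD[OF assms(1,2) nodesI[OF assms(3)] assms(4)] .

lemma dep_closed_lower: "dep_closed R \<Longrightarrow> lower R"
  by (simp add: dep_closed_def)

lemma dep_closed_patch: "dep_closed R \<Longrightarrow> Q \<in> R \<Longrightarrow> Q' \<in> patch Q \<Longrightarrow> Q' \<in> R"
  by (auto simp: dep_closed_def)

lemma leaf_meets_fine:
  assumes R: "dep_closed R" and L: "(I1, S1) \<in> leaves R" "(I1, S1) \<in> prisms k" "s \<in> I1" and "k \<le> n"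
    and Q: "(J, S2) \<in> prisms n" "s \<in> J" "\<And>A. A \<in> nodes \<Longrightarrow> below (J, S2) A \<Longrightarrow> A \<noteq> (J, S2) \<Longrightarrow> A \<in> R"
  shows "meet_in_face (vset S1) (vset S2)"
  using \<open>k \<le> n\<close> Q
proof (induction n arbitrary: J S2 rule: dec_induct)
  case base
  then show ?case using meet_uniform prismsD(2)[OF L(2)] prismsD(2)[OF base(1)] by simp
next
  case (step n)
  obtain P where P: "P \<in> prisms n" "below (J, S2) P" using prism_ancestor[OF step.prems(1), of n] by auto
  have PR: "P \<in> R"
  proof (rule step.prems(3)[OF nodesI[OF P(1)] P(2)])
    show "P \<noteq> (J, S2)" using prism_level_unique[OF P(1), of "Suc n"] step.prems(1) by auto
  qed
  define J' p where "J' = fst P" and "p = snd P"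
  have Pe: "P = (J', p)" by (simp add: J'_def p_def)
  have JJ': "J \<subseteq> J'" "pts S2 \<subseteq> pts p" using P(2) by (auto simp: below_def Pe)
  have sJ': "s \<in> J'" using step.prems(2) JJ' by blast
  have notR: "(I1, S1) \<notin> R" using leavesD(2)[OF L(1)] .
  have IH: "meet_in_face (vset S1) (vset p)"
  proof (rule step.IH)
    show "(J', p) \<in> prisms n" using P(1) Pe by simp
    show "A \<in> R" if "A \<in> nodes" "below (J', p) A" "A \<noteq> (J', p)" for A
      using lowerD[OF dep_closed_lower[OF R] PR that(1)] that(2) Pe by simp
  qed fact
  have up: "p \<in> uniform n" using prismsD(2)[OF P(1)] by (simp add: p_def)
  have uS1: "S1 \<in> uniform k" using prismsD(2)[OF L(2)] by simp
  have uS2: "S2 \<in> uniform (Suc n)" using prismsD(2)[OF step.prems(1)] by simp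
  have S2: "S2 \<in> bisect p" using simp.children_eq[OF up] uS2 JJ'(2) by blast
  have "fst (J', p) \<subseteq> fst (I1, S1)"
    by (rule time_nested[OF _ L(2) step.hyps(1)]) (use P(1) Pe sJ' L(3) in auto)
  then have J'I1: "J' \<subseteq> I1" by simp
  have "\<not> edge_ends p \<subseteq> vset S1"
  proof
    assume edge_ends: "edge_ends p \<subseteq> vset S1"
    show False
    proof (cases "DIM('a) = 1")
      case True
      then have "vset p \<subseteq> vset S1" using edge_ends edge_ends_eq_vset[OF tagged_uniform[OF up]] by simp
      then have "below P (I1, S1)" using J'I1 by (simp add: below_def Pe pts_def hull_mono)
      then show False using lower_above[OF dep_closed_lower[OF R] PR L(2)] notR by blast
    next
      case False
      then have d: "2 \<le> DIM('a)" using DIM_positive[where 'a='a] by linarith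
      obtain S' where S': "S' \<in> uniform n" "pts S' \<subseteq> pts S1" "edge_ends S' = edge_ends p"
        using patch_member_below[OF d up uS1 step.hyps(1) mid_in_pts[OF edge_ends]] by blast
      have P': "(J', S') \<in> prisms n" using prismsI[OF _ S'(1)] prismsD(1)[OF P(1)] by (simp add: J'_def)
      then have "(J', S') \<in> patch P" using S'(3) unfolding patch_eq[OF P(1)] by (simp add: Pe)
      then have "(J', S') \<in> R" using dep_closed_patch[OF R PR] by blast
      moreover have "below (J', S') (I1, S1)" using J'I1 S'(2) by (simp add: below_def)
      ultimately show False using lower_above[OF dep_closed_lower[OF R] _ L(2)] notR by blast
    qed
  qed
  moreover obtain a b where ab: "edge_ends p = {a, b}" "a \<noteq> b" "vset S2 = half a b (vset p)" "hd (verts S2) = a"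
    "a \<in> vset p" "b \<in> vset p"
    by (rule vset_bisect[OF tagged_uniform[OF up] S2])
  ultimately have "meet_in_face (half a b (vset p)) (vset S1)"
    by (intro meet_in_face_half(1)[OF independent_uniform[OF up] ab(5,6,2) meet_in_face_sym[OF IH]]) auto
  then show ?case using ab(3) meet_in_face_sym by simp
qed

lemma dep_closed_conforming:
  assumes R: "dep_closed R"
  shows "conforming_in_space T (leaves R)"
  unfolding conforming_in_space_def conforming_def
proof (intro ballI)
  fix s S S' assume "s \<in> {0..T}" "S \<in> active s (leaves R)" "S' \<in> active s (leaves R)"
  then obtain I I' where L: "(I, S) \<in> leaves R" "s \<in> I" "(I', S') \<in> leaves R" "s \<in> I'"
    by (auto simp: active_def)
  obtain n where n: "(I, S) \<in> prisms n" using leavesD(1)[OF L(1)] by (rule nodesE)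
  obtain k where k: "(I', S') \<in> prisms k" using leavesD(1)[OF L(3)] by (rule nodesE)
  have "meet_in_face (vset S) (vset S')"
  proof (cases "n \<le> k")
    case True
    show ?thesis by (rule leaf_meets_fine[OF R L(1) n L(2) True k L(4) leavesD(3)[OF L(3)]])
  next
    case False
    then have "k \<le> n" by simp
    from leaf_meets_fine[OF R L(3) k L(4) this n L(2) leavesD(3)[OF L(1)]] show ?thesis
      by (rule meet_in_face_sym)
  qed
  then have "(pts S \<inter> pts S') face_of pts S" "(pts S \<inter> pts S') face_of pts S'"
    unfolding pts_def using prismsD(2)[OF n] prismsD(2)[OF k] independent_uniform
    by (auto intro!: meet_in_face_faces)
  then show "pts S = pts S' \<or> pts S \<inter> pts S' = {} \<or> (pts S \<inter> pts S') face_of pts S \<and> (pts S \<inter> pts S') face_of pts S'"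
    by blast
qed

lemma conforming_patch:
  assumes R: "lower R" and conf: "conforming_in_space T (leaves R)" and Q: "Q \<in> R"
  shows "patch Q \<subseteq> R"
proof
  fix Q' assume Q': "Q' \<in> patch Q"
  obtain n where n: "Q \<in> prisms n" using lower_nodes[OF R Q] by (rule nodesE)
  have n': "Q' \<in> prisms n" "fst Q' = fst Q" "edge_ends (snd Q') = edge_ends (snd Q)" using Q' by (simp_all add: patch_eq[OF n])
  show "Q' \<in> R"
  proof (rule ccontr)
    assume "Q' \<notin> R"
    then obtain L where L: "L \<in> leaves R" "below Q' L" using leaf_above[OF nodesI[OF n'(1)]] by blast
    obtain k where k: "L \<in> prisms k" using leavesD(1)[OF L(1)] by (rule nodesE)
    have kn: "k \<le> n" using level_mono[OF n'(1) k L(2)] .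
    obtain s where s: "s \<in> fst Q" using prism_nonempty[OF n] by blast
    have sT: "s \<in> {0..T}"
    proof -
      obtain a b where ab: "0 \<le> a" "a < b" "b \<le> T" "fst Q = iv T a b"
        using prismsD(1)[OF n] by (rule interval_form)
      then show ?thesis using s iv_simps(7)[OF ab(2), of T] by auto
    qed
    define m where "m = mid (snd Q)"
    note tQ = tagged_uniform[OF prismsD(2)[OF n]] and tL = tagged_uniform[OF prismsD(2)[OF k]]
    have "m = mid (snd Q')" unfolding m_def using mid_eq n'(3) edge_ends_def by metis
    then have "m \<in> pts (snd Q')" using mid_in_pts[OF edge_ends_subset[OF tagged_uniform[OF prismsD(2)[OF n'(1)]]]] by simp
    then have mL: "m \<in> pts (snd L)" using L(2) by (auto simp: below_def)
    define Pr where "Pr = (\<lambda>X. s \<in> fst X \<and> (X = Q \<or> m \<in> vset (snd X)))"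
    obtain L2 j where L2: "L2 \<in> leaves R" "L2 \<in> prisms j" "n < j" "below L2 Q" "Pr L2"
    proof (rule leaf_descend[OF R n Q, of Pr])
      show "Pr Q" using s by (simp add: Pr_def)
      fix C i assume C: "C \<in> prisms i" "Pr C"
      have sC: "s \<in> fst C" using C(2) by (simp add: Pr_def)
      have "\<exists>D\<in>bisect (snd C). m \<in> vset D"
      proof (cases "C = Q")
        case True
        obtain D where "D \<in> bisect (snd C)" using bisect_ex[OF C(1)] .
        then show ?thesis using mid_child[OF tQ] True m_def by blast
      next
        case False
        then have "m \<in> vset (snd C)" using C(2) by (simp add: Pr_def)
        then show ?thesis using vertex_child[OF tagged_uniform[OF prismsD(2)[OF C(1)]]] by blast
      qed
      then obtain D where D: "D \<in> bisect (snd C)" "m \<in> vset D" by blast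
      obtain J where "(J, D) \<in> prisms (Suc i)" "s \<in> J" "below (J, D) C" using prism_child[OF C(1) sC D(1)] by blast
      then show "\<exists>D\<in>prisms (Suc i). below D C \<and> Pr D" using D(2) by (intro bexI[of _ "(J, D)"]) (auto simp: Pr_def)
    qed
    have "L2 \<noteq> Q" using prism_level_unique[OF n, of j] L2(2,3) by auto
    then have mL2: "m \<in> vset (snd L2)" using L2(5) by (simp add: Pr_def)
    have "snd L2 \<in> active s (leaves R)" using L2(1,5) by (auto simp: active_def Pr_def intro!: exI[of _ "fst L2"])
    moreover have "s \<in> fst L" using s n'(2) L(2) by (auto simp: below_def)
    then have "snd L \<in> active s (leaves R)" using L(1) by (auto simp: active_def intro!: exI[of _ "fst L"])
    ultimately have "m \<in> vset (snd L)"
      using conforming_vertex[OF tagged_uniform[OF prismsD(2)[OF L2(2)]] tL _ _ _ mL2 mL] conf sT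
      unfolding conforming_in_space_def by blast
    then show False using mid_not_coarse_vertex[OF prismsD(2)[OF n] prismsD(2)[OF k] kn] m_def by blast
  qed
qed

lemma graded_iff:
  assumes R: "lower R"
  shows "graded (leaves R) \<longleftrightarrow> one_irregular_in_time \<T>\<^sub>0 (leaves R) \<and>
    (DIM('a) = 1 \<longrightarrow> one_irregular_in_space \<T>\<^sub>0 (leaves R))"
proof -
  have close: "levels_close \<T>\<^sub>0 Q Q' \<longleftrightarrow> n \<le> k + 1 \<and> k \<le> n + 1" if "Q \<in> prisms n" "Q' \<in> prisms k" for Q Q' n k
    using level_prism[OF that(1)] level_prism[OF that(2)] by (auto simp: levels_close_def)
  have "graded (leaves R) \<longleftrightarrow> (\<forall>Q\<in>leaves R. \<forall>Q'\<in>leaves R. touching Q Q' \<longrightarrow> levels_close \<T>\<^sub>0 Q Q')"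
  proof
    assume g: "graded (leaves R)"
    show "\<forall>Q\<in>leaves R. \<forall>Q'\<in>leaves R. touching Q Q' \<longrightarrow> levels_close \<T>\<^sub>0 Q Q'"
    proof (intro ballI impI)
      fix Q Q' assume L: "Q \<in> leaves R" "Q' \<in> leaves R" "touching Q Q'"
      obtain n where n: "Q \<in> prisms n" using leavesD(1)[OF L(1)] by (rule nodesE)
      obtain k where k: "Q' \<in> prisms k" using leavesD(1)[OF L(2)] by (rule nodesE)
      have "n \<le> k + 1" using g L n k unfolding graded_def by blast
      moreover have "k \<le> n + 1" using g L touching_sym[OF L(3)] n k unfolding graded_def by blast
      ultimately show "levels_close \<T>\<^sub>0 Q Q'" using close[OF n k] by simp
    qed
  next
    assume *: "\<forall>Q\<in>leaves R. \<forall>Q'\<in>leaves R. touching Q Q' \<longrightarrow> levels_close \<T>\<^sub>0 Q Q'"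
    show "graded (leaves R)"
      unfolding graded_def
    proof (intro ballI allI impI)
      fix Q Q' n k assume "Q \<in> leaves R" "Q' \<in> leaves R" "Q \<in> prisms n" "Q' \<in> prisms k" "touching Q Q'"
      then show "n \<le> k + 1" using * close by blast
    qed
  qed
  then show ?thesis unfolding touching_def one_irregular_in_time_def one_irregular_in_space_def by blast
qed

lemma admissible_dep_closed:
  assumes R: "lower R" and "admissible T \<Omega> \<I>\<^sub>0 \<T>\<^sub>0 s1 s2 (leaves R)"
  shows "dep_closed R"
  using assms graded_coarse_deps[OF R] graded_iff[OF R] conforming_patch[OF R]
  unfolding dep_closed_def admissible_def by blast

lemma dep_closed_admissible:
  assumes R: "dep_closed R" and "(atomic_step \<T>\<^sub>0 s1 s2)\<^sup>*\<^sup>* (\<I>\<^sub>0 \<times> \<T>\<^sub>0) (leaves R)"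
  shows "admissible T \<Omega> \<I>\<^sub>0 \<T>\<^sub>0 s1 s2 (leaves R)"
  unfolding admissible_def
  using partition_leaves[OF dep_closed_lower[OF R]] assms(2) dep_closed_conforming[OF R]
    graded_iff[OF dep_closed_lower[OF R]] dep_closed_graded[OF R] by simp

lemma coarse_deps_iff:
  assumes "Q \<in> prisms n" "Q' \<in> prisms k"
  shows "Q' \<in> coarse_deps Q \<longleftrightarrow> touching Q Q' \<and> k + 1 = n"
proof
  assume "Q' \<in> coarse_deps Q"
  then obtain m where "Q \<in> prisms (Suc m)" "Q' \<in> prisms m" "touching Q Q'" by (auto simp: coarse_deps_def)
  then show "touching Q Q' \<and> k + 1 = n"
    using prism_level_unique[OF assms(1), of "Suc m"] prism_level_unique[OF assms(2), of m] by simp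
qed (use assms in \<open>auto simp: coarse_deps_def\<close>)

lemma nbrs_eq:
  assumes R: "lower R" and Q: "Q \<in> leaves R"
  shows "nbrs \<T>\<^sub>0 (leaves R) Q =
    (coarse_deps Q \<inter> leaves R) \<union> {Q' \<in> leaves R - {Q}. \<exists>X\<in>patch Q. below X Q'}"
proof (rule set_eqI)
  fix Q'
  obtain n where n: "Q \<in> prisms n" using leavesD(1)[OF Q] by (rule nodesE)
  show "Q' \<in> nbrs \<T>\<^sub>0 (leaves R) Q \<longleftrightarrow>
    Q' \<in> (coarse_deps Q \<inter> leaves R) \<union> {Q' \<in> leaves R - {Q}. \<exists>X\<in>patch Q. below X Q'}"
  proof (cases "Q' \<in> leaves R \<and> Q' \<noteq> Q")
    case False
    have "Q \<notin> coarse_deps Q" using coarse_deps_iff[OF n n] by simp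
    then show ?thesis using False by (auto simp: nbrs_def nbrs_t_def nbrs_x_def)
  next
    case True
    obtain k where k: "Q' \<in> prisms k" using leavesD(1) True by (blast elim: nodesE)
    have lev: "level \<T>\<^sub>0 Q' + 1 = level \<T>\<^sub>0 Q \<longleftrightarrow> k + 1 = n" using level_prism[OF n] level_prism[OF k] by simp
    show ?thesis
    proof (cases "DIM('a) = 1")
      case d: True
      have "\<not> below X Q'" if X: "X \<in> patch Q" for X
      proof
        assume b: "below X Q'"
        have X': "X \<in> prisms n" "fst X = fst Q" "edge_ends (snd X) = edge_ends (snd Q)" using X by (simp_all add: patch_eq[OF n])
        have "vset (snd X) = vset (snd Q)"
          using X'(3) edge_ends_eq_vset[OF tagged_uniform[OF prismsD(2)[OF X'(1)]] d]
            edge_ends_eq_vset[OF tagged_uniform[OF prismsD(2)[OF n]] d] by simp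
        then have "snd X = snd Q"
          using regularD(3)[OF regular_uniform prismsD(2)[OF X'(1)] prismsD(2)[OF n]] by blast
        then have "X = Q" using X'(2) by (simp add: prod_eq_iff)
        then show False using b leaf_antichain[OF Q] True by blast
      qed
      moreover have "Q' \<in> nbrs \<T>\<^sub>0 (leaves R) Q \<longleftrightarrow> touching Q Q' \<and> k + 1 = n"
        using True d lev by (auto simp: nbrs_def nbrs_t_def nbrs_x_def touching_def)
      ultimately show ?thesis using True coarse_deps_iff[OF n k] by blast
    next
      case False
      then have d: "2 \<le> DIM('a)" using DIM_positive[where 'a='a] by linarith
      note tQ = tagged_uniform[OF prismsD(2)[OF n]]
      have RE: "RE (snd Q) = convex hull (edge_ends (snd Q))"
        using False by (simp add: RE_def edge_ends_def segment_convex_hull)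
      have "overlap_in_time Q Q' \<and> 1 \<le> aff_dim (pts (snd Q) \<inter> pts (snd Q')) \<and>
           aff_dim (pts (snd Q) \<inter> pts (snd Q')) \<le> int DIM('a) - 1 \<and> RE (snd Q) \<subseteq> pts (snd Q')
        \<longleftrightarrow> (\<exists>X\<in>patch Q. below X Q')" (is "?L \<longleftrightarrow> ?R")
      proof
        assume L: ?L
        have "edge_ends (snd Q) \<subseteq> RE (snd Q)" unfolding RE by (rule hull_subset)
        moreover have "mid (snd Q) \<in> RE (snd Q)" unfolding RE edge_ends_def mid_def by (simp flip: segment_convex_hull)
        ultimately have sub: "edge_ends (snd Q) \<subseteq> pts (snd Q')" "mid (snd Q) \<in> pts (snd Q')" using L by auto
        have kn: "k \<le> n" using edge_level[OF prismsD(2)[OF n] prismsD(2)[OF k] sub] .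
        have "fst Q \<subseteq> fst Q'" using time_nested[OF n k kn] overlap_iff[OF n k] L by simp
        moreover obtain S' where S': "S' \<in> uniform n" "pts S' \<subseteq> pts (snd Q')" "edge_ends S' = edge_ends (snd Q)"
          using patch_member_below[OF d prismsD(2)[OF n] prismsD(2)[OF k] kn sub(2)] by blast
        moreover have "(fst Q, S') \<in> patch Q"
          using prismsI[OF prismsD(1)[OF n] S'(1)] S'(3) by (simp add: patch_eq[OF n])
        ultimately show ?R by (intro bexI[of _ "(fst Q, S')"]) (simp_all add: below_def)
      next
        assume ?R
        then obtain X where X: "X \<in> patch Q" "below X Q'" by blast
        have X': "X \<in> prisms n" "fst X = fst Q" "edge_ends (snd X) = edge_ends (snd Q)" using X by (simp_all add: patch_eq[OF n])
        have kn: "k \<le> n" using level_mono[OF X'(1) k X(2)] .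
        have sub: "fst Q \<subseteq> fst Q'" "pts (snd X) \<subseteq> pts (snd Q')" using X(2) X'(2) by (auto simp: below_def)
        have ov: "overlap_in_time Q Q'" using overlap_iff[OF n k] sub(1) prism_nonempty[OF n] by blast
        have "RE (snd Q) \<subseteq> pts (snd X)"
          unfolding RE X'(3)[symmetric] pts_def using edge_ends_subset[OF tagged_uniform[OF prismsD(2)[OF X'(1)]]] by (rule hull_mono)
        then have REs: "RE (snd Q) \<subseteq> pts (snd Q')" using sub(2) by blast
        have "RE (snd Q) \<subseteq> pts (snd Q)" unfolding RE pts_def using edge_ends_subset[OF tQ] by (rule hull_mono)
        then have "edge_ends (snd Q) \<subseteq> pts (snd Q) \<inter> pts (snd Q')" using REs hull_subset[of "edge_ends (snd Q)" convex] unfolding RE by blast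
        then have "aff_dim (edge_ends (snd Q)) \<le> aff_dim (pts (snd Q) \<inter> pts (snd Q'))" by (rule aff_dim_subset)
        moreover have "aff_dim (edge_ends (snd Q)) = 1" using edge_ends_distinct[OF tQ] by (simp add: edge_ends_def aff_dim_2)
        moreover have "aff_dim (pts (snd Q) \<inter> pts (snd Q')) \<noteq> int DIM('a)"
        proof
          assume "aff_dim (pts (snd Q) \<inter> pts (snd Q')) = int DIM('a)"
          then have "below Q Q'" using space_nested[OF n k kn] sub(1) by (simp add: below_def)
          then show False using leaf_antichain[OF Q] True by blast
        qed
        moreover have "aff_dim (pts (snd Q) \<inter> pts (snd Q')) \<le> int DIM('a)" by (rule aff_dim_le_DIM)
        ultimately show ?L using ov REs by simp
      qed
      then have "Q' \<in> nbrs_x \<T>\<^sub>0 (leaves R) Q \<longleftrightarrow> (\<exists>X\<in>patch Q. below X Q')"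
        using True False unfolding nbrs_x_def by simp
      moreover have "Q' \<in> nbrs_t \<T>\<^sub>0 (leaves R) Q \<longleftrightarrow> Q' \<in> coarse_deps Q"
        using True False lev coarse_deps_iff[OF n k] unfolding nbrs_t_def touching_def by auto
      ultimately show ?thesis using True unfolding nbrs_def by blast
    qed
  qed
qed

lemma near_neighbour:
  assumes R: "dep_closed R" and Q: "Q \<in> leaves R" "Q \<in> prisms n"
    and Q': "Q' \<in> leaves R" "Q' \<in> prisms k" "k < n" "X \<in> patch Q" "below X Q'"
  obtains L m where "L \<in> leaves R" "L \<in> prisms m" "Suc m = n" "L \<in> nbrs \<T>\<^sub>0 (leaves R) Q"
proof -
  note result = that
  note lowR = dep_closed_lower[OF R]
  have X: "X \<in> prisms n" "fst X = fst Q" "edge_ends (snd X) = edge_ends (snd Q)" using Q'(4) by (simp_all add: patch_eq[OF Q(2)])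
  have patchI: "(fst Q, W) \<in> patch Q" if "W \<in> uniform n" "edge_ends W = edge_ends (snd Q)" for W
    using prismsI[OF prismsD(1)[OF Q(2)] that(1)] that(2) by (simp add: patch_eq[OF Q(2)])
  have patch_notin: "Y \<notin> R" if "Y \<in> patch Q" for Y
    using dep_closed_patch[OF R, of Y Q] patch_mates_eq[OF Q(2) that] patch_mates_self[OF Q(2)] leavesD(2)[OF Q(1)] by blast
  show ?thesis
  proof (cases "DIM('a) = 1")
    case True
    have "vset (snd X) = vset (snd Q)"
      using X(3) edge_ends_eq_vset[OF tagged_uniform[OF prismsD(2)[OF X(1)]] True]
        edge_ends_eq_vset[OF tagged_uniform[OF prismsD(2)[OF Q(2)]] True] by simp
    then have "snd X = snd Q"
      using regularD(3)[OF regular_uniform prismsD(2)[OF X(1)] prismsD(2)[OF Q(2)]] by blast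
    then have "X = Q" using X(2) by (simp add: prod_eq_iff)
    then have "Q' = Q" using leaf_antichain[OF Q(1) Q'(1)] Q'(5) by simp
    then have "k = n" using prism_level_unique[OF Q'(2)] Q(2) by blast
    then show ?thesis using Q'(3) by simp
  next
    case False
    then have d: "2 \<le> DIM('a)" using DIM_positive[where 'a='a] by linarith
    show ?thesis
    proof (rule ccontr)
      assume no: "\<not> thesis"
      have none: False if L: "L \<in> leaves R" "L \<in> prisms m" "Suc m = n" "Y \<in> patch Q" "below Y L" for L m Y
      proof -
        have "L \<noteq> Q" using prism_level_unique[OF L(2), of n] Q(2) L(3) by auto
        then have "L \<in> nbrs \<T>\<^sub>0 (leaves R) Q" using nbrs_eq[OF lowR Q(1)] L by blast
        then show False using result[OF L(1-3)] no by blast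
      qed
      have "(fst Q, snd X) \<in> leaves R"
      proof (rule patch_induct[OF d prismsD(2)[OF Q(2)] prismsD(2)[OF X(1)] X(3), where Pr = "\<lambda>W. (fst Q, W) \<in> leaves R"])
        show "(fst Q, snd Q) \<in> leaves R" using Q(1) by simp
        fix W W' assume W: "W \<in> uniform n" "W' \<in> uniform n" "edge_ends W = edge_ends (snd Q)" "edge_ends W' = edge_ends (snd Q)"
          and WL: "(fst Q, W) \<in> leaves R" and c: "card (vset W \<inter> vset W') = DIM('a)"
        let ?A = "(fst Q, W)" and ?B = "(fst Q, W')"
        have AB: "?A \<in> prisms n" "?B \<in> prisms n" using prismsI[OF prismsD(1)[OF Q(2)]] W(1,2) by auto
        have Bp: "?B \<in> patch Q" using patchI W(2,4) by blast
        obtain L where L: "L \<in> leaves R" "below ?B L" using leaf_above[OF nodesI[OF AB(2)] patch_notin[OF Bp]] by blast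
        obtain j where j: "L \<in> prisms j" using leavesD(1)[OF L(1)] by (rule nodesE)
        have jn: "j \<le> n" using level_mono[OF AB(2) j L(2)] .
        have Sj: "Suc j \<noteq> n" using none[OF L(1) j _ Bp L(2)] by blast
        show "?B \<in> leaves R"
        proof (cases "j = n")
          case True
          then have "L = ?B" using anc_same_level[OF AB(2) _ L(2)] j by simp
          then show ?thesis using L(1) by simp
        next
          case False
          then have "n = Suc (Suc (n - 2))" "j \<le> n - 2" using jn Sj by arith+
          then obtain m where m: "n = Suc (Suc m)" "j \<le> m" by blast
          have notR: "Y \<notin> R" if "Y \<in> prisms i" "below ?B Y" "j \<le> i" for Y i
            using lower_above[OF lowR _ j] anc_chain[OF AB(2) that(1) j that(2) L(2) that(3)] leavesD(2)[OF L(1)] by blast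
          obtain p1 where p1: "p1 \<in> prisms (Suc m)" "below ?A p1" using prism_ancestor[OF AB(1), of "Suc m"] m(1) by auto
          obtain p2 where p2: "p2 \<in> prisms m" "below p1 p2" using prism_ancestor[OF p1(1), of m] by auto
          obtain q1 where q1: "q1 \<in> uniform (Suc m)" "pts W' \<subseteq> pts q1" using simp.ancestor_ex[OF W(2), of "Suc m"] m(1) by auto
          obtain q2 where q2: "q2 \<in> uniform m" "pts q1 \<subseteq> pts q2" using simp.ancestor_ex[OF q1(1), of m] by auto
          have pR: "p1 \<in> R" "p2 \<in> R"
          proof -
            have "p1 \<noteq> ?A" using prism_level_unique[OF p1(1), of n] AB(1) m(1) by auto
            then show "p1 \<in> R" using leavesD(3)[OF WL nodesI[OF p1(1)] p1(2)] by blast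
            then show "p2 \<in> R" using lower_above[OF lowR _ p2] by blast
          qed
          have Q1: "(fst p1, q1) \<in> prisms (Suc m)" "below ?B (fst p1, q1)"
            using prismsI[OF prismsD(1)[OF p1(1)] q1(1)] p1(2) q1(2) by (auto simp: below_def)
          have Q2: "(fst p2, q2) \<in> prisms m" "below ?B (fst p2, q2)"
            using prismsI[OF prismsD(1)[OF p2(1)] q2(1)] p1(2) p2(2) q1(2) q2(2) by (auto simp: below_def)
          have "edge_ends (snd p1) = edge_ends q1 \<or> edge_ends (snd p2) = edge_ends q2"
          proof (rule neighbour_ancestors[OF d])
            show "W \<in> uniform (Suc (Suc m))" "W' \<in> uniform (Suc (Suc m))" using W(1,2) m(1) by auto
            show "snd p1 \<in> uniform (Suc m)" "snd p2 \<in> uniform m" using prismsD(2) p1(1) p2(1) by auto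
            show "pts W \<subseteq> pts (snd p1)" "pts (snd p1) \<subseteq> pts (snd p2)" using p1(2) p2(2) by (auto simp: below_def)
          qed fact+
          then show ?thesis
          proof
            assume "edge_ends (snd p1) = edge_ends q1"
            then have "(fst p1, q1) \<in> patch p1" using Q1(1) by (simp add: patch_eq[OF p1(1)])
            then have "(fst p1, q1) \<in> R" using dep_closed_patch[OF R pR(1)] by blast
            then show ?thesis using notR[OF Q1] m(2) by simp
          next
            assume "edge_ends (snd p2) = edge_ends q2"
            then have "(fst p2, q2) \<in> patch p2" using Q2(1) by (simp add: patch_eq[OF p2(1)])
            then have "(fst p2, q2) \<in> R" using dep_closed_patch[OF R pR(2)] by blast
            then show ?thesis using notR[OF Q2] m(2) by simp
          qed
        qed
      qed
      then have "X \<in> leaves R" unfolding X(2)[symmetric] by simp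
      then have "Q' = X" using leaf_antichain[OF _ Q'(1,5)] by blast
      then have "k = n" using prism_level_unique[OF Q'(2)] X(1) by blast
      then show False using Q'(3) by simp
    qed
  qed
qed

end

section \<open>Patch refinement\<close>

context space_time
begin

text \<open>\<^term>\<open>good \<Phi> cf\<close>: every execution from \<^term>\<open>cf\<close> is finite, and its result satisfies \<^term>\<open>\<Phi>\<close>.\<close>

inductive good :: "('a prism set \<Rightarrow> nat \<Rightarrow> bool) \<Rightarrow> 'a config \<Rightarrow> bool" for \<Phi> where
  goodI: "(\<And>cf'. patch_step \<T>\<^sub>0 s1 s2 cf cf' \<Longrightarrow> good \<Phi> cf') \<Longrightarrow>
    (\<And>P n. cf = Returned P n \<Longrightarrow> \<Phi> P n) \<Longrightarrow> good \<Phi> cf"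

lemma good_no_infinite_run:
  assumes "good \<Phi> cf"
  shows "\<not> (\<exists>f. f 0 = cf \<and> (\<forall>i::nat. patch_step \<T>\<^sub>0 s1 s2 (f i) (f (Suc i))))"
  using assms
proof induction
  case (goodI cf)
  show ?case
  proof
    assume "\<exists>f. f 0 = cf \<and> (\<forall>i::nat. patch_step \<T>\<^sub>0 s1 s2 (f i) (f (Suc i)))"
    then obtain f where f: "f 0 = cf" "\<And>i. patch_step \<T>\<^sub>0 s1 s2 (f i) (f (Suc i))" by blast
    have "patch_step \<T>\<^sub>0 s1 s2 cf (f (Suc 0))" using f(2)[of 0] f(1) by simp
    moreover have "\<exists>g. g 0 = f (Suc 0) \<and> (\<forall>i. patch_step \<T>\<^sub>0 s1 s2 (g i) (g (Suc i)))"
      using f(2) by (intro exI[of _ "\<lambda>i. f (Suc i)"]) simp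
    ultimately show False using goodI.IH by blast
  qed
qed

lemma good_returns:
  assumes "good \<Phi> cf"
  shows "\<exists>P n. (patch_step \<T>\<^sub>0 s1 s2)\<^sup>*\<^sup>* cf (Returned P n)"
  using assms
proof induction
  case (goodI cf)
  show ?case
  proof (cases cf)
    case (Running P c fr st)
    obtain K F Fn D where "fr = (K, F, Fn, D)" by (cases fr)
    then obtain cf' where cf': "patch_step \<T>\<^sub>0 s1 s2 cf cf'" using patch_step_progress Running by blast
    then obtain P n where "(patch_step \<T>\<^sub>0 s1 s2)\<^sup>*\<^sup>* cf' (Returned P n)" using goodI.IH by blast
    with cf' have "(patch_step \<T>\<^sub>0 s1 s2)\<^sup>*\<^sup>* cf (Returned P n)" by (rule converse_rtranclp_into_rtranclp)
    then show ?thesis by blast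
  next
    case (Returned P n)
    then show ?thesis by blast
  qed
qed

lemma good_result:
  assumes "good \<Phi> cf" "(patch_step \<T>\<^sub>0 s1 s2)\<^sup>*\<^sup>* cf (Returned P n)"
  shows "\<Phi> P n"
  using assms
proof induction
  case (goodI cf)
  from goodI.prems show ?case
  proof (cases rule: converse_rtranclpE)
    case base
    then show ?thesis using goodI.hyps by blast
  next
    case (step cf')
    then show ?thesis using goodI.IH by blast
  qed
qed

fun resume :: "('a frame \<times> 'a prism set \<times> 'a prism \<times> 'a prism) list \<Rightarrow> 'a prism set \<Rightarrow> nat \<Rightarrow> 'a config" where
  "resume [] P c = Returned P c"
| "resume (((K, F, Fnew, D), Pold, Q', Q'') # st) P c =
    Running P c (K, F, Fnew \<union> (if Q'' \<in> nbrs_x \<T>\<^sub>0 Pold Q' then atomic_split \<T>\<^sub>0 s1 s2 Q'' \<inter> nbrs \<T>\<^sub>0 P Q' else {}), D) st"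

lemma candidates_subset: "candidates \<T>\<^sub>0 X \<subseteq> X"
  by (auto simp: candidates_def Let_def)

lemma patch_step_RunningE:
  assumes "patch_step \<T>\<^sub>0 s1 s2 (Running P c (K, F, Fn, D) st) cf'"
  obtains (same) Q' Q'' where "(Q', Q'') \<in> candidates \<T>\<^sub>0 (pending \<T>\<^sub>0 P K F D)" "level \<T>\<^sub>0 Q'' = level \<T>\<^sub>0 Q'"
      "cf' = Running P c (K, F, insert Q'' Fn, insert (Q', Q'') D) st"
    | (recursive) Q' Q'' where "(Q', Q'') \<in> candidates \<T>\<^sub>0 (pending \<T>\<^sub>0 P K F D)" "level \<T>\<^sub>0 Q'' \<noteq> level \<T>\<^sub>0 Q'"
      "cf' = Running P c ({}, {Q''}, {}, {}) (((K, F, Fn, insert (Q', Q'') D), P, Q', Q'') # st)"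
    | (round) "F \<noteq> {}" "pending \<T>\<^sub>0 P K F D = {}" "cf' = Running P c (K \<union> F, Fn, {}, {}) st"
    | (return) "F = {}" "cf' = resume st (refine_all \<T>\<^sub>0 s1 s2 P K) (c + card K)"
  using assms by (cases rule: patch_step.cases) auto

lemma lower_steps:
  assumes "lower R" "lower R'" "R \<subseteq> R'"
  shows "(atomic_step \<T>\<^sub>0 s1 s2 ^^ card (R' - R)) (leaves R) (leaves R')"
  using assms
proof (induction "card (R' - R)" arbitrary: R)
  case 0
  have "finite (R' - R)" using 0 by (simp add: lower_def)
  then have "R' = R" using 0 by auto
  then show ?case by simp
next
  case (Suc n)
  obtain X where X: "X \<in> R' - R" using Suc.hyps(2) by (metis card.empty ex_in_conv nat.distinct(1))
  have "X \<in> nodes" using lower_nodes[OF Suc.prems(2)] X by blast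
  then obtain L where L: "L \<in> leaves R" "below X L" using leaf_above X by blast
  have LR': "L \<in> R'" using lowerD[OF Suc.prems(2) _ leavesD(1)[OF L(1)] L(2)] X by blast
  have "R' - R = insert L (R' - insert L R)" "L \<notin> R' - insert L R" using LR' leavesD(2)[OF L(1)] by auto
  moreover have "finite (R' - insert L R)" using Suc.prems(2) by (simp add: lower_def)
  ultimately have c: "card (R' - R) = Suc (card (R' - insert L R))" by (metis card_insert_disjoint)
  then have "(atomic_step \<T>\<^sub>0 s1 s2 ^^ card (R' - insert L R)) (leaves (insert L R)) (leaves R')"
    using Suc.hyps(1)[of "insert L R"] Suc.hyps(2) lower_insert[OF Suc.prems(1) L(1)] Suc.prems LR' by simp
  moreover have "atomic_step \<T>\<^sub>0 s1 s2 (leaves R) (leaves (insert L R))"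
    using atomic_step_leaves[OF Suc.prems(1)] L(1) by blast
  ultimately show ?case unfolding c by (rule relpowp_Suc_I2[rotated])
qed

definition refined :: "'a prism set \<Rightarrow> 'a prism \<Rightarrow> 'a prism set \<Rightarrow> bool" where
  "refined R Q R1 \<longleftrightarrow> dep_closed R1 \<and> R \<subseteq> R1 \<and> Q \<in> R1 \<and>
    (\<forall>R''. dep_closed R'' \<longrightarrow> R \<subseteq> R'' \<longrightarrow> Q \<in> R'' \<longrightarrow> R1 \<subseteq> R'') \<and>
    (\<forall>n. Q \<in> prisms n \<longrightarrow> (\<forall>X\<in>R1 - R. \<forall>k. X \<in> prisms k \<longrightarrow> k \<le> n))"

lemma leaf_persists:
  assumes "L \<in> leaves R" "R \<subseteq> R1" "L \<notin> R1"
  shows "L \<in> leaves R1"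
  using assms by (auto simp: leaves_def)

text \<open>The invariant of a call for \<open>Q0\<close>, of level \<open>l\<close>, started in the partition \<open>leaves R0\<close>: the
  variables \<open>K\<close>, \<open>F\<close>, \<open>Fn\<close> collect the patch of \<open>Q0\<close>, and recursive calls have refined only
  prisms of lower level whose refinement is forced.\<close>

definition call_inv ::
  "'a prism set \<Rightarrow> 'a prism \<Rightarrow> nat \<Rightarrow> nat \<Rightarrow> 'a prism set \<Rightarrow> 'a prism set \<Rightarrow> 'a prism set \<Rightarrow> 'a prism set \<Rightarrow>
   ('a prism \<times> 'a prism) set \<Rightarrow> nat \<Rightarrow> bool" where
  "call_inv R0 Q0 l c0 R K F Fn D c \<longleftrightarrow>
     dep_closed R \<and> R0 \<subseteq> R \<and> c = c0 + card (R - R0) \<and>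
     (\<forall>R''. dep_closed R'' \<longrightarrow> R0 \<subseteq> R'' \<longrightarrow> Q0 \<in> R'' \<longrightarrow> R \<subseteq> R'') \<and>
     (\<forall>X\<in>R - R0. \<forall>k. X \<in> prisms k \<longrightarrow> k < l) \<and>
     K \<union> F \<union> Fn \<subseteq> leaves R \<inter> patch Q0 \<and> K \<inter> F = {} \<and> (K \<union> F) \<inter> Fn = {} \<and> Q0 \<in> K \<union> F \<and>
     (\<forall>Q'\<in>K. coarse_deps Q' \<subseteq> R) \<and> (K \<noteq> {} \<longrightarrow> patch Q0 \<subseteq> K \<union> F) \<and>
     (\<forall>Q' Q''. (Q', Q'') \<in> D \<longrightarrow> Q'' \<in> Fn \<or> Q'' \<in> R)"

lemma call_invD:
  assumes "call_inv R0 Q0 l c0 R K F Fn D c"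
  shows "dep_closed R" "R0 \<subseteq> R" "c = c0 + card (R - R0)"
    "\<And>R''. dep_closed R'' \<Longrightarrow> R0 \<subseteq> R'' \<Longrightarrow> Q0 \<in> R'' \<Longrightarrow> R \<subseteq> R''"
    "\<And>X k. X \<in> R \<Longrightarrow> X \<notin> R0 \<Longrightarrow> X \<in> prisms k \<Longrightarrow> k < l"
    "K \<union> F \<union> Fn \<subseteq> leaves R" "K \<union> F \<union> Fn \<subseteq> patch Q0" "K \<inter> F = {}" "(K \<union> F) \<inter> Fn = {}" "Q0 \<in> K \<union> F"
    "\<And>Q'. Q' \<in> K \<Longrightarrow> coarse_deps Q' \<subseteq> R" "K \<noteq> {} \<Longrightarrow> patch Q0 \<subseteq> K \<union> F"
    "\<And>Q' Q''. (Q', Q'') \<in> D \<Longrightarrow> Q'' \<in> Fn \<or> Q'' \<in> R"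
  using assms unfolding call_inv_def by blast+

lemma call_invI:
  assumes "dep_closed R" "R0 \<subseteq> R" "c = c0 + card (R - R0)"
    "\<And>R''. dep_closed R'' \<Longrightarrow> R0 \<subseteq> R'' \<Longrightarrow> Q0 \<in> R'' \<Longrightarrow> R \<subseteq> R''"
    "\<And>X k. X \<in> R \<Longrightarrow> X \<notin> R0 \<Longrightarrow> X \<in> prisms k \<Longrightarrow> k < l"
    "K \<union> F \<union> Fn \<subseteq> leaves R" "K \<union> F \<union> Fn \<subseteq> patch Q0" "K \<inter> F = {}" "(K \<union> F) \<inter> Fn = {}" "Q0 \<in> K \<union> F"
    "\<And>Q'. Q' \<in> K \<Longrightarrow> coarse_deps Q' \<subseteq> R" "K \<noteq> {} \<Longrightarrow> patch Q0 \<subseteq> K \<union> F"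
    "\<And>Q' Q''. (Q', Q'') \<in> D \<Longrightarrow> Q'' \<in> Fn \<or> Q'' \<in> R"
  shows "call_inv R0 Q0 l c0 R K F Fn D c"
  unfolding call_inv_def using assms(1-3,8-10,12)
proof (intro conjI)
  show "\<forall>R''. dep_closed R'' \<longrightarrow> R0 \<subseteq> R'' \<longrightarrow> Q0 \<in> R'' \<longrightarrow> R \<subseteq> R''" using assms(4) by blast
  show "\<forall>X\<in>R - R0. \<forall>k. X \<in> prisms k \<longrightarrow> k < l" using assms(5) by blast
  show "K \<union> F \<union> Fn \<subseteq> leaves R \<inter> patch Q0" using assms(6,7) by blast
  show "\<forall>Q'\<in>K. coarse_deps Q' \<subseteq> R" using assms(11) by blast
  show "\<forall>Q' Q''. (Q', Q'') \<in> D \<longrightarrow> Q'' \<in> Fn \<or> Q'' \<in> R" using assms(13) by blast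
qed simp_all

lemma neighbour_same_level:
  assumes R: "lower R" and Q: "Q \<in> leaves R" "Q \<in> prisms l" and Y: "Y \<in> nbrs \<T>\<^sub>0 (leaves R) Q" "Y \<in> prisms l"
  shows "Y \<in> patch Q" "Y \<in> leaves R"
proof -
  have "Y \<notin> coarse_deps Q" using coarse_deps_iff[OF Q(2) Y(2)] by simp
  then obtain X where X: "Y \<in> leaves R" "X \<in> patch Q" "below X Y" using Y(1) nbrs_eq[OF R Q(1)] by blast
  have "X \<in> prisms l" using X(2) by (simp add: patch_eq[OF Q(2)])
  then have "Y = X" using anc_same_level[OF _ Y(2) X(3)] by simp
  then show "Y \<in> patch Q" "Y \<in> leaves R" using X by simp_all
qed

text \<open>A neighbour that is coarser by two or more levels is never treated: there is then also one
  that is coarser by one level, and it is preferred.\<close>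

lemma candidate_near:
  assumes inv: "call_inv R0 Q0 l c0 R K F Fn D c" and Q0: "Q0 \<in> prisms l"
    and cand: "(Q', Q'') \<in> candidates \<T>\<^sub>0 (pending \<T>\<^sub>0 (leaves R) K F D)" and ne: "level \<T>\<^sub>0 Q'' \<noteq> level \<T>\<^sub>0 Q'"
  obtains m where "Q'' \<in> prisms m" "Suc m = l" "Q'' \<in> leaves R"
    "\<And>R''. dep_closed R'' \<Longrightarrow> Q' \<in> R'' \<Longrightarrow> Q'' \<in> R''"
proof -
  note D = call_invD[OF inv]
  note lowR = dep_closed_lower[OF D(1)]
  have pl: "Y \<in> prisms l" if "Y \<in> patch Q0" for Y using that by (simp add: patch_eq[OF Q0])
  have "(Q', Q'') \<in> pending \<T>\<^sub>0 (leaves R) K F D" using cand candidates_subset by blast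
  then have Q': "Q' \<in> F" and Q'': "Q'' \<in> nbrs \<T>\<^sub>0 (leaves R) Q'" by (auto simp: pending_def)
  have Q'l: "Q' \<in> leaves R" "Q' \<in> prisms l" using Q' D(6,7) pl by blast+
  have or: "Q'' \<in> leaves R \<and> (Q'' \<in> coarse_deps Q' \<or> (\<exists>X\<in>patch Q'. below X Q''))"
    using Q'' nbrs_eq[OF lowR Q'l(1)] by blast
  then have Q''leaf: "Q'' \<in> leaves R" by simp
  obtain k where k: "Q'' \<in> prisms k" using leavesD(1)[OF Q''leaf] by (rule nodesE)
  have lev: "level \<T>\<^sub>0 Q' = l" "level \<T>\<^sub>0 Q'' = k" using level_prism Q'l(2) k by auto
  have forced: "Q'' \<in> R''" if R'': "dep_closed R''" "Q' \<in> R''" for R''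
    using or
  proof (elim conjE disjE)
    assume "Q'' \<in> coarse_deps Q'"
    then show ?thesis using R'' by (auto simp: dep_closed_def)
  next
    assume "\<exists>X\<in>patch Q'. below X Q''"
    then obtain X where "X \<in> patch Q'" "below X Q''" by blast
    then show ?thesis using dep_closed_patch[OF R''] lower_above[OF dep_closed_lower[OF R''(1)] _ k] by blast
  qed
  have "k + 1 = l"
    using or
  proof (elim conjE disjE)
    assume "Q'' \<in> coarse_deps Q'"
    then show ?thesis using coarse_deps_iff[OF Q'l(2) k] by simp
  next
    assume "\<exists>X\<in>patch Q'. below X Q''"
    then obtain X where X: "X \<in> patch Q'" "below X Q''" by blast
    have "X \<in> prisms l" using X(1) by (simp add: patch_eq[OF Q'l(2)])
    then have "k \<le> l" using level_mono k X(2) by blast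
    then have kl: "k < l" using ne lev by simp
    show ?thesis
    proof (rule ccontr)
      assume far: "k + 1 \<noteq> l"
      obtain L m where L: "L \<in> leaves R" "L \<in> prisms m" "Suc m = l" "L \<in> nbrs \<T>\<^sub>0 (leaves R) Q'"
        by (rule near_neighbour[OF D(1) Q'l Q''leaf k kl X])
      define near where "near = {(Q', Q'') \<in> pending \<T>\<^sub>0 (leaves R) K F D. level \<T>\<^sub>0 Q' \<le> level \<T>\<^sub>0 Q'' + 1}"
      have nl: "L \<notin> prisms l" using prism_level_unique[OF L(2), of l] L(3) by auto
      then have "L \<notin> K \<union> F \<union> Fn" using D(7) pl by blast
      moreover have "L \<notin> R" using leavesD(2)[OF L(1)] .
      ultimately have "(Q', L) \<in> pending \<T>\<^sub>0 (leaves R) K F D"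
        using D(13)[of Q' L] Q' L(4) unfolding pending_def by blast
      moreover have "level \<T>\<^sub>0 Q' \<le> level \<T>\<^sub>0 L + 1" using level_prism[OF L(2)] lev L(3) by simp
      ultimately have "(Q', L) \<in> near" by (simp add: near_def)
      then have "near \<noteq> {}" by blast
      then have "candidates \<T>\<^sub>0 (pending \<T>\<^sub>0 (leaves R) K F D) = near"
        unfolding candidates_def Let_def near_def[symmetric] by simp
      then have "(Q', Q'') \<in> near" using cand by simp
      then have "level \<T>\<^sub>0 Q' \<le> level \<T>\<^sub>0 Q'' + 1" by (simp add: near_def)
      then have "l \<le> k + 1" using lev by simp
      then show False using far kl by simp
    qed
  qed
  then show ?thesis using that[OF k _ Q''leaf forced] by simp
qed

lemma call_inv_recursive:
  assumes inv: "call_inv R0 Q0 l c0 R K F Fn D c" and Q0: "Q0 \<in> prisms l"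
    and Q': "Q' \<in> F" and Q'': "Q'' \<in> prisms m" "Suc m = l" "Q'' \<in> leaves R"
    and forced: "\<And>R''. dep_closed R'' \<Longrightarrow> Q' \<in> R'' \<Longrightarrow> Q'' \<in> R''"
    and ref: "refined R Q'' R1" and Fn1: "Fn1 \<subseteq> atomic_split \<T>\<^sub>0 s1 s2 Q'' \<inter> nbrs \<T>\<^sub>0 (leaves R1) Q'"
  shows "call_inv R0 Q0 l c0 R1 K F (Fn \<union> Fn1) (insert (Q', Q'') D) (c + card (R1 - R))"
proof -
  note D = call_invD[OF inv]
  have R1: "dep_closed R1" "R \<subseteq> R1" "Q'' \<in> R1"
    "\<And>R''. dep_closed R'' \<Longrightarrow> R \<subseteq> R'' \<Longrightarrow> Q'' \<in> R'' \<Longrightarrow> R1 \<subseteq> R''"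
    "\<And>X k. X \<in> R1 \<Longrightarrow> X \<notin> R \<Longrightarrow> X \<in> prisms k \<Longrightarrow> k \<le> m"
    using ref Q''(1) unfolding refined_def by blast+
  note low1 = dep_closed_lower[OF R1(1)]
  have fin: "finite R1" using low1 by (simp add: lower_def)
  have pl: "Y \<in> prisms l" if "Y \<in> patch Q0" for Y using that by (simp add: patch_eq[OF Q0])
  have pers: "Y \<in> leaves R1" if Y: "Y \<in> K \<union> F \<union> Fn" for Y
  proof -
    have Yl: "Y \<in> leaves R" "Y \<in> prisms l" using Y D(6,7) pl by blast+
    have "Y \<notin> R1" using R1(5)[OF _ leavesD(2)[OF Yl(1)] Yl(2)] Q''(2) by auto
    then show ?thesis using leaf_persists[OF Yl(1) R1(2)] by blast
  qed
  have Q'p: "Q' \<in> patch Q0" "Q' \<in> prisms l" "patch Q' = patch Q0" using Q' D(7) pl patch_mates_eq[OF Q0] by blast+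
  have new: "Y \<in> leaves R1 \<inter> patch Q0 \<and> Y \<notin> K \<union> F" if Y: "Y \<in> Fn1" for Y
  proof -
    have Y': "Y \<in> children Q''" "Y \<in> nbrs \<T>\<^sub>0 (leaves R1) Q'" using Y Fn1 split_eq[OF Q''(1)] by auto
    have Yl: "Y \<in> prisms l" using Y'(1) Q''(2) children_prisms[OF Q''(1)] by auto
    have "Y \<in> patch Q'" "Y \<in> leaves R1"
      using neighbour_same_level[OF low1 pers Q'p(2) Y'(2) Yl] Q' by blast+
    moreover have "Y \<notin> leaves R" using children_not_leaf[OF Q''(3) Y'(1)] .
    ultimately show ?thesis using Q'p(3) D(6) by blast
  qed
  have "card (R1 - R0) = card (R1 - R) + card (R - R0)"
  proof -
    have "R1 - R0 = (R1 - R) \<union> (R - R0)" "(R1 - R) \<inter> (R - R0) = {}" using R1(2) D(2) by auto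
    then show ?thesis using fin R1(2) by (simp add: card_Un_disjoint finite_subset)
  qed
  then have c: "c + card (R1 - R) = c0 + card (R1 - R0)" using D(3) by simp
  show ?thesis
  proof (rule call_invI[OF R1(1) subset_trans[OF D(2) R1(2)] c _ _ _ _ D(8) _ D(10) _ D(12)])
    show "R1 \<subseteq> R''" if R'': "dep_closed R''" "R0 \<subseteq> R''" "Q0 \<in> R''" for R''
      using R1(4)[OF R''(1) D(4)[OF R''] forced[OF R''(1) dep_closed_patch[OF R''(1,3) Q'p(1)]]] .
    show "k < l" if X: "X \<in> R1" "X \<notin> R0" "X \<in> prisms k" for X k
    proof (cases "X \<in> R")
      case True
      show ?thesis by (rule D(5)[OF True X(2,3)])
    next
      case False
      show ?thesis using R1(5)[OF X(1) False X(3)] Q''(2) by simp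
    qed
    show "K \<union> F \<union> (Fn \<union> Fn1) \<subseteq> leaves R1" "K \<union> F \<union> (Fn \<union> Fn1) \<subseteq> patch Q0" using pers D(7) new by blast+
    show "(K \<union> F) \<inter> (Fn \<union> Fn1) = {}" using D(9) new by blast
    show "coarse_deps Y \<subseteq> R1" if "Y \<in> K" for Y using D(11)[OF that] R1(2) by blast
    show "Y' \<in> Fn \<union> Fn1 \<or> Y' \<in> R1" if "(Y, Y') \<in> insert (Q', Q'') D" for Y Y'
      using that D(13)[of Y Y'] R1(2,3) by blast
  qed
qed

lemma call_inv_same_level:
  assumes inv: "call_inv R0 Q0 l c0 R K F Fn D c" and Q0: "Q0 \<in> prisms l"
    and pend: "(Q', Q'') \<in> pending \<T>\<^sub>0 (leaves R) K F D" and eq: "level \<T>\<^sub>0 Q'' = level \<T>\<^sub>0 Q'"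
  shows "call_inv R0 Q0 l c0 R K F (insert Q'' Fn) (insert (Q', Q'') D) c"
    "(Q', Q'') \<in> patch Q0 \<times> patch Q0 - D"
proof -
  note D = call_invD[OF inv]
  have pl: "Y \<in> prisms l" if "Y \<in> patch Q0" for Y using that by (simp add: patch_eq[OF Q0])
  have Q': "Q' \<in> F" "Q' \<in> leaves R" "Q' \<in> prisms l" "patch Q' = patch Q0" "Q' \<in> patch Q0"
  proof -
    show "Q' \<in> F" using pend by (simp add: pending_def)
    then show "Q' \<in> leaves R" "Q' \<in> patch Q0" using D(6,7) by blast+
    then show "Q' \<in> prisms l" "patch Q' = patch Q0" using pl patch_mates_eq[OF Q0] by blast+
  qed
  have Q'': "Q'' \<in> nbrs \<T>\<^sub>0 (leaves R) Q'" "Q'' \<notin> K \<union> F" using pend by (auto simp: pending_def)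
  then have "Q'' \<in> leaves R" by (auto simp: nbrs_def nbrs_t_def nbrs_x_def)
  then obtain k where k: "Q'' \<in> prisms k" using leavesD(1) by (blast elim: nodesE)
  then have "Q'' \<in> prisms l" using eq level_prism[OF k] level_prism[OF Q'(3)] by simp
  then have "Q'' \<in> patch Q0" "Q'' \<in> leaves R"
    using neighbour_same_level[OF dep_closed_lower[OF D(1)] Q'(2,3) Q''(1)] Q'(4) by blast+
  show "call_inv R0 Q0 l c0 R K F (insert Q'' Fn) (insert (Q', Q'') D) c"
  proof (rule call_invI[OF D(1-5) _ _ D(8) _ D(10-12)])
    show "K \<union> F \<union> insert Q'' Fn \<subseteq> leaves R" using D(6) \<open>Q'' \<in> leaves R\<close> by blast
    show "K \<union> F \<union> insert Q'' Fn \<subseteq> patch Q0" using D(7) \<open>Q'' \<in> patch Q0\<close> by blast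
    show "(K \<union> F) \<inter> insert Q'' Fn = {}" using D(9) Q''(2) by blast
    show "Y' \<in> insert Q'' Fn \<or> Y' \<in> R" if "(Y, Y') \<in> insert (Q', Q'') D" for Y Y'
      using that D(13)[of Y Y'] by blast
  qed
  show "(Q', Q'') \<in> patch Q0 \<times> patch Q0 - D" using pend Q'(5) \<open>Q'' \<in> patch Q0\<close> by (auto simp: pending_def)
qed

lemma call_inv_round:
  assumes inv: "call_inv R0 Q0 l c0 R K F Fn D c" and Q0: "Q0 \<in> prisms l"
    and F: "F \<noteq> {}" and pend: "pending \<T>\<^sub>0 (leaves R) K F D = {}"
  shows "call_inv R0 Q0 l c0 R (K \<union> F) Fn {} {} c"
proof -
  note D = call_invD[OF inv]
  note lowR = dep_closed_lower[OF D(1)]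
  have pl: "Y \<in> prisms l" if "Y \<in> patch Q0" for Y using that by (simp add: patch_eq[OF Q0])
  have nbr: "Y \<in> K \<union> F \<union> Fn" if Q': "Q' \<in> F" and Y: "Y \<in> nbrs \<T>\<^sub>0 (leaves R) Q'" for Q' Y
  proof (rule ccontr)
    assume n: "Y \<notin> K \<union> F \<union> Fn"
    have "Y \<in> leaves R" using Y by (auto simp: nbrs_def nbrs_t_def nbrs_x_def)
    then have "Y \<notin> R" by (rule leavesD(2))
    then have "(Q', Y) \<notin> D" using D(13)[of Q' Y] n by blast
    then have "(Q', Y) \<in> pending \<T>\<^sub>0 (leaves R) K F D" using Q' Y n by (simp add: pending_def)
    then show False using pend by blast
  qed
  have coarse_deps: "coarse_deps Q' \<subseteq> R" if Q': "Q' \<in> F" for Q'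
  proof
    fix Y assume Y: "Y \<in> coarse_deps Q'"
    have Q'l: "Q' \<in> leaves R" "Q' \<in> prisms l" using Q' D(6,7) pl by blast+
    show "Y \<in> R"
    proof (rule ccontr)
      assume "Y \<notin> R"
      then have L: "Y \<in> leaves R" using coarse_deps_leaf[OF D(1) Q'l(1)] Y by blast
      then have "Y \<in> nbrs \<T>\<^sub>0 (leaves R) Q'" using nbrs_eq[OF lowR Q'l(1)] Y by blast
      then have "Y \<in> prisms l" using nbr[OF Q'] D(7) pl by blast
      then show False using coarse_deps_iff[OF Q'l(2)] Y by simp
    qed
  qed
  have patch: "patch Q0 \<subseteq> K \<union> F \<union> Fn"
  proof
    fix X assume X: "X \<in> patch Q0"
    obtain Q' where Q': "Q' \<in> F" using F by blast
    have Q'l: "Q' \<in> leaves R" "Q' \<in> prisms l" "patch Q' = patch Q0" using Q' D(6,7) pl patch_mates_eq[OF Q0] by blast+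
    have "X \<notin> R"
    proof
      assume "X \<in> R"
      then have "patch X \<subseteq> R" using D(1) by (auto simp: dep_closed_def)
      moreover have "patch X = patch Q0" using patch_mates_eq[OF Q0 X] .
      ultimately have "Q' \<in> R" using D(7) Q' by blast
      then show False using leavesD(2)[OF Q'l(1)] by blast
    qed
    then obtain L where L: "L \<in> leaves R" "below X L" using leaf_above[OF nodesI[OF pl[OF X]]] by blast
    have "L \<in> K \<union> F \<union> Fn"
    proof (cases "L = Q'")
      case False
      then have "L \<in> nbrs \<T>\<^sub>0 (leaves R) Q'" using nbrs_eq[OF lowR Q'l(1)] L X Q'l(3) by blast
      then show ?thesis using nbr[OF Q'] by blast
    qed (use Q' in blast)
    moreover from this have "L \<in> prisms l" using D(7) pl by blast
    then have "L = X" using anc_same_level[OF pl[OF X] _ L(2)] by simp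
    ultimately show "X \<in> K \<union> F \<union> Fn" by simp
  qed
  have dsKF: "\<forall>Q'\<in>K \<union> F. coarse_deps Q' \<subseteq> R" using coarse_deps D(11) by blast
  show ?thesis
  proof (rule call_invI[OF D(1-5)])
    show "K \<union> F \<union> Fn \<union> {} \<subseteq> leaves R" "K \<union> F \<union> Fn \<union> {} \<subseteq> patch Q0" using D(6,7) by simp_all
    show "Q0 \<in> K \<union> F \<union> Fn" using D(10) by blast
    show "coarse_deps Q' \<subseteq> R" if "Q' \<in> K \<union> F" for Q' using dsKF that by blast
  qed (use D(9) patch in simp_all)
qed

lemma call_inv_return:
  assumes inv: "call_inv R0 Q0 l c0 R K {} Fn D c" and Q0: "Q0 \<in> prisms l"
  shows "refined R0 Q0 (R \<union> K)" "refine_all \<T>\<^sub>0 s1 s2 (leaves R) K = leaves (R \<union> K)"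
    "c + card K = c0 + card (R \<union> K - R0)"
proof -
  note D = call_invD[OF inv]
  note lowR = dep_closed_lower[OF D(1)]
  have K: "K = patch Q0" using D(7,10,12) by blast
  have KL: "K \<subseteq> leaves R" using D(6) by blast
  have pl: "Y \<in> prisms l" if "Y \<in> K" for Y using that K by (simp add: patch_eq[OF Q0])
  then have fK: "finite K" using finite_N finite_subset[of K "prisms l"] by blast
  note ref = refine_leaves[OF lowR KL fK]
  show "refine_all \<T>\<^sub>0 s1 s2 (leaves R) K = leaves (R \<union> K)" by (rule ref)
  have "coarse_deps Q \<subseteq> R \<union> K \<and> patch Q \<subseteq> R \<union> K" if "Q \<in> R \<union> K" for Q
  proof (cases "Q \<in> R")
    case True
    then have "coarse_deps Q \<subseteq> R" "patch Q \<subseteq> R" using D(1) by (simp_all add: dep_closed_def)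
    then show ?thesis by blast
  next
    case False
    then have "Q \<in> K" using that by simp
    then show ?thesis using D(11) patch_mates_eq[OF Q0] K by blast
  qed
  then have cl: "dep_closed (R \<union> K)" using ref(1) by (simp add: dep_closed_def)
  have lev: "k \<le> l" if X: "X \<in> R \<union> K - R0" "X \<in> prisms k" for X k
  proof (cases "X \<in> R")
    case True
    then show ?thesis using D(5)[of X k] X by auto
  next
    case False
    then have "X \<in> prisms l" using X(1) pl by blast
    then show ?thesis using prism_level_unique[OF X(2)] by simp
  qed
  have min: "R \<union> K \<subseteq> R''" if R'': "dep_closed R''" "R0 \<subseteq> R''" "Q0 \<in> R''" for R''
    using D(4)[OF R''] dep_closed_patch[OF R''(1,3)] K by blast
  have lev': "\<forall>n. Q0 \<in> prisms n \<longrightarrow> (\<forall>X\<in>R \<union> K - R0. \<forall>k. X \<in> prisms k \<longrightarrow> k \<le> n)"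
    using lev prism_level_unique[OF Q0] by blast
  show "refined R0 Q0 (R \<union> K)"
    unfolding refined_def using cl D(2,10) min lev' by blast
  have "K \<inter> R = {}" using KL leavesD(2) by blast
  then have "R \<union> K - R0 = (R - R0) \<union> K" "(R - R0) \<inter> K = {}" using D(2) by auto
  moreover have "finite R" using lowR by (simp add: lower_def)
  ultimately have "card (R \<union> K - R0) = card (R - R0) + card K" using fK by (simp add: card_Un_disjoint)
  then show "c + card K = c0 + card (R \<union> K - R0)" using D(3) by simp
qed

lemma call_good:
  assumes "dep_closed R0" "Q0 \<in> leaves R0" "Q0 \<in> prisms l"
    and "\<And>R1. refined R0 Q0 R1 \<Longrightarrow> good \<Phi> (resume st (leaves R1) (c0 + card (R1 - R0)))"
  shows "good \<Phi> (Running (leaves R0) c0 ({}, {Q0}, {}, {}) st)"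
  using assms
proof (induction l arbitrary: R0 Q0 c0 st rule: less_induct)
  case (less l)
  note Q0 = less.prems(3)
  define U where "U = (\<Union>k\<le>l. prisms k)"
  have finU: "finite U" using finite_N by (simp add: U_def)
  have finp: "finite (patch Q0)" using patch_mates_level[OF Q0] finite_N finite_subset by blast
  define ms where "ms = [\<lambda>x :: 'a prism set \<times> 'a prism set \<times> ('a prism \<times> 'a prism) set. card (patch Q0 - fst (snd x)),
    \<lambda>x. card (U - fst x), \<lambda>x. card (patch Q0 \<times> patch Q0 - snd (snd x))]"
  have loop: "good \<Phi> (Running (leaves R) c (K, F, Fn, D) st)"
    if "call_inv R0 Q0 l c0 R K F Fn D c" "x = (R, K, D)" for x R K F Fn D c
    using that
  proof (induction x arbitrary: R K F Fn D c rule: wf_induct_rule[OF wf_measures[of ms]])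
    case (1 x)
    note inv = 1(2)
    note I = call_invD[OF inv]
    have IH: "good \<Phi> (Running (leaves R') c' (K', F', Fn', D') st)"
      if "call_inv R0 Q0 l c0 R' K' F' Fn' D' c'"
        "card (patch Q0 - K') < card (patch Q0 - K) \<or> card (patch Q0 - K') = card (patch Q0 - K) \<and>
          (card (U - R') < card (U - R) \<or> card (U - R') = card (U - R) \<and>
            card (patch Q0 \<times> patch Q0 - D') < card (patch Q0 \<times> patch Q0 - D))" for R' K' F' Fn' D' c'
      by (rule 1(1)[OF _ that(1) refl]) (use that(2) 1(3) in \<open>simp add: ms_def\<close>)
    show ?case
    proof (rule goodI)
      fix cf' assume "patch_step \<T>\<^sub>0 s1 s2 (Running (leaves R) c (K, F, Fn, D) st) cf'"
      then show "good \<Phi> cf'"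
      proof (cases rule: patch_step_RunningE)
        case (same Q' Q'')
        have "(Q', Q'') \<in> pending \<T>\<^sub>0 (leaves R) K F D" using same(1) candidates_subset by blast
        note inv' = call_inv_same_level[OF inv Q0 this same(2)]
        have "patch Q0 \<times> patch Q0 - insert (Q', Q'') D \<subset> patch Q0 \<times> patch Q0 - D" using inv'(2) by blast
        then have "card (patch Q0 \<times> patch Q0 - insert (Q', Q'') D) < card (patch Q0 \<times> patch Q0 - D)"
          using finp by (intro psubset_card_mono) auto
        then show ?thesis unfolding same(3) by (intro IH[OF inv'(1)]) simp
      next
        case (recursive Q' Q'')
        obtain m where Q'': "Q'' \<in> prisms m" "Suc m = l" "Q'' \<in> leaves R"
          and forced: "\<And>R''. dep_closed R'' \<Longrightarrow> Q' \<in> R'' \<Longrightarrow> Q'' \<in> R''"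
          by (rule candidate_near[OF inv Q0 recursive(1,2)]) (rule that)
        have Q': "Q' \<in> F" using recursive(1) candidates_subset unfolding pending_def by blast
        show ?thesis
          unfolding recursive(3)
        proof (rule less.IH[OF _ I(1) Q''(3,1)])
          show "m < l" using Q''(2) by simp
          fix R1 assume ref: "refined R Q'' R1"
          define Fn1 where "Fn1 = (if Q'' \<in> nbrs_x \<T>\<^sub>0 (leaves R) Q' then atomic_split \<T>\<^sub>0 s1 s2 Q'' \<inter> nbrs \<T>\<^sub>0 (leaves R1) Q' else {})"
          have "Fn1 \<subseteq> atomic_split \<T>\<^sub>0 s1 s2 Q'' \<inter> nbrs \<T>\<^sub>0 (leaves R1) Q'" by (simp add: Fn1_def)
          note inv' = call_inv_recursive[OF inv Q0 Q' Q'' forced ref this]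
          have "R \<subseteq> R1" "Q'' \<in> R1" using ref by (auto simp: refined_def)
          moreover have "Q'' \<notin> R" using leavesD(2)[OF Q''(3)] .
          moreover have "Q'' \<in> U" using Q''(1,2) by (auto simp: U_def)
          ultimately have "U - R1 \<subset> U - R" by blast
          then have dec: "card (U - R1) < card (U - R)" using finU by (intro psubset_card_mono) auto
          have "good \<Phi> (Running (leaves R1) (c + card (R1 - R)) (K, F, Fn \<union> Fn1, insert (Q', Q'') D) st)"
            by (rule IH[OF inv' disjI2[OF conjI[OF refl disjI1[OF dec]]]])
          then show "good \<Phi> (resume (((K, F, Fn, insert (Q', Q'') D), leaves R, Q', Q'') # st) (leaves R1) (c + card (R1 - R)))"
            by (simp add: Fn1_def)
        qed
      next
        case round
        have "F \<subseteq> patch Q0" "K \<inter> F = {}" using I(7,8) by auto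
        then have "patch Q0 - (K \<union> F) \<subset> patch Q0 - K" using round(1) by blast
        then have "card (patch Q0 - (K \<union> F)) < card (patch Q0 - K)" using finp by (intro psubset_card_mono) auto
        then show ?thesis unfolding round(3) by (intro IH[OF call_inv_round[OF inv Q0 round(1,2)]]) simp
      next
        case return
        note ret = call_inv_return[OF inv[unfolded return(1)] Q0]
        show ?thesis unfolding return(2) ret(2,3) by (rule less.prems(4)[OF ret(1)])
      qed
    qed simp
  qed
  have "call_inv R0 Q0 l c0 R0 {} {Q0} {} {} c0"
    unfolding call_inv_def using less.prems(1,2) patch_mates_self[OF Q0] by simp
  then show ?case using loop by blast
qed

lemma new_leaf_level:
  assumes R: "refined R Q R1" "dep_closed R" and Q: "Q \<in> prisms l" and L: "L \<in> leaves R1" "L \<notin> leaves R" "L \<in> prisms k"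
  shows "k \<le> l + 1"
proof (cases k)
  case (Suc j)
  have low1: "lower R1" using R(1) dep_closed_lower by (simp add: refined_def)
  have sub: "R \<subseteq> R1" using R(1) by (simp add: refined_def)
  obtain P where P: "P \<in> prisms j" "below L P" "P \<in> R1" using parent[OF L(1)] L(3) Suc by blast
  have "P \<notin> R"
  proof
    assume "P \<in> R"
    then have "A \<in> R" if "A \<in> nodes" "below L A" "A \<noteq> L" for A
      using lowerD[OF dep_closed_lower[OF R(2)] _ that(1)] child_anc[OF P(1) _ P(2) that] L(3) Suc by blast
    moreover have "L \<notin> R" using leavesD(2)[OF L(1)] sub by blast
    ultimately have "L \<in> leaves R" using leavesD(1)[OF L(1)] by (auto simp: leaves_def)
    then show False using L(2) by blast
  qed
  then have "j \<le> l" using R(1) P Q unfolding refined_def by blast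
  then show ?thesis using Suc by simp
qed simp

end

theorem theorem3p10:
  fixes \<Omega> :: "'a::euclidean_space set" and T s1 s2 :: real
    and M :: nat and t :: "nat \<Rightarrow> real" and \<T>\<^sub>0 :: "'a tsimplex set"
    and P :: "'a prism set" and I :: "real set" and S :: "'a tsimplex"
  assumes "0 < T" and "0 < s1" and "0 < s2"
    and "polyhedral_lipschitz_domain \<Omega>"
    and "time_grid T M t"
    and "initial_triangulation \<Omega> \<T>\<^sub>0"
    and "admissible T \<Omega> (initial_intervals M t) \<T>\<^sub>0 s1 s2 P"
    and "(I, S) \<in> P"
  shows "patch_refine_terminates \<T>\<^sub>0 s1 s2 P (I, S) \<and>
    (\<exists>P' n. patch_refine \<T>\<^sub>0 s1 s2 P (I, S) P' n) \<and>
    (\<forall>P' n. patch_refine \<T>\<^sub>0 s1 s2 P (I, S) P' n \<longrightarrow>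
       admissible T \<Omega> (initial_intervals M t) \<T>\<^sub>0 s1 s2 P' \<and>
       (I, S) \<notin> P' \<and> (atomic_step \<T>\<^sub>0 s1 s2 ^^ n) P P' \<and>
       (\<forall>P'' k. admissible T \<Omega> (initial_intervals M t) \<T>\<^sub>0 s1 s2 P'' \<and>
          (I, S) \<notin> P'' \<and> (atomic_step \<T>\<^sub>0 s1 s2 ^^ k) P P'' \<longrightarrow> n \<le> k) \<and>
       (\<forall>Q \<in> P' - P. level \<T>\<^sub>0 Q \<le> level \<T>\<^sub>0 (I, S) + 1))"
proof -
  interpret space_time \<Omega> \<T>\<^sub>0 T M t s1 s2
    using assms(2-6) by unfold_locales (auto simp: polyhedral_lipschitz_domain_def)
  let ?Q = "(I, S)"
  have reach: "(atomic_step \<T>\<^sub>0 s1 s2)\<^sup>*\<^sup>* (initial_intervals M t \<times> \<T>\<^sub>0) P"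
    using assms(7) by (simp add: admissible_def)
  obtain R where lowR: "lower R" and P: "P = leaves R" using reach by (rule reachable_leaves)
  have R: "dep_closed R" using admissible_dep_closed[OF lowR] assms(7) P by simp
  have Q: "?Q \<in> leaves R" using assms(8) P by simp
  obtain l where l: "?Q \<in> prisms l" using leavesD(1)[OF Q] by (rule nodesE)
  define \<Phi> where "\<Phi> = (\<lambda>P' n. \<exists>R1. refined R ?Q R1 \<and> P' = leaves R1 \<and> n = card (R1 - R))"
  have "good \<Phi> (Running (leaves R) 0 ({}, {?Q}, {}, {}) [])"
  proof (rule call_good[OF R Q l])
    fix R1 assume ref: "refined R ?Q R1"
    have "good \<Phi> (Returned (leaves R1) (card (R1 - R)))"
    proof (rule goodI)
      fix cf assume "patch_step \<T>\<^sub>0 s1 s2 (Returned (leaves R1) (card (R1 - R))) cf"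
      then show "good \<Phi> cf" by (cases rule: patch_step.cases)
    qed (use ref in \<open>auto simp: \<Phi>_def\<close>)
    then show "good \<Phi> (resume [] (leaves R1) (0 + card (R1 - R)))" by simp
  qed
  then have good: "good \<Phi> (initial_config P ?Q)" by (simp add: initial_config_def P)
  have "admissible T \<Omega> (initial_intervals M t) \<T>\<^sub>0 s1 s2 P' \<and>
       ?Q \<notin> P' \<and> (atomic_step \<T>\<^sub>0 s1 s2 ^^ n) P P' \<and>
       (\<forall>P'' k. admissible T \<Omega> (initial_intervals M t) \<T>\<^sub>0 s1 s2 P'' \<and>
          ?Q \<notin> P'' \<and> (atomic_step \<T>\<^sub>0 s1 s2 ^^ k) P P'' \<longrightarrow> n \<le> k) \<and>
       (\<forall>X \<in> P' - P. level \<T>\<^sub>0 X \<le> level \<T>\<^sub>0 ?Q + 1)"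
    if "patch_refine \<T>\<^sub>0 s1 s2 P ?Q P' n" for P' n
  proof -
    have "\<Phi> P' n" using good_result[OF good] that by (simp add: patch_refine_def)
    then obtain R1 where ref: "refined R ?Q R1" and P': "P' = leaves R1" and n: "n = card (R1 - R)"
      by (auto simp: \<Phi>_def)
    have R1: "dep_closed R1" "R \<subseteq> R1" "?Q \<in> R1"
      and min: "\<And>R''. dep_closed R'' \<Longrightarrow> R \<subseteq> R'' \<Longrightarrow> ?Q \<in> R'' \<Longrightarrow> R1 \<subseteq> R''"
      using ref unfolding refined_def by blast+
    have steps: "(atomic_step \<T>\<^sub>0 s1 s2 ^^ n) P P'"
      unfolding P P' n by (rule lower_steps[OF lowR dep_closed_lower[OF R1(1)] R1(2)])
    then have "(atomic_step \<T>\<^sub>0 s1 s2)\<^sup>*\<^sup>* P P'" by (rule relpowp_imp_rtranclp)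
    then have "(atomic_step \<T>\<^sub>0 s1 s2)\<^sup>*\<^sup>* (initial_intervals M t \<times> \<T>\<^sub>0) (leaves R1)"
      using rtranclp_trans[OF reach] P' by blast
    then have adm: "admissible T \<Omega> (initial_intervals M t) \<T>\<^sub>0 s1 s2 P'"
      unfolding P' by (rule dep_closed_admissible[OF R1(1)])
    have notin: "?Q \<notin> P'" using leavesD(2) R1(3) P' by blast
    have "n \<le> k" if P'': "admissible T \<Omega> (initial_intervals M t) \<T>\<^sub>0 s1 s2 P''" "?Q \<notin> P''"
      "(atomic_step \<T>\<^sub>0 s1 s2 ^^ k) P P''" for P'' k
    proof -
      obtain R'' where R'': "lower R''" "R \<subseteq> R''" "card (R'' - R) = k" "P'' = leaves R''"
        using steps_leaves[OF lowR] P''(3) P by blast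
      have "?Q \<in> R''" using leaf_persists[OF Q R''(2)] P''(2) R''(4) by blast
      moreover have "dep_closed R''" using admissible_dep_closed[OF R''(1)] P''(1) R''(4) by simp
      ultimately have "R1 - R \<subseteq> R'' - R" using min R''(2) by blast
      moreover have "finite (R'' - R)" using R''(1) by (simp add: lower_def)
      ultimately show ?thesis unfolding n R''(3)[symmetric] by (rule card_mono[rotated])
    qed
    moreover have "level \<T>\<^sub>0 X \<le> level \<T>\<^sub>0 ?Q + 1" if X: "X \<in> P' - P" for X
    proof -
      have X': "X \<in> leaves R1" "X \<notin> leaves R" using X P P' by auto
      obtain k where k: "X \<in> prisms k" using leavesD(1)[OF X'(1)] by (rule nodesE)
      show ?thesis using new_leaf_level[OF ref R l X' k] level_prism[OF k] level_prism[OF l] by simp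
    qed
    ultimately show ?thesis using adm notin steps by blast
  qed
  moreover have "patch_refine_terminates \<T>\<^sub>0 s1 s2 P ?Q"
    unfolding patch_refine_terminates_def using good_no_infinite_run[OF good] .
  moreover have "\<exists>P' n. patch_refine \<T>\<^sub>0 s1 s2 P ?Q P' n"
    unfolding patch_refine_def using good_returns[OF good] .
  ultimately show ?thesis by blast
qed

end
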